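(* Let $S=\{\phi_e:X_{t(e)}\to X_{i(e)}\}_{e\in E}$ be a finitely primitive conformal graph directed Markov system (CGDMS), with scaling function $r:\widetilde{\Sigma}\to(0,1)$ and topological pressure $P$. Then for every $t\ge0$, $$P(t)=\lim_{n\to\infty}\frac1n\log\sum_{\omega\in\widetilde{\Sigma}^n}\ \prod_{k=0}^{n-1} r(\ldots,\omega_n,\ldots,\omega_{k+1})^t ,$$ where for each finite word $\omega=(\omega_n,\ldots,\omega_1)\in\widetilde{\Sigma}^n$, $(\ldots,\omega_n,\ldots,\omega_{k+1})\in\widetilde{\Sigma}$ denotes an arbitrarily chosen admissible left-infinite word whose rightmost $n-k$ letters are $\omega_n,\ldots,\omega_{k+1}$.
   Context: Graph and words. $(V,E)$ is a directed multigraph with finite vertex set $V$ and countable edge set $E$; $i(e)$ and $t(e)$ are the initial and terminal vertices of $e\in E$. The incidence matrix $A$ has $A_{e_1e_2}=1$ if $t(e_1)=i(e_2)$ and $A_{e_1e_2}=0$ otherwise. $\Sigma^n$ is the set of words $(\omega_1,\ldots,\omega_n)\in E^n$ with $A_{\omega_j\omega_{j+1}}=1$ for $1\le j\le n-1$. The dual space $\widetilde{\Sigma}$ is the set of left-infinite words $\omega=(\ldots,\omega_2,\omega_1)$ in $E$ with $A_{\omega_{j+1}\omega_j}=1$ for all $j\ge1$; $\widetilde{\Sigma}^n$ is the set of words $(\omega_n,\ldots,\omega_1)$ with $A_{\omega_{j+1}\omega_j}=1$ for $1\le j\le n-1$ (so $\widetilde{\Sigma}^n=\Sigma^n$ as sets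 of words, only the indexing differs). For $\omega\in\widetilde{\Sigma}$, $\omega|_n=(\omega_n,\ldots,\omega_1)$. GDMS. Fix $0<\lambda<1$. Given nonempty compact metric spaces $\{X_v\}_{v\in V}$, a graph directed Markov system (GDMS) is a collection of injective maps $S=\{\phi_e:X_{t(e)}\to X_{i(e)}\}_{e\in E}$, each with Lipschitz constant $\le\lambda$. For $(\omega_1,\ldots,\omega_n)\in\Sigma^n$ set $\phi_{\omega_1,\ldots,\omega_n}=\phi_{\omega_1}\circ\cdots\circ\phi_{\omega_n}:X_{t(\omega_n)}\to X_{i(\omega_1)}$ and let $\Delta_{\omega_1,\ldots,\omega_n}$ be its image; for a dual word $(\omega_n,\ldots,\omega_1)\in\widetilde{\Sigma}^n$ correspondingly $\phi_{\omega_n,\ldots,\omega_1}=\phi_{\omega_n}\circ\cdots\circ\phi_{\omega_1}:X_{t(\omega_1)}\to X_{i(\omega_n)}$, with image $\Delta_{\omega_n,\ldots,\omega_1}$. CGDMS. A GDMS is conformal (a CGDMS) if: (a) the $X_v$ are compact convex subsets of a common $\mathbb{R}^d$, $d\ge1$; (b) (open set condition) $\phi_{e_1}(\mathrm{int}\,X_{t(e_1)})\cap\phi_{e_2}(\mathrm{int}\,X_{t(e_2)})=\emptyset$ for all distinct $e_1,e_2\in E$; (c) for each $v\in V$ there is an open neighborhood $W_v$ of $X_v$ such that each $\phi_e$ extends to a $C^1$ conformal diffeomorphism of $W_{t(e)}$ into $W_{i(e)}$; (d) there are constants $C,\alpha>0$ with $\big||D\phi_e(x)|-|D\phi_e(y)|\big|\le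 C\,\|(D\phi_e)^{-1}\|^{-1}|x-y|^{\alpha}$ for all $e\in E$ and $x,y\in X_{t(e)}$, where $|D\phi_e(x)|$ is the norm of the derivative at $x$ and $\|\cdot\|$ is the supremum norm over $X_{t(e)}$. Finite primitivity: for some $n\ge1$ there is a finite set $\Lambda\subset\Sigma^n$ such that for all $e_1,e_2\in E$ there is $(\omega_1,\ldots,\omega_n)\in\Lambda$ with $(e_1,\omega_1,\ldots,\omega_n,e_2)\in\Sigma^{n+2}$. Scaling function. The sets $X_v$ have positive diameter. For $\omega\in\widetilde{\Sigma}$ set $r_1(\omega_1)=\mathrm{diam}(\phi_{\omega_1}(X_{t(\omega_1)}))/\mathrm{diam}(X_{t(\omega_1)})$ and $r_n(\omega|_n)=\mathrm{diam}(\Delta_{\omega_n,\ldots,\omega_1})/\mathrm{diam}(\Delta_{\omega_n,\ldots,\omega_2})$ for $n\ge2$. The scaling function is $r(\omega)=\lim_{n\to\infty}r_n(\omega|_n)$ (the limit exists for every $\omega\in\widetilde{\Sigma}$); by convention $r_n$ and $r$ are regarded as functions with values in $(0,1)$. Pressure. For $t\ge0$, $P(t)=\lim_{n\to\infty}\frac1n\log\sum_{\omega\in\Sigma^n}\|D\phi_\omega\|^t$, where $\|D\phi_\omega\|=\sup_x|D\phi_\omega(x)|$ over the domain $X_{t(\omega_n)}$ of $\phi_\omega$; the limit exists, and the value $+\infty$ is allowed. *)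

theory Defs
  imports "HOL-Analysis.Analysis" "Graph_Theory.Digraph"
begin

text \<open>
  The directed multigraph \<open>(V, E)\<close> is a \<^typ>\<open>('v, 'e) pre_digraph\<close> \<open>G\<close>, with
  \<open>i(e) = tail G e\<close> and \<open>t(e) = head G e\<close>.
\<close>

definition admissible :: "('v, 'e) pre_digraph \<Rightarrow> 'e \<Rightarrow> 'e \<Rightarrow> bool" where
  "admissible G e1 e2 \<longleftrightarrow> head G e1 = tail G e2"

text \<open>
  Words are lists read from left to right, so that \<open>words G n\<close> is both the set of
  \<open>(\<omega>\<^sub>1, \<dots>, \<omega>\<^sub>n)\<close> and the set of dual words \<open>(\<omega>\<^sub>n, \<dots>, \<omega>\<^sub>1)\<close>.
\<close>

definition words :: "('v, 'e) pre_digraph \<Rightarrow> nat \<Rightarrow> 'e list set" where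
  "words G n = {w. length w = n \<and> set w \<subseteq> arcs G \<and> successively (admissible G) w}"

text \<open>
  A left-infinite word \<open>(\<dots>, \<omega>\<^sub>2, \<omega>\<^sub>1)\<close> is a function on \<^typ>\<open>nat\<close> counting from \<open>0\<close>:
  \<open>\<omega> j\<close> is the letter \<open>\<omega>\<^sub>j\<^sub>+\<^sub>1\<close>, so \<open>\<omega> 0\<close> is the rightmost one.
\<close>

definition dual_space :: "('v, 'e) pre_digraph \<Rightarrow> (nat \<Rightarrow> 'e) set" where
  "dual_space G = {\<omega>. (\<forall>j. \<omega> j \<in> arcs G) \<and> (\<forall>j. admissible G (\<omega> (Suc j)) (\<omega> j))}"

text \<open>The dual word \<open>(\<omega>\<^sub>n, \<dots>, \<omega>\<^sub>1)\<close> of the rightmost \<open>n\<close> letters of \<open>\<omega>\<close>.\<close>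

definition trunc :: "(nat \<Rightarrow> 'e) \<Rightarrow> nat \<Rightarrow> 'e list" where
  "trunc \<omega> n = rev (map \<omega> [0..<n])"

definition finitely_primitive :: "('v, 'e) pre_digraph \<Rightarrow> bool" where
  "finitely_primitive G \<longleftrightarrow>
     (\<exists>n\<ge>1. \<exists>\<Lambda>. finite \<Lambda> \<and> \<Lambda> \<subseteq> words G n \<and>
       (\<forall>e1\<in>arcs G. \<forall>e2\<in>arcs G. \<exists>w\<in>\<Lambda>. e1 # w @ [e2] \<in> words G (n + 2)))"

text \<open>
  The spaces \<open>X v\<close> are subsets of one ambient metric space; only the values of \<open>\<phi> e\<close> on
  \<open>X (head G e)\<close> enter here.
\<close>

locale gdms = wf_digraph G
  for G :: "('v, 'e) pre_digraph" +
  fixes lam :: real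
    and X :: "'v \<Rightarrow> 'a::metric_space set"
    and \<phi> :: "'e \<Rightarrow> 'a \<Rightarrow> 'a"
  assumes finite_verts: "finite (verts G)"
    and countable_arcs: "countable (arcs G)"
    and lam_bounds: "0 < lam" "lam < 1"
    and compact_X: "v \<in> verts G \<Longrightarrow> compact (X v)"
    and nonempty_X: "v \<in> verts G \<Longrightarrow> X v \<noteq> {}"
    and maps_into: "e \<in> arcs G \<Longrightarrow> \<phi> e ` X (head G e) \<subseteq> X (tail G e)"
    and inj_map: "e \<in> arcs G \<Longrightarrow> inj_on (\<phi> e) (X (head G e))"
    and lipschitz_map: "e \<in> arcs G \<Longrightarrow> lam-lipschitz_on (X (head G e)) (\<phi> e)"

definition C1_on :: "('a::real_normed_vector \<Rightarrow> 'b::real_normed_vector) \<Rightarrow> 'a set \<Rightarrow> bool" where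
  "C1_on f U \<longleftrightarrow>
     (\<exists>f' :: 'a \<Rightarrow> 'a \<Rightarrow>\<^sub>L 'b. continuous_on U f' \<and>
        (\<forall>x\<in>U. (f has_derivative blinfun_apply (f' x)) (at x)))"

definition C1_diffeo_into ::
  "('a::real_normed_vector \<Rightarrow> 'b::real_normed_vector) \<Rightarrow> 'a set \<Rightarrow> 'b set \<Rightarrow> bool" where
  "C1_diffeo_into f U U' \<longleftrightarrow>
     f ` U \<subseteq> U' \<and> inj_on f U \<and> open (f ` U) \<and> C1_on f U \<and> C1_on (inv_into U f) (f ` U)"

abbreviation fderiv ::
  "('a::real_normed_vector \<Rightarrow> 'b::real_normed_vector) \<Rightarrow> 'a \<Rightarrow> 'a \<Rightarrow> 'b" where
  "fderiv f x \<equiv> frechet_derivative f (at x)"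

text \<open>
  Conformal: the derivative at every point is a positive multiple of an orthogonal map;
  orientation need not be preserved.
\<close>

definition conformal_on :: "('a::real_inner \<Rightarrow> 'a) \<Rightarrow> 'a set \<Rightarrow> bool" where
  "conformal_on f U \<longleftrightarrow>
     (\<forall>x\<in>U. \<exists>c>0. \<exists>Q. orthogonal_transformation Q \<and> fderiv f x = (\<lambda>h. c *\<^sub>R Q h))"

text \<open>
  The function \<open>\<phi> e\<close> is total, and its values on the neighbourhood \<open>W (head G e)\<close> of
  \<open>X (head G e)\<close> are those of the conformal extension of \<open>\<phi>\<^sub>e\<close>, so that derivatives at
  points of \<open>X (head G e)\<close> are ordinary two-sided ones.
\<close>

locale cgdms = gdms G lam X \<phi>
  for G :: "('v, 'e) pre_digraph"
    and lam :: real
    and X :: "'v \<Rightarrow> (real ^ 'd) set"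
    and \<phi> :: "'e \<Rightarrow> real ^ 'd \<Rightarrow> real ^ 'd" +
  assumes convex_X: "v \<in> verts G \<Longrightarrow> convex (X v)"
    and open_set_condition:
      "\<lbrakk>e1 \<in> arcs G; e2 \<in> arcs G; e1 \<noteq> e2\<rbrakk> \<Longrightarrow>
         \<phi> e1 ` interior (X (head G e1)) \<inter> \<phi> e2 ` interior (X (head G e2)) = {}"
    and conformal_extension:
      "\<exists>W. (\<forall>v\<in>verts G. open (W v) \<and> X v \<subseteq> W v) \<and>
           (\<forall>e\<in>arcs G. C1_diffeo_into (\<phi> e) (W (head G e)) (W (tail G e)) \<and>
                       conformal_on (\<phi> e) (W (head G e)))"
    and derivative_hoelder:
      "\<exists>C>0. \<exists>\<alpha>>0. \<forall>e\<in>arcs G. \<forall>x\<in>X (head G e). \<forall>y\<in>X (head G e).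
         \<bar>onorm (fderiv (\<phi> e) x) - onorm (fderiv (\<phi> e) y)\<bar>
           \<le> C * inverse (SUP z\<in>X (head G e). onorm (inv (fderiv (\<phi> e) z))) * norm (x - y) powr \<alpha>"

definition word_map :: "('e \<Rightarrow> 'a \<Rightarrow> 'a) \<Rightarrow> 'e list \<Rightarrow> 'a \<Rightarrow> 'a" where
  "word_map \<phi> w = foldr (\<lambda>e f. \<phi> e \<circ> f) w id"

text \<open>The sets \<open>\<Delta>\<^sub>w\<close>; like the derivative norm below, meaningful only for \<open>w \<noteq> []\<close>.\<close>

definition word_image ::
  "('v, 'e) pre_digraph \<Rightarrow> ('v \<Rightarrow> 'a set) \<Rightarrow> ('e \<Rightarrow> 'a \<Rightarrow> 'a) \<Rightarrow> 'e list \<Rightarrow> 'a set" where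
  "word_image G X \<phi> w = word_map \<phi> w ` X (head G (last w))"

text \<open>In \<open>\<omega>\<^sub>n, \<dots>, \<omega>\<^sub>1\<close> the letter dropped in the denominator is \<open>\<omega>\<^sub>1\<close>, the last one of the list.\<close>

definition scaling_ratio ::
  "('v, 'e) pre_digraph \<Rightarrow> ('v \<Rightarrow> 'a::metric_space set) \<Rightarrow> ('e \<Rightarrow> 'a \<Rightarrow> 'a) \<Rightarrow> 'e list \<Rightarrow> real" where
  "scaling_ratio G X \<phi> w =
     (if length w = 1
      then diameter (word_image G X \<phi> w) / diameter (X (head G (last w)))
      else diameter (word_image G X \<phi> w) / diameter (word_image G X \<phi> (butlast w)))"

definition scaling_function ::
  "('v, 'e) pre_digraph \<Rightarrow> ('v \<Rightarrow> 'a::metric_space set) \<Rightarrow> ('e \<Rightarrow> 'a \<Rightarrow> 'a) \<Rightarrow> (nat \<Rightarrow> 'e) \<Rightarrow> real" where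
  "scaling_function G X \<phi> \<omega> = lim (\<lambda>n. scaling_ratio G X \<phi> (trunc \<omega> n))"

definition ext_log :: "ennreal \<Rightarrow> ereal" where
  "ext_log x = (if x = 0 then -\<infinity> else if x = \<infinity> then \<infinity> else ereal (ln (enn2real x)))"

definition deriv_norm ::
  "('v, 'e) pre_digraph \<Rightarrow> ('v \<Rightarrow> 'a::real_normed_vector set) \<Rightarrow> ('e \<Rightarrow> 'a \<Rightarrow> 'a) \<Rightarrow> 'e list \<Rightarrow> real" where
  "deriv_norm G X \<phi> w = (SUP x\<in>X (head G (last w)). onorm (fderiv (word_map \<phi> w) x))"

definition pressure ::
  "('v, 'e) pre_digraph \<Rightarrow> ('v \<Rightarrow> 'a::real_normed_vector set) \<Rightarrow> ('e \<Rightarrow> 'a \<Rightarrow> 'a) \<Rightarrow> real \<Rightarrow> ereal" where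
  "pressure G X \<phi> t =
     lim (\<lambda>n. ereal (1 / real n) *
            ext_log (\<Sum>\<^sub>\<infinity>w\<in>words G n. ennreal (deriv_norm G X \<phi> w powr t)))"

end

theory Submission
  imports Defs
begin

text \<open>
  Write \<open>r\<close> for the scaling function and \<open>\<parallel>D\<phi>\<^sub>w\<parallel>\<close> for the derivative norm of a word \<open>w\<close> of
  length \<open>n\<close>. The diameter quotients of consecutive images telescope: with \<open>level_ratio\<close> for
  the quotient belonging to one more letter, the product over all prefixes of \<open>w\<close> is
  \<open>diam \<Delta>\<^sub>w / diam X\<close>, and \<open>diam \<Delta>\<^sub>w\<close> agrees with \<open>\<parallel>D\<phi>\<^sub>w\<parallel>\<close> up to a constant factor. On the other
  hand \<open>r\<close> is the uniform limit of these quotients, in the logarithmic sense. Replacing each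
  quotient by the value of \<open>r\<close> at any extension of the prefix to the left therefore costs a
  bounded factor for the boundedly many short prefixes and a factor \<open>exp \<epsilon>\<close> for each of the
  others. Hence the product of values of \<open>r\<close> lies between \<open>exp (- A - n \<epsilon>) \<parallel>D\<phi>\<^sub>w\<parallel>\<close> and
  \<open>exp (A + n \<epsilon>) \<parallel>D\<phi>\<^sub>w\<parallel>\<close> for every \<open>\<epsilon> > 0\<close> (\<open>prod_scaling_function_comparable\<close>); raised
  to the power \<open>t\<close>, this says that the two sums over words have the same exponential growth rate (\<open>growth_rate_transfer\<close>).

  Both facts about diameters follow from one statement: on sets of small diameter every word map
  is, uniformly in the word, a similarity up to a factor close to 1
  (\<open>word_map_near_similarity\<close>). The Hoelder condition on the derivatives makes the scale of
  \<open>\<phi>\<^sub>w\<close> almost constant on small sets (\<open>word_scale_distortion\<close>), and the mean value inequality on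
  the convex sets \<open>X\<^sub>v\<close> gives the upper bound for distances. The lower bound needs more, because
  images are not convex and a curve of constant speed may bend. In the relative interior of
  \<open>X\<^sub>v\<close> a map all of whose derivatives expand by at least \<open>m\<close>, onto the direction space of the
  target, expands distances locally by \<open>m\<close> (\<open>expansion_lower_bound\<close>). Thus, if the expansion
  factors lie between \<open>m\<close> and \<open>M\<close> with \<open>M / m\<close> close to 1, three equidistant points on a segment go
  to three almost equidistant points that are almost collinear, by the parallelogram law, and a
  bounded number of such steps keeps the image of a whole segment almost straight
  (\<open>almost_straight_image\<close>). Points near the relative boundary are first moved inwards by a small
  fraction of their distance. All of this takes place inside affine hulls, since the sets \<open>X\<^sub>v\<close> may
  have empty interior in \<open>\<real>\<^sup>d\<close>: primitivity forces the direction spaces at the two ends of an arc to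
  have equal dimension (\<open>arc_dim_eq\<close>), so that the derivatives map one onto the other.

  The pressure is a genuine limit. If the sum over the letters is finite, Fekete's lemma applies to
  the logarithms of the partition sums; if it is infinite, then so are all the partition sums,
  because by primitivity each letter extends to words of any length by finitely many continuations.
\<close>

section \<open>Maps with nearly constant expansion factor are nearly isometric\<close>

text \<open>
  A quantitative open mapping theorem. Given \<open>f y\<close> within distance \<open>m' \<rho>\<close> of \<open>f z\<close>, where
  \<open>m' < m\<close>, minimise \<open>norm (f x - f y) + m' * norm (x - z)\<close> over the relative ball around \<open>z\<close>. A
  minimiser with \<open>f x \<noteq> f y\<close> lies off the boundary of the ball and could be improved by
  moving in the direction that the derivative sends to \<open>f y - f x\<close>: the first term then
  decreases faster than the second one grows. So the minimum is attained at a preimage of \<open>f y\<close>,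
  which is \<open>y\<close> by injectivity, and comparing with the value at \<open>z\<close> gives the bound for \<open>m'\<close>.
\<close>

lemma expansion_lower_bound:
  fixes f :: "'a::euclidean_space \<Rightarrow> 'b::euclidean_space"
  assumes m: "m > 0"
    and ball: "\<And>l. l \<in> L \<Longrightarrow> norm l \<le> \<rho> \<Longrightarrow> z + l \<in> Y"
    and diff: "\<And>x y. x \<in> Y \<Longrightarrow> y \<in> Y \<Longrightarrow> x - y \<in> L"
    and L: "subspace L"
    and der: "\<And>x. x \<in> Y \<Longrightarrow> (f has_derivative F x) (at x)"
    and surj: "\<And>x y. x \<in> Y \<Longrightarrow> y \<in> Y \<Longrightarrow>
                 \<exists>h\<in>L. F x h = f y - f x \<and> m * norm h \<le> norm (f y - f x)"
    and inj: "inj_on f Y"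
    and z: "z \<in> Y" and y: "y \<in> Y" and \<rho>: "\<rho> > 0"
  shows "m * min \<rho> (norm (y - z)) \<le> norm (f y - f z)"
proof -
  have key: "m' * min \<rho> (norm (y - z)) \<le> norm (f y - f z)" if m': "0 < m'" "m' < m" for m'
  proof (cases "norm (f y - f z) < m' * \<rho>")
    case False
    have "m' * min \<rho> (norm (y - z)) \<le> m' * \<rho>" using m' by (intro mult_left_mono) auto
    then show ?thesis using False by linarith
  next
    case True
    define K where "K = (\<lambda>l. z + l) ` (L \<inter> cball 0 \<rho>)"
    have "compact (L \<inter> cball 0 \<rho>)"
      using L closed_subspace by (metis closed_Int_compact compact_cball)
    then have compact_K: "compact K" unfolding K_def by (intro compact_translation)
    have KY: "K \<subseteq> Y" using ball by (auto simp: K_def)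
    have K_iff: "x \<in> K \<longleftrightarrow> x - z \<in> L \<and> norm (x - z) \<le> \<rho>" for x
      by (force simp: K_def image_iff)
    have zK: "z \<in> K" using \<rho> subspace_0[OF L] by (simp add: K_iff)
    define \<Psi> where "\<Psi> = (\<lambda>x. norm (f x - f y) + m' * norm (x - z))"
    have contf: "continuous_on K f"
      using der KY by (meson has_derivative_continuous continuous_at_imp_continuous_on subsetD)
    have "continuous_on K \<Psi>" unfolding \<Psi>_def by (intro continuous_intros contf)
    then obtain x where x: "x \<in> K" and xmin: "\<And>x'. x' \<in> K \<Longrightarrow> \<Psi> x \<le> \<Psi> x'"
      using continuous_attains_inf[OF compact_K] zK by blast
    have x_le: "\<Psi> x \<le> norm (f y - f z)"
      using xmin[OF zK] by (simp add: \<Psi>_def norm_minus_commute)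
    have "m' * norm (x - z) < m' * \<rho>"
      using x_le True norm_ge_zero[of "f x - f y"] unfolding \<Psi>_def by linarith
    then have x_int: "norm (x - z) < \<rho>" using m' by simp
    have xY: "x \<in> Y" using x KY by auto
    have "f x = f y"
    proof (rule ccontr)
      assume ne: "f x \<noteq> f y"
      obtain h where h: "h \<in> L" "F x h = f y - f x" "m * norm h \<le> norm (f y - f x)"
        using surj[OF xY y] by blast
      define N where "N = norm (f y - f x)"
      have N: "N > 0" using ne by (simp add: N_def)
      have h0: "norm h \<le> N / m" using h(3) m by (simp add: N_def field_simps)
      \<comment> \<open>half of the rate at which the minimised function would decrease along \<open>h\<close>\<close>
      define \<kappa> where "\<kappa> = N * (1 - m' / m) / 2"
      have \<kappa>: "\<kappa> > 0" using N m' m by (simp add: \<kappa>_def)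
      have lim: "((\<lambda>s. f (x + s *\<^sub>R h)) has_derivative (\<lambda>s. s *\<^sub>R F x h)) (at 0)"
      proof -
        have lin: "bounded_linear (F x)" using der[OF xY] by (rule has_derivative_bounded_linear)
        have "((\<lambda>s. x + s *\<^sub>R h) has_derivative (\<lambda>s. s *\<^sub>R h)) (at (0::real))"
          by (auto intro!: derivative_eq_intros)
        moreover have "(f has_derivative F x) (at (x + 0 *\<^sub>R h))" using der[OF xY] by simp
        ultimately have "(f \<circ> (\<lambda>s. x + s *\<^sub>R h) has_derivative F x \<circ> (\<lambda>s. s *\<^sub>R h)) (at (0::real))"
          by (rule diff_chain_at)
        then show ?thesis
          by (simp add: o_def linear_cmul[OF bounded_linear.linear[OF lin]])
      qed
      obtain d where d: "d > 0" and dd: "\<And>s. norm s < d \<Longrightarrow>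
          norm (f (x + s *\<^sub>R h) - f x - s *\<^sub>R F x h) \<le> \<kappa> * norm s"
        using has_derivative_at_alt[THEN iffD1, OF lim] \<kappa> by (fastforce)
      define s where "s = Min {d / 2, 1 / 2, (\<rho> - norm (x - z)) / (norm h + 1)}"
      have s0: "s > 0" using d x_int by (auto simp: s_def Min_gr_iff intro!: divide_pos_pos add_nonneg_pos)
      have s1: "s \<le> d / 2" "s \<le> 1/2" "s \<le> (\<rho> - norm (x - z)) / (norm h + 1)"
        unfolding s_def by (rule Min_le; simp)+
      have "s * norm h \<le> s * (norm h + 1)" using s0 by simp
      also have "\<dots> \<le> \<rho> - norm (x - z)"
        using s1(3) by (subst (asm) pos_le_divide_eq) (auto simp: add_nonneg_pos)
      finally have sh: "s * norm h \<le> \<rho> - norm (x - z)" .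
      have tri: "norm (x + s *\<^sub>R h - z) \<le> norm (x - z) + s * norm h"
      proof -
        have "x + s *\<^sub>R h - z = (x - z) + s *\<^sub>R h" by simp
        then show ?thesis using norm_triangle_ineq[of "x - z" "s *\<^sub>R h"] s0 by (metis abs_of_pos norm_scaleR)
      qed
      have "x + s *\<^sub>R h - z = (x - z) + s *\<^sub>R h" by simp
      also have "\<dots> \<in> L" using x h(1) L by (intro subspace_add subspace_mul) (auto simp: K_iff)
      finally have "x + s *\<^sub>R h \<in> K" using tri sh by (simp add: K_iff)
      then have ge: "\<Psi> x \<le> \<Psi> (x + s *\<^sub>R h)" by (rule xmin)
      have "norm (f (x + s *\<^sub>R h) - f y)
          = norm ((f (x + s *\<^sub>R h) - f x - s *\<^sub>R F x h) - (1 - s) *\<^sub>R (f y - f x))"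
        unfolding h(2) by (simp add: algebra_simps)
      also have "\<dots> \<le> \<kappa> * s + (1 - s) * N"
      proof -
        have "norm (f (x + s *\<^sub>R h) - f x - s *\<^sub>R F x h) \<le> \<kappa> * s" using dd[of s] s0 s1 d by simp
        moreover have "norm ((1 - s) *\<^sub>R (f y - f x)) = (1 - s) * N" using s1 by (simp add: N_def)
        ultimately show ?thesis using norm_triangle_ineq4 by (smt (verit))
      qed
      finally have "\<Psi> (x + s *\<^sub>R h) \<le> \<kappa> * s + (1 - s) * N + m' * (norm (x - z) + s * norm h)"
        unfolding \<Psi>_def using tri m' by (intro add_mono mult_left_mono) auto
      moreover have "m' * (s * norm h) \<le> m' * (s * (N / m))"
        using h0 s0 m' by (intro mult_left_mono) auto
      moreover have "\<Psi> x = N + m' * norm (x - z)" by (simp add: \<Psi>_def N_def norm_minus_commute)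
      ultimately have "0 \<le> \<kappa> * s - s * N + m' * (s * (N / m))"
        using ge by (simp add: algebra_simps)
      also have "\<dots> = s * (\<kappa> - N * (1 - m' / m))" by (simp add: algebra_simps)
      also have "\<dots> = - (s * \<kappa>)" by (simp add: \<kappa>_def)
      finally show False using s0 \<kappa> by (simp add: mult_le_0_iff)
    qed
    then have "x = y" using inj xY y by (meson inj_onD)
    then have "m' * norm (y - z) \<le> norm (f y - f z)" using x_le by (simp add: \<Psi>_def)
    moreover have "m' * min \<rho> (norm (y - z)) \<le> m' * norm (y - z)"
      using m' by (intro mult_left_mono) auto
    ultimately show ?thesis by linarith
  qed
  show ?thesis
  proof (rule field_le_mult_one_interval)
    fix s :: real assume s: "0 < s" "s < 1"
    then have "(s * m) * min \<rho> (norm (y - z)) \<le> norm (f y - f z)"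
      using m by (intro key) auto
    then show "s * (m * min \<rho> (norm (y - z))) \<le> norm (f y - f z)" by (simp add: mult.assoc)
  qed
qed

text \<open>
  Two consecutive increments of length at most \<open>b\<close> whose sum has length at least \<open>2 * a\<close> differ by
  at most \<open>2 * sqrt (b\<^sup>2 - a\<^sup>2)\<close>, by the parallelogram law. All \<open>N\<close> increments are therefore close
  to the first one.
\<close>

lemma almost_constant_increments:
  fixes p :: "nat \<Rightarrow> 'a::real_inner"
  assumes up: "\<And>i. i < N \<Longrightarrow> norm (p (Suc i) - p i) \<le> b"
    and low: "\<And>i. Suc i < N \<Longrightarrow> 2 * a \<le> norm (p (i + 2) - p i)"
    and start: "N \<ge> 1" "a \<le> norm (p 1 - p 0)"
    and ab: "0 \<le> a" "a \<le> b"
  shows "norm (p N - p 0) \<ge> real N * (a - real N * (2 * sqrt (b\<^sup>2 - a\<^sup>2)))"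
proof -
  define \<kappa> where "\<kappa> = 2 * sqrt (b\<^sup>2 - a\<^sup>2)"
  have k0: "\<kappa> \<ge> 0" using ab by (simp add: \<kappa>_def power_mono)
  define v where "v = (\<lambda>i. p (Suc i) - p i)"
  have step: "norm (v (Suc i) - v i) \<le> \<kappa>" if "Suc i < N" for i
  proof -
    have "(norm (v (Suc i) - v i))\<^sup>2 = 2 * (norm (v (Suc i)))\<^sup>2 + 2 * (norm (v i))\<^sup>2 - (norm (v (Suc i) + v i))\<^sup>2"
      by (simp add: power2_norm_eq_inner inner_simps inner_commute)
    moreover have "(norm (v (Suc i)))\<^sup>2 \<le> b\<^sup>2" "(norm (v i))\<^sup>2 \<le> b\<^sup>2"
      using up that by (auto simp: v_def intro!: power_mono)
    moreover have "(2 * a)\<^sup>2 \<le> (norm (v (Suc i) + v i))\<^sup>2"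
      using low[OF that] ab by (intro power_mono) (auto simp: v_def)
    ultimately have "(norm (v (Suc i) - v i))\<^sup>2 \<le> 4 * (b\<^sup>2 - a\<^sup>2)" by (simp add: power_mult_distrib)
    also have "\<dots> = \<kappa>\<^sup>2" using ab by (simp add: \<kappa>_def power_mult_distrib power_mono)
    finally show ?thesis using k0 by (rule power2_le_imp_le)
  qed
  have dev: "norm (v i - v 0) \<le> real i * \<kappa>" if "i < N" for i
    using that
  proof (induction i)
    case (Suc i)
    have "v (Suc i) - v 0 = (v (Suc i) - v i) + (v i - v 0)" by simp
    then have "norm (v (Suc i) - v 0) \<le> norm (v (Suc i) - v i) + norm (v i - v 0)"
      using norm_triangle_ineq by metis
    then show ?case using step[of i] Suc by (simp add: algebra_simps)
  qed simp
  have "p N - p 0 = (\<Sum>i<N. v i)" unfolding v_def by (simp add: sum_lessThan_telescope)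
  also have "\<dots> = (\<Sum>i<N. v i - v 0) + real N *\<^sub>R v 0"
    by (simp add: sum_subtractf sum_constant_scaleR)
  finally have "norm (p N - p 0) \<ge> norm (real N *\<^sub>R v 0) - norm (\<Sum>i<N. v i - v 0)"
    by (metis add.commute norm_diff_ineq)
  moreover have "norm (\<Sum>i<N. v i - v 0) \<le> real N * (real N * \<kappa>)"
  proof -
    have "norm (\<Sum>i<N. v i - v 0) \<le> (\<Sum>i<N. real N * \<kappa>)"
    proof (rule sum_norm_le)
      fix i assume i: "i \<in> {..<N}"
      have "real i * \<kappa> \<le> real N * \<kappa>" using i k0 by (intro mult_right_mono) auto
      then show "norm (v i - v 0) \<le> real N * \<kappa>" using dev[of i] i by auto
    qed
    then show ?thesis by simp
  qed
  moreover have "norm (real N *\<^sub>R v 0) \<ge> real N * a"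
    using start by (auto simp: v_def intro!: mult_left_mono)
  ultimately show ?thesis unfolding \<kappa>_def[symmetric] by (simp add: algebra_simps)
qed

text \<open>
  The points \<open>x\<close> and \<open>y\<close> may lie on the relative boundary of \<open>X\<close>, where \<open>f\<close> is not known to
  expand. Contracting towards the centre \<open>z0\<close> by a factor \<open>1 - \<tau>\<close>, where \<open>\<tau>\<close> is proportional to
  \<open>norm (x - y)\<close>, turns the segment from \<open>x\<close> to \<open>y\<close> into one along which \<open>X\<close> contains relative balls
  of radius \<open>\<tau> * R\<close>. This radius is a fixed fraction of the length, so the number \<open>N\<close> of steps of
  half that radius does not depend on the scale. The last term of the bound pays for
  moving the endpoints.
\<close>

lemma almost_straight_image:
  fixes f :: "'a::euclidean_space \<Rightarrow> 'b::euclidean_space"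
  assumes X: "convex X" "z0 \<in> X" "\<And>l. l \<in> L \<Longrightarrow> norm l \<le> R \<Longrightarrow> z0 + l \<in> X"
      "\<And>x. x \<in> X \<Longrightarrow> norm (x - z0) \<le> D" "0 < R" "R \<le> D" "subspace L"
    and xy: "x \<in> X" "y \<in> X" "x \<noteq> y" "norm (x - y) \<le> D"
    and Y: "Y = X \<inter> cball x (3 * norm (x - y))"
    and lip: "\<And>a b. a \<in> Y \<Longrightarrow> b \<in> Y \<Longrightarrow> norm (f a - f b) \<le> M * norm (a - b)"
    and expand: "\<And>z \<rho> y. z \<in> Y \<Longrightarrow> \<rho> > 0 \<Longrightarrow> (\<And>l. l \<in> L \<Longrightarrow> norm l \<le> \<rho> \<Longrightarrow> z + l \<in> Y) \<Longrightarrow>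
                   y \<in> Y \<Longrightarrow> norm (y - z) \<le> \<rho> \<Longrightarrow> m * norm (y - z) \<le> norm (f y - f z)"
    and mM: "0 < m" "m \<le> M"
    and \<sigma>: "0 < \<sigma>" "\<sigma> \<le> 1"
    and N: "N \<ge> 1" "2 * D \<le> real N * \<sigma> * R"
  shows "norm (x - y) * ((1 - \<sigma>) * m - 2 * real N * sqrt (M\<^sup>2 - m\<^sup>2) - 2 * M * \<sigma>) \<le> norm (f x - f y)"
proof -
  define s where "s = norm (x - y)"
  have s: "s > 0" using xy by (simp add: s_def)
  have D: "D > 0" using X by linarith
  define \<tau> where "\<tau> = \<sigma> * s / D"
  have \<tau>0: "\<tau> > 0" using s D \<sigma> by (simp add: \<tau>_def)
  have "\<sigma> * s \<le> 1 * D" using \<sigma> xy s unfolding s_def by (intro mult_mono) auto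
  then have \<tau>1: "\<tau> \<le> 1" using D by (simp add: \<tau>_def)
  have "\<sigma> * s \<le> \<sigma> * D" using \<sigma> xy unfolding s_def by (intro mult_left_mono) auto
  then have \<tau>\<sigma>: "\<tau> \<le> \<sigma>" using D by (simp add: \<tau>_def field_simps)
  have \<tau>D: "\<tau> * D = \<sigma> * s" using D by (simp add: \<tau>_def)
  have \<sigma>s: "\<sigma> * s \<le> s" using \<sigma> s by simp
  define J where "J = (\<lambda>p. p + \<tau> *\<^sub>R (z0 - p))"
  have J_move: "norm (J p - p) \<le> \<sigma> * s" if "p \<in> X" for p
  proof -
    have "norm (J p - p) = \<tau> * norm (p - z0)" using \<tau>0 by (simp add: J_def norm_minus_commute)
    also have "\<dots> \<le> \<tau> * D" using X(4)[OF that] \<tau>0 by simp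
    finally show ?thesis using \<tau>D by simp
  qed
  define \<rho> where "\<rho> = \<tau> * R"
  have \<rho>0: "\<rho> > 0" using \<tau>0 X by (simp add: \<rho>_def)
  have "\<rho> \<le> \<tau> * D" unfolding \<rho>_def using \<tau>0 X by (intro mult_left_mono) auto
  then have \<rho>s: "\<rho> \<le> s" using \<tau>D \<sigma>s by simp
  have J_ball: "J p + l \<in> Y" if p: "p \<in> X" "norm (p - x) \<le> s" and l: "l \<in> L" "norm l \<le> \<rho>" for p l
  proof -
    have "norm (l /\<^sub>R \<tau>) \<le> R" using l \<tau>0 by (simp add: \<rho>_def field_simps)
    then have "z0 + l /\<^sub>R \<tau> \<in> X" using l X by (intro X(3)) (auto intro: subspace_mul)
    then have "(1 - \<tau>) *\<^sub>R p + \<tau> *\<^sub>R (z0 + l /\<^sub>R \<tau>) \<in> X"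
      using p \<tau>0 \<tau>1 X by (intro convexD) auto
    also have "(1 - \<tau>) *\<^sub>R p + \<tau> *\<^sub>R (z0 + l /\<^sub>R \<tau>) = J p + l"
      using \<tau>0 by (simp add: J_def algebra_simps)
    finally have "J p + l \<in> X" .
    moreover have "norm (J p + l - x) \<le> norm (J p - p) + norm l + norm (p - x)"
    proof -
      have e: "J p + l - x = (J p - p) + l + (p - x)" by simp
      show ?thesis unfolding e
        using norm_triangle_ineq[of "J p - p + l" "p - x"] norm_triangle_ineq[of "J p - p" l] by linarith
    qed
    then have "norm (J p + l - x) \<le> 3 * s"
      using J_move[OF p(1)] p l \<rho>s \<sigma>s by linarith
    ultimately show ?thesis by (simp add: Y s_def dist_norm norm_minus_commute)
  qed
  have J_Y: "J p \<in> Y" if "p \<in> X" "norm (p - x) \<le> s" for p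
    using J_ball[OF that, of 0] \<rho>0 X by (simp add: subspace_0)
  define h where "h = (1 - \<tau>) * s / real N"
  have h0: "h \<ge> 0" using \<tau>1 s by (simp add: h_def)
  define pp where "pp = (\<lambda>i. x + (real i / real N) *\<^sub>R (y - x))"
  have pp: "pp i \<in> X" "norm (pp i - x) \<le> s" if "i \<le> N" for i
  proof -
    have "(1 - real i / real N) *\<^sub>R x + (real i / real N) *\<^sub>R y \<in> X"
      using xy X that N by (intro convexD) auto
    then show "pp i \<in> X" by (simp add: pp_def algebra_simps)
    have "norm (pp i - x) = real i / real N * s" by (simp add: pp_def s_def norm_minus_commute)
    also have "\<dots> \<le> 1 * s" using that N s by (intro mult_right_mono) auto
    finally show "norm (pp i - x) \<le> s" by simp
  qed
  define p where "p = (\<lambda>i. J (pp i))"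
  have pY: "p i \<in> Y" if "i \<le> N" for i using J_Y pp that by (simp add: p_def)
  have p_diff: "norm (p (i + k) - p i) = real k * h" for i k
  proof -
    have "pp (i + k) - pp i = (real k / real N) *\<^sub>R (y - x)"
      unfolding pp_def by (simp add: add_divide_distrib scaleR_add_left)
    moreover have "J a - J b = (1 - \<tau>) *\<^sub>R (a - b)" for a b by (simp add: J_def algebra_simps)
    ultimately have "p (i + k) - p i = ((1 - \<tau>) * (real k / real N)) *\<^sub>R (y - x)"
      by (simp add: p_def)
    then have "norm (p (i + k) - p i) = \<bar>(1 - \<tau>) * (real k / real N)\<bar> * norm (y - x)" by simp
    also have "\<bar>(1 - \<tau>) * (real k / real N)\<bar> = (1 - \<tau>) * (real k / real N)" using \<tau>1 by simp
    finally show ?thesis by (simp add: h_def s_def norm_minus_commute)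
  qed
  have "2 * h \<le> 2 * s / real N"
  proof -
    have "(1 - \<tau>) * s \<le> 1 * s" using \<tau>0 s by (intro mult_right_mono) auto
    then have "2 * ((1 - \<tau>) * s) / real N \<le> 2 * s / real N" by (intro divide_right_mono) auto
    then show ?thesis unfolding h_def by simp
  qed
  also have "\<dots> \<le> \<rho>"
  proof -
    have "2 * D * s \<le> real N * \<sigma> * R * s" using N s by (intro mult_right_mono) auto
    then show ?thesis using N D unfolding \<rho>_def \<tau>_def by (simp add: field_simps)
  qed
  \<comment> \<open>two steps stay within one relative ball, so that \<open>expand\<close> applies to \<open>p i\<close> and \<open>p (i + 2)\<close>\<close>
  finally have h\<rho>: "2 * h \<le> \<rho>" .
  have ex: "m * (real k * h) \<le> norm (f (p (i + k)) - f (p i))" if "i + k \<le> N" "k \<le> 2" for i k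
  proof -
    have "real k * h \<le> 2 * h" using that h0 by (intro mult_right_mono) auto
    then have "norm (p (i + k) - p i) \<le> \<rho>" using h\<rho> p_diff by simp
    moreover have "\<And>l. l \<in> L \<Longrightarrow> norm l \<le> \<rho> \<Longrightarrow> p i + l \<in> Y"
      unfolding p_def using J_ball pp that by simp
    ultimately have "m * norm (p (i + k) - p i) \<le> norm (f (p (i + k)) - f (p i))"
      using that \<rho>0 by (intro expand pY) auto
    then show ?thesis by (simp add: p_diff)
  qed
  have "norm (f (p N) - f (p 0)) \<ge> real N * (m * h - real N * (2 * sqrt ((M * h)\<^sup>2 - (m * h)\<^sup>2)))"
  proof (rule almost_constant_increments[where p = "\<lambda>i. f (p i)"])
    show "norm (f (p (Suc i)) - f (p i)) \<le> M * h" if "i < N" for i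
      using lip[OF pY pY, of "Suc i" i] that p_diff[of i 1] by simp
    show "2 * (m * h) \<le> norm (f (p (i + 2)) - f (p i))" if "Suc i < N" for i
      using ex[of i 2] that by simp
    show "m * h \<le> norm (f (p 1) - f (p 0))" using ex[of 0 1] N by simp
    show "m * h \<le> M * h" using mM h0 by (intro mult_right_mono) auto
  qed (use N mM h0 in auto)
  also have "sqrt ((M * h)\<^sup>2 - (m * h)\<^sup>2) = h * sqrt (M\<^sup>2 - m\<^sup>2)"
  proof -
    have "(M * h)\<^sup>2 - (m * h)\<^sup>2 = h\<^sup>2 * (M\<^sup>2 - m\<^sup>2)" by (simp add: power_mult_distrib algebra_simps)
    then show ?thesis using h0 by (simp add: real_sqrt_mult)
  qed
  also have "real N * (m * h - real N * (2 * (h * sqrt (M\<^sup>2 - m\<^sup>2))))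
      = (1 - \<tau>) * s * (m - 2 * real N * sqrt (M\<^sup>2 - m\<^sup>2))"
    using N by (simp add: h_def field_simps)
  finally have main: "(1 - \<tau>) * s * (m - 2 * real N * sqrt (M\<^sup>2 - m\<^sup>2)) \<le> norm (f (p N) - f (p 0))" .
  define q where "q = 2 * real N * sqrt (M\<^sup>2 - m\<^sup>2)"
  have q0: "q \<ge> 0" using mM by (simp add: q_def power_mono)
  have "s * ((1 - \<sigma>) * m - q) \<le> (1 - \<tau>) * s * (m - q)"
  proof -
    have "(1 - \<sigma>) * m \<le> (1 - \<tau>) * m" using \<tau>\<sigma> mM by (intro mult_right_mono) auto
    moreover have "0 \<le> \<tau> * q" using \<tau>0 q0 by simp
    ultimately have "(1 - \<sigma>) * m - q \<le> (1 - \<tau>) * m - (1 - \<tau>) * q" by (simp add: algebra_simps)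
    then have "s * ((1 - \<sigma>) * m - q) \<le> s * ((1 - \<tau>) * m - (1 - \<tau>) * q)" using s by simp
    then show ?thesis by (simp add: algebra_simps)
  qed
  moreover have "norm (f (p N) - f (p 0)) \<le> norm (f x - f y) + 2 * (M * (\<sigma> * s))"
  proof -
    have e: "pp 0 = x" "pp N = y" using N by (auto simp: pp_def)
    have inY: "x \<in> Y" "y \<in> Y" using xy s by (auto simp: Y s_def dist_norm)
    have "norm (f (p 0) - f x) \<le> M * norm (p 0 - x)" "norm (f (p N) - f y) \<le> M * norm (p N - y)"
      using lip pY inY by auto
    moreover have "M * norm (p 0 - x) \<le> M * (\<sigma> * s)" "M * norm (p N - y) \<le> M * (\<sigma> * s)"
      using J_move[of x] J_move[of y] xy e mM by (auto simp: p_def intro!: mult_left_mono)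
    moreover have e': "f (p N) - f (p 0) = (f (p N) - f y) - (f (p 0) - f x) - (f x - f y)" by simp
    have "norm (f (p N) - f (p 0)) \<le> norm (f (p N) - f y) + norm (f (p 0) - f x) + norm (f x - f y)"
      unfolding e'
      using norm_triangle_ineq4[of "f (p N) - f y - (f (p 0) - f x)" "f x - f y"]
        norm_triangle_ineq4[of "f (p N) - f y" "f (p 0) - f x"] by linarith
    ultimately show ?thesis by linarith
  qed
  ultimately show ?thesis using main unfolding q_def[symmetric] s_def[symmetric]
    by (simp add: algebra_simps)
qed

text \<open>
  The order of choices matters: \<open>\<sigma>\<close> and then \<open>N\<close> are fixed by \<open>\<eta>\<close> and the shape constants, and
  only then is the admissible quotient \<open>q\<close> of the expansion factors taken so close to 1 that the
  bending accumulated over \<open>N\<close> steps stays below \<open>\<eta> / 4\<close>.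
\<close>

lemma almost_straight_parameters:
  fixes R D \<eta> :: real
  assumes RD: "0 < R" "R \<le> D" and \<eta>: "0 < \<eta>" "\<eta> < 1"
  shows "\<exists>\<sigma> N q. 0 < \<sigma> \<and> \<sigma> \<le> 1 \<and> (1::nat) \<le> N \<and> 2 * D \<le> real N * \<sigma> * R \<and> 1 < q \<and>
    (\<forall>m M. 0 < m \<longrightarrow> m \<le> M \<longrightarrow> M \<le> q * m \<longrightarrow>
       (1 - \<eta>) * m \<le> (1 - \<sigma>) * m - 2 * real N * sqrt (M\<^sup>2 - m\<^sup>2) - 2 * M * \<sigma>)"
proof -
  define \<sigma> where "\<sigma> = \<eta> / 8"
  obtain N0 :: nat where N0: "2 * D / (\<sigma> * R) \<le> real N0" using real_arch_simple by blast
  define N where "N = Suc N0"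
  have \<sigma>: "0 < \<sigma>" "\<sigma> \<le> 1" using \<eta> by (auto simp: \<sigma>_def)
  have N: "N \<ge> 1" "2 * D \<le> real N * \<sigma> * R"
  proof -
    have "2 * D / (\<sigma> * R) \<le> real N" using N0 by (simp add: N_def)
    then show "2 * D \<le> real N * \<sigma> * R" using \<sigma> RD by (simp add: field_simps)
  qed (simp add: N_def)
  define \<kappa> where "\<kappa> = \<eta> / (8 * real N)"
  have \<kappa>: "0 < \<kappa>" "\<kappa> \<le> 1" using \<eta> N by (auto simp: \<kappa>_def)
  define q where "q = sqrt (1 + \<kappa>\<^sup>2)"
  have q1: "q > 1" using \<kappa> by (simp add: q_def)
  have "\<kappa>\<^sup>2 \<le> 1" using \<kappa> by (simp add: power_le_one)
  then have q2: "q \<le> 2" unfolding q_def by (intro real_le_lsqrt) auto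
  have main: "(1 - \<eta>) * m \<le> (1 - \<sigma>) * m - 2 * real N * sqrt (M\<^sup>2 - m\<^sup>2) - 2 * M * \<sigma>"
    if m: "0 < m" "m \<le> M" "M \<le> q * m" for m M :: real
  proof -
    have "M\<^sup>2 \<le> (q * m)\<^sup>2" using m by (intro power_mono) auto
    also have "\<dots> = (1 + \<kappa>\<^sup>2) * m\<^sup>2" by (simp add: power_mult_distrib q_def)
    finally have "sqrt (M\<^sup>2 - m\<^sup>2) \<le> sqrt ((\<kappa> * m)\<^sup>2)" by (simp add: algebra_simps power_mult_distrib)
    then have "sqrt (M\<^sup>2 - m\<^sup>2) \<le> \<kappa> * m" using \<kappa> m by simp
    then have "2 * real N * sqrt (M\<^sup>2 - m\<^sup>2) \<le> 2 * real N * (\<kappa> * m)" by (intro mult_left_mono) auto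
    also have "\<dots> = \<eta> / 4 * m" using N by (simp add: \<kappa>_def)
    finally have 1: "2 * real N * sqrt (M\<^sup>2 - m\<^sup>2) \<le> \<eta> / 4 * m" .
    have "q * m \<le> 2 * m" using q2 m by (intro mult_right_mono) auto
    then have "M \<le> 2 * m" using m by linarith
    then have "M * \<sigma> \<le> 2 * m * \<sigma>" using \<sigma> by (intro mult_right_mono) auto
    then have 2: "2 * M * \<sigma> \<le> \<eta> / 2 * m" by (simp add: \<sigma>_def)
    have "0 < \<eta> * m" using \<eta> m by simp
    then show ?thesis using 1 2 by (simp add: \<sigma>_def algebra_simps)
  qed
  show ?thesis
    by (intro exI[of _ \<sigma>] exI[of _ N] exI[of _ q] conjI \<sigma> N q1 allI impI main)
qed

section \<open>Similarities and the direction space of a convex set\<close>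

lemma onorm_similarity:
  fixes F :: "'a::euclidean_space \<Rightarrow> 'b::real_normed_vector"
  assumes "c \<ge> 0" "\<And>h. norm (F h) = c * norm h"
  shows "onorm F = c"
proof -
  obtain b :: 'a where b: "b \<in> Basis" using nonempty_Basis by blast
  have "(SUP x. norm (F x) / norm x) = c"
  proof (rule cSup_eq_maximum)
    have "c = norm (F b) / norm b" using b assms(2)[of b] by simp
    then show "c \<in> range (\<lambda>x. norm (F x) / norm x)" by (rule image_eqI) simp
    fix y assume "y \<in> range (\<lambda>x. norm (F x) / norm x)"
    then obtain x where "y = norm (F x) / norm x" by blast
    then show "y \<le> c" using assms by (cases "x = 0") auto
  qed
  then show ?thesis by (simp add: onorm_def)
qed

text \<open>
  The linear subspace parallel to the affine hull of \<open>S\<close>.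
\<close>

definition direction_space :: "'a::euclidean_space set \<Rightarrow> 'a set" where
  "direction_space S = span {a - b |a b. a \<in> S \<and> b \<in> S}"

lemma subspace_direction_space [simp]: "subspace (direction_space S)"
  by (simp add: direction_space_def)

lemma diff_in_direction_space: "a \<in> S \<Longrightarrow> b \<in> S \<Longrightarrow> a - b \<in> direction_space S"
  unfolding direction_space_def by (rule span_base) blast

text \<open>
  The derivative in the direction \<open>a - x\<close> is a limit of difference quotients along the segment
  from \<open>x\<close> to \<open>a\<close>; these lie in the direction space of \<open>T\<close>, which is closed.
\<close>

lemma derivative_maps_directions:
  fixes f :: "'a::euclidean_space \<Rightarrow> 'b::euclidean_space"
  assumes S: "convex S" "f ` S \<subseteq> T" "x \<in> S" and der: "(f has_derivative F) (at x)"
  shows "F ` direction_space S \<subseteq> direction_space T"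
proof -
  have lin: "bounded_linear F" using der by (rule has_derivative_bounded_linear)
  then interpret F: linear F by (rule bounded_linear.linear)
  have ray: "F (a - x) \<in> direction_space T" if a: "a \<in> S" for a
  proof -
    have in_S: "x + s *\<^sub>R (a - x) \<in> S" if "0 \<le> s" "s \<le> 1" for s
    proof -
      have "(1 - s) *\<^sub>R x + s *\<^sub>R a \<in> S" using that a S by (intro convexD) auto
      then show ?thesis by (simp add: algebra_simps)
    qed
    have "((\<lambda>s. x + s *\<^sub>R (a - x)) has_derivative (\<lambda>s. s *\<^sub>R (a - x))) (at (0::real))"
      by (auto intro!: derivative_eq_intros)
    moreover have "(f has_derivative F) (at (x + 0 *\<^sub>R (a - x)))" using der by simp
    ultimately have "(f \<circ> (\<lambda>s. x + s *\<^sub>R (a - x)) has_derivative F \<circ> (\<lambda>s. s *\<^sub>R (a - x))) (at (0::real))"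
      by (rule diff_chain_at)
    then have "((\<lambda>s. f (x + s *\<^sub>R (a - x))) has_vector_derivative F (a - x)) (at 0)"
      by (simp add: has_vector_derivative_def o_def F.scale)
    define \<gamma> where "\<gamma> = (\<lambda>s::real. f (x + s *\<^sub>R (a - x)))"
    have "(\<gamma> has_derivative (\<lambda>s. s *\<^sub>R F (a - x))) (at 0)"
      using \<open>((\<lambda>s. f (x + s *\<^sub>R (a - x))) has_vector_derivative F (a - x)) (at 0)\<close>
      by (simp add: has_vector_derivative_def \<gamma>_def)
    then have "(\<gamma> has_derivative (\<lambda>s. s *\<^sub>R F (a - x))) (at_right 0)"
      by (rule has_derivative_at_withinI)
    then have "((\<lambda>s. (1 / norm (s - 0)) *\<^sub>R (\<gamma> s - (\<gamma> 0 + (s - 0) *\<^sub>R F (a - x)))) \<longlongrightarrow> 0) (at_right 0)"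
      unfolding has_derivative_within by blast
    then have "((\<lambda>s. (1 / norm (s - 0)) *\<^sub>R (\<gamma> s - (\<gamma> 0 + (s - 0) *\<^sub>R F (a - x))) + F (a - x)) \<longlongrightarrow> 0 + F (a - x)) (at_right 0)"
      by (intro tendsto_add tendsto_const)
    then have lim: "((\<lambda>s. (1 / norm (s - 0)) *\<^sub>R (\<gamma> s - (\<gamma> 0 + (s - 0) *\<^sub>R F (a - x))) + F (a - x)) \<longlongrightarrow> F (a - x)) (at_right 0)"
      by (simp only: add_0)
    have eq: "(1 / norm (s - 0)) *\<^sub>R (\<gamma> s - (\<gamma> 0 + (s - 0) *\<^sub>R F (a - x))) + F (a - x) = (\<gamma> s - f x) /\<^sub>R s"
      if "0 < s" for s :: real
      using that by (simp add: \<gamma>_def algebra_simps divide_inverse)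
    show ?thesis
    proof (rule Lim_in_closed_set[OF closed_subspace _ _ lim])
      have "(1 / norm (s - 0)) *\<^sub>R (\<gamma> s - (\<gamma> 0 + (s - 0) *\<^sub>R F (a - x))) + F (a - x) \<in> direction_space T"
        if s: "0 < s" "s < 1" for s
      proof -
        have "\<gamma> s \<in> T" "f x \<in> T" using in_S[of s] s S by (auto simp: \<gamma>_def)
        then show ?thesis unfolding eq[OF s(1)] by (intro subspace_mul diff_in_direction_space) auto
      qed
      then show "\<forall>\<^sub>F s in at_right (0::real). (1 / norm (s - 0)) *\<^sub>R (\<gamma> s - (\<gamma> 0 + (s - 0) *\<^sub>R F (a - x))) + F (a - x) \<in> direction_space T"
        unfolding eventually_at_right_field by (intro exI[of _ 1]) auto
    qed auto
  qed
  have "F l \<in> direction_space T" if l: "l \<in> {a - b |a b. a \<in> S \<and> b \<in> S}" for l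
  proof -
    obtain a b where l: "l = a - b" "a \<in> S" "b \<in> S" using l by blast
    have "F l = F (a - x) - F (b - x)" by (simp add: l F.diff)
    then show ?thesis using ray l by (simp add: subspace_diff)
  qed
  then have "F ` {a - b |a b. a \<in> S \<and> b \<in> S} \<subseteq> direction_space T" by blast
  then have "span (F ` {a - b |a b. a \<in> S \<and> b \<in> S}) \<subseteq> direction_space T" by (simp add: span_minimal)
  then show ?thesis unfolding direction_space_def[of S] linear_span_image[OF F.linear_axioms] .
qed

lemma relative_ball_exists:
  fixes S :: "'a::euclidean_space set"
  assumes S: "convex S" "S \<noteq> {}"
  obtains z r where "z \<in> S" "r > 0" "\<And>l. l \<in> direction_space S \<Longrightarrow> norm l \<le> r \<Longrightarrow> z + l \<in> S"
proof -
  obtain z where "z \<in> rel_interior S" using rel_interior_eq_empty[OF S(1)] S(2) by blast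
  then obtain r where z: "z \<in> S" and r: "r > 0" "cball z r \<inter> affine hull S \<subseteq> S"
    by (auto simp: mem_rel_interior_cball)
  have sub: "direction_space S \<subseteq> span {x - z |x. x \<in> S - {z}}"
    unfolding direction_space_def
  proof (rule span_minimal)
    have 1: "a - z \<in> span {x - z |x. x \<in> S - {z}}" if "a \<in> S" for a
    proof (cases "a = z")
      case True
      then show ?thesis by (simp add: span_0)
    next
      case False
      then show ?thesis using that by (intro span_base) blast
    qed
    show "{a - b |a b. a \<in> S \<and> b \<in> S} \<subseteq> span {x - z |x. x \<in> S - {z}}"
    proof clarify
      fix a b assume "a \<in> S" "b \<in> S"
      then have "(a - z) - (b - z) \<in> span {x - z |x. x \<in> S - {z}}" by (intro span_diff[OF 1 1])
      then show "a - b \<in> span {x - z |x. x \<in> S - {z}}" by simp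
    qed
  qed simp
  show ?thesis
  proof (rule that[OF z r(1)])
    fix l assume l: "l \<in> direction_space S" "norm l \<le> r"
    then have "z + l \<in> affine hull S" using sub unfolding affine_hull_span[OF z] by blast
    then show "z + l \<in> S" using l r by (auto simp: dist_norm subset_iff)
  qed
qed

section \<open>Words as composable paths\<close>

text \<open>
  As a map, a word acts from right to left: \<open>links G w v u\<close> says that \<open>word_map \<phi> w\<close> is a composition
  of matching maps from \<open>X v\<close> to \<open>X u\<close>. In contrast to \<open>words\<close>, the empty word carries a vertex.
\<close>

primrec links :: "('v, 'e) pre_digraph \<Rightarrow> 'e list \<Rightarrow> 'v \<Rightarrow> 'v \<Rightarrow> bool" where
  "links G [] v u \<longleftrightarrow> u = v \<and> v \<in> verts G"
| "links G (e # w) v u \<longleftrightarrow> e \<in> arcs G \<and> tail G e = u \<and> links G w v (head G e)"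

lemma links_append:
  "links G (a @ b) v u \<longleftrightarrow> (\<exists>m. links G b v m \<and> links G a m u)"
  if "wf_digraph G"
proof -
  have "links G b v m \<Longrightarrow> m \<in> verts G" for b m
    using that by (cases b) (auto simp: wf_digraph.tail_in_verts)
  then show ?thesis by (induction a arbitrary: u) auto
qed

lemma links_words:
  assumes "wf_digraph G" "w \<in> words G n" "w \<noteq> []"
  shows "links G w (head G (last w)) (tail G (hd w))"
  using assms(2,3)
proof (induction w arbitrary: n)
  case (Cons e w)
  show ?case
  proof (cases w)
    case Nil
    then show ?thesis using Cons assms(1) by (auto simp: words_def wf_digraph.head_in_verts)
  next
    case (Cons e' w')
    then have "w \<in> words G (length w)" "w \<noteq> []" "head G e = tail G (hd w)" "e \<in> arcs G"
      using Cons.prems by (auto simp: words_def admissible_def)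
    then show ?thesis using Cons.IH Cons by auto
  qed
qed simp

lemma links_imp_words: "links G w v u \<Longrightarrow> w \<in> words G (length w)"
proof (induction w arbitrary: u)
  case (Cons e w)
  then show ?case by (cases w) (auto simp: words_def admissible_def)
qed (simp add: words_def)

lemma word_map_simps [simp]:
  "word_map \<phi> [] = id" "word_map \<phi> (e # w) = \<phi> e \<circ> word_map \<phi> w"
  by (simp_all add: word_map_def)

lemma word_map_append: "word_map \<phi> (a @ b) = word_map \<phi> a \<circ> word_map \<phi> b"
  by (induction a) (simp_all add: o_assoc)

text \<open>
  The chain rule for the factor by which the conformal derivative of \<open>word_map \<phi> w\<close> at \<open>x\<close>
  stretches lengths.
\<close>

primrec word_scale :: "('e \<Rightarrow> 'a::real_normed_vector \<Rightarrow> 'a) \<Rightarrow> 'e list \<Rightarrow> 'a \<Rightarrow> real" where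
  "word_scale \<phi> [] x = 1"
| "word_scale \<phi> (e # w) x = onorm (fderiv (\<phi> e) (word_map \<phi> w x)) * word_scale \<phi> w x"

lemma word_scale_append:
  "word_scale \<phi> (a @ b) x = word_scale \<phi> a (word_map \<phi> b x) * word_scale \<phi> b x"
  by (induction a) (simp_all add: word_map_append)

lemma trunc_Suc: "trunc \<omega> (Suc n) = \<omega> n # trunc \<omega> n"
  by (simp add: trunc_def)

lemma trunc_append: "trunc \<omega> (n + m) = trunc (\<lambda>i. \<omega> (i + m)) n @ trunc \<omega> m"
proof (induction n)
  case (Suc n)
  then show ?case unfolding add_Suc trunc_Suc by simp
qed (simp add: trunc_def)

lemma length_trunc [simp]: "length (trunc \<omega> n) = n"
  by (simp add: trunc_def)

lemma links_last: "links G w v u \<Longrightarrow> w \<noteq> [] \<Longrightarrow> head G (last w) = v"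
  by (induction w arbitrary: u) (auto split: if_splits)

section \<open>Bounded distortion\<close>

context cgdms
begin

lemma arc_similarity:
  assumes e: "e \<in> arcs G" and x: "x \<in> X (head G e)"
  shows "(\<phi> e has_derivative fderiv (\<phi> e) x) (at x)"
    and "onorm (fderiv (\<phi> e) x) > 0"
    and "norm (fderiv (\<phi> e) x h) = onorm (fderiv (\<phi> e) x) * norm h"
    and "onorm (inv (fderiv (\<phi> e) x)) = inverse (onorm (fderiv (\<phi> e) x))"
proof -
  obtain W where W: "\<And>v. v \<in> verts G \<Longrightarrow> open (W v) \<and> X v \<subseteq> W v"
    "\<And>e. e \<in> arcs G \<Longrightarrow> C1_diffeo_into (\<phi> e) (W (head G e)) (W (tail G e)) \<and> conformal_on (\<phi> e) (W (head G e))"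
    using conformal_extension by blast
  have xW: "x \<in> W (head G e)" using W(1) e x head_in_verts by blast
  obtain f' :: "real ^ 'd \<Rightarrow> (real ^ 'd) \<Rightarrow>\<^sub>L (real ^ 'd)" where "(\<phi> e has_derivative blinfun_apply (f' x)) (at x)"
    using W(2)[OF e] xW unfolding C1_diffeo_into_def C1_on_def by blast
  then show "(\<phi> e has_derivative fderiv (\<phi> e) x) (at x)"
    using frechet_derivative_at by metis
  obtain c Q where c: "c > 0" "orthogonal_transformation Q" "fderiv (\<phi> e) x = (\<lambda>h. c *\<^sub>R Q h)"
    using W(2)[OF e] xW unfolding conformal_on_def by blast
  have n: "norm (fderiv (\<phi> e) x h) = c * norm h" for h
    using c by (simp add: orthogonal_transformation_norm)
  have on: "onorm (fderiv (\<phi> e) x) = c" using c n by (intro onorm_similarity) auto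
  show "onorm (fderiv (\<phi> e) x) > 0" "norm (fderiv (\<phi> e) x h) = onorm (fderiv (\<phi> e) x) * norm h"
    using on n c by auto
  have "surj (fderiv (\<phi> e) x)"
    unfolding surj_def
  proof
    fix y
    obtain z where "Q z = y /\<^sub>R c"
      using orthogonal_transformation_surj[OF c(2)] by (metis surjD)
    then show "\<exists>z. y = fderiv (\<phi> e) x z" using c by (intro exI[of _ z]) simp
  qed
  then have "norm h = c * norm (inv (fderiv (\<phi> e) x) h)" for h
    using n[of "inv (fderiv (\<phi> e) x) h"] by (simp only: surj_f_inv_f)
  then have "norm (inv (fderiv (\<phi> e) x) h) = inverse c * norm h" for h
    using c by (metis less_irrefl mult.assoc left_inverse mult_1)
  then show "onorm (inv (fderiv (\<phi> e) x)) = inverse (onorm (fderiv (\<phi> e) x))"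
    unfolding on using c by (intro onorm_similarity) auto
qed

lemma continuous_arc_scale:
  assumes e: "e \<in> arcs G"
  shows "continuous_on (X (head G e)) (\<lambda>x. onorm (fderiv (\<phi> e) x))"
proof -
  obtain W where W: "\<And>v. v \<in> verts G \<Longrightarrow> open (W v) \<and> X v \<subseteq> W v"
    "\<And>e. e \<in> arcs G \<Longrightarrow> C1_diffeo_into (\<phi> e) (W (head G e)) (W (tail G e)) \<and> conformal_on (\<phi> e) (W (head G e))"
    using conformal_extension by blast
  obtain f' where f': "continuous_on (W (head G e)) f'"
    "\<And>x. x \<in> W (head G e) \<Longrightarrow> (\<phi> e has_derivative blinfun_apply (f' x)) (at x)"
    using W(2)[OF e] unfolding C1_diffeo_into_def C1_on_def by blast
  have sub: "X (head G e) \<subseteq> W (head G e)" using W(1) e head_in_verts by blast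
  have "onorm (fderiv (\<phi> e) x) = norm (f' x)" if "x \<in> X (head G e)" for x
    using frechet_derivative_at[OF f'(2)] that sub unfolding norm_blinfun.rep_eq by (metis subsetD)
  moreover have "continuous_on (X (head G e)) (\<lambda>x. norm (f' x))"
    using f'(1) sub by (intro continuous_on_norm) (rule continuous_on_subset)
  ultimately show ?thesis using continuous_on_cong by fastforce
qed

text \<open>
  Since the derivatives are similarities, the quantity \<open>\<parallel>(D\<phi>\<^sub>e)\<^sup>-\<^sup>1\<parallel>\<^sup>-\<^sup>1\<close> in the Hoelder condition is the
  minimum of the scale over the compact set \<open>X (head G e)\<close>, attained because the scale is continuous.
  The condition is thus one on relative, that is logarithmic, oscillation.
\<close>

lemma arc_scale_distortion:
  obtains C \<alpha> where "C > 0" "\<alpha> > 0"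
    "\<And>e x y. e \<in> arcs G \<Longrightarrow> x \<in> X (head G e) \<Longrightarrow> y \<in> X (head G e) \<Longrightarrow>
       onorm (fderiv (\<phi> e) x) \<le> onorm (fderiv (\<phi> e) y) * exp (C * norm (x - y) powr \<alpha>)"
proof -
  obtain C \<alpha> where C: "C > 0" "\<alpha> > 0"
    "\<And>e x y. e \<in> arcs G \<Longrightarrow> x \<in> X (head G e) \<Longrightarrow> y \<in> X (head G e) \<Longrightarrow>
       \<bar>onorm (fderiv (\<phi> e) x) - onorm (fderiv (\<phi> e) y)\<bar>
           \<le> C * inverse (SUP z\<in>X (head G e). onorm (inv (fderiv (\<phi> e) z))) * norm (x - y) powr \<alpha>"
    using derivative_hoelder by blast
  show ?thesis
  proof (rule that[OF C(1,2)])
    fix e x y assume e: "e \<in> arcs G" and x: "x \<in> X (head G e)" and y: "y \<in> X (head G e)"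
    define g where "g = (\<lambda>z. onorm (fderiv (\<phi> e) z))"
    have g: "g z > 0" if "z \<in> X (head G e)" for z using arc_similarity(2)[OF e that] by (simp add: g_def)
    have "continuous_on (X (head G e)) g" using continuous_arc_scale[OF e] by (simp add: g_def)
    then have "continuous_on (X (head G e)) (\<lambda>z. inverse (g z))"
      using g by (intro continuous_on_inverse) force+
    then have "bdd_above ((\<lambda>z. inverse (g z)) ` X (head G e))"
      using e by (intro bounded_imp_bdd_above compact_imp_bounded compact_continuous_image compact_X) auto
    then have "inverse (g y) \<le> (SUP z\<in>X (head G e). inverse (g z))"
      using y by (intro cSUP_upper)
    also have "\<dots> = (SUP z\<in>X (head G e). onorm (inv (fderiv (\<phi> e) z)))"
      using arc_similarity(4)[OF e] by (intro SUP_cong) (auto simp: g_def)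
    finally have "inverse (SUP z\<in>X (head G e). onorm (inv (fderiv (\<phi> e) z))) \<le> g y"
      using g[OF y] by (metis inverse_inverse_eq inverse_positive_iff_positive le_imp_inverse_le)
    then have "C * inverse (SUP z\<in>X (head G e). onorm (inv (fderiv (\<phi> e) z))) * norm (x - y) powr \<alpha>
        \<le> C * g y * norm (x - y) powr \<alpha>"
      using C by (intro mult_right_mono mult_left_mono) auto
    then have "\<bar>g x - g y\<bar> \<le> C * g y * norm (x - y) powr \<alpha>"
      using C(3)[OF e x y] by (simp add: g_def)
    then have "g x \<le> g y * (1 + C * norm (x - y) powr \<alpha>)"
      by (simp add: algebra_simps)
    also have "\<dots> \<le> g y * exp (C * norm (x - y) powr \<alpha>)"
      using g[OF y] exp_ge_add_one_self by (intro mult_left_mono) auto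
    finally show "onorm (fderiv (\<phi> e) x) \<le> onorm (fderiv (\<phi> e) y) * exp (C * norm (x - y) powr \<alpha>)"
      by (simp add: g_def)
  qed
qed

lemma links_verts: "links G w v u \<Longrightarrow> v \<in> verts G" "links G w v u \<Longrightarrow> u \<in> verts G"
  by (induction w arbitrary: u) auto

lemma word_map_into: "links G w v u \<Longrightarrow> x \<in> X v \<Longrightarrow> word_map \<phi> w x \<in> X u"
  using maps_into by (induction w arbitrary: u) fastforce+

lemma word_map_lipschitz:
  "links G w v u \<Longrightarrow> x \<in> X v \<Longrightarrow> y \<in> X v \<Longrightarrow>
     norm (word_map \<phi> w x - word_map \<phi> w y) \<le> lam ^ length w * norm (x - y)"
proof (induction w arbitrary: u)
  case (Cons e w)
  let ?a = "word_map \<phi> w x" and ?b = "word_map \<phi> w y"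
  have e: "e \<in> arcs G" and w: "links G w v (head G e)" using Cons by auto
  have "dist (\<phi> e ?a) (\<phi> e ?b) \<le> lam * dist ?a ?b"
    using lipschitz_map[OF e] word_map_into[OF w] Cons by (auto simp: lipschitz_on_def)
  also have "\<dots> \<le> lam * (lam ^ length w * norm (x - y))"
    using Cons.IH[OF w] Cons lam_bounds by (auto simp: dist_norm)
  finally show ?case by (simp add: dist_norm)
qed simp

lemma word_map_inj: "links G w v u \<Longrightarrow> inj_on (word_map \<phi> w) (X v)"
proof (induction w arbitrary: u)
  case (Cons e w)
  then have w: "links G w v (head G e)" and e: "e \<in> arcs G" by auto
  have "word_map \<phi> w ` X v \<subseteq> X (head G e)" using word_map_into[OF w] by blast
  then have "inj_on (\<phi> e) (word_map \<phi> w ` X v)" by (rule inj_on_subset[OF inj_map[OF e]])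
  then show ?case unfolding word_map_simps by (intro comp_inj_on Cons.IH[OF w])
qed simp

lemma word_scale_pos: "links G w v u \<Longrightarrow> x \<in> X v \<Longrightarrow> word_scale \<phi> w x > 0"
  using word_map_into arc_similarity(2) by (induction w arbitrary: u) fastforce+

text \<open>
  After \<open>i\<close> maps the two points are closer by the factor \<open>lam ^ i\<close>, so the logarithmic
  oscillations of the single factors are dominated by a geometric series.
\<close>

lemma word_scale_distortion:
  obtains C \<alpha> where "C > 0" "\<alpha> > 0"
    "\<And>w v u x y. links G w v u \<Longrightarrow> x \<in> X v \<Longrightarrow> y \<in> X v \<Longrightarrow>
       word_scale \<phi> w x \<le> word_scale \<phi> w y * exp (C * norm (x - y) powr \<alpha>)"
proof -
  obtain C \<alpha> where C: "C > 0" "\<alpha> > 0"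
    "\<And>e x y. e \<in> arcs G \<Longrightarrow> x \<in> X (head G e) \<Longrightarrow> y \<in> X (head G e) \<Longrightarrow>
       onorm (fderiv (\<phi> e) x) \<le> onorm (fderiv (\<phi> e) y) * exp (C * norm (x - y) powr \<alpha>)"
    using arc_scale_distortion by blast
  define p where "p = lam powr \<alpha>"
  have p: "0 < p" "p < 1"
    using lam_bounds C by (auto simp: p_def powr_less_one powr01_less_one)
  have step: "word_scale \<phi> w x
      \<le> word_scale \<phi> w y * exp (C * (\<Sum>i<length w. p ^ i) * norm (x - y) powr \<alpha>)"
    if "links G w v u" and xy: "x \<in> X v" "y \<in> X v" for w v u x y
    using that(1)
  proof (induction w arbitrary: u)
    case (Cons e w)
    let ?a = "word_map \<phi> w x" and ?b = "word_map \<phi> w y"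
    define d where "d = norm (x - y) powr \<alpha>"
    have e: "e \<in> arcs G" and w: "links G w v (head G e)" using Cons by auto
    have ab: "?a \<in> X (head G e)" "?b \<in> X (head G e)" using w xy word_map_into by auto
    have "norm (?a - ?b) powr \<alpha> \<le> (lam ^ length w * norm (x - y)) powr \<alpha>"
      using word_map_lipschitz[OF w xy] C by (intro powr_mono2) auto
    also have "\<dots> = p ^ length w * d"
      using lam_bounds by (simp add: p_def d_def powr_mult powr_realpow powr_powr mult.commute flip: powr_realpow)
    finally have "C * norm (?a - ?b) powr \<alpha> \<le> C * (p ^ length w * d)"
      using C by (intro mult_left_mono) auto
    then have "onorm (fderiv (\<phi> e) ?b) * exp (C * norm (?a - ?b) powr \<alpha>)
        \<le> onorm (fderiv (\<phi> e) ?b) * exp (C * (p ^ length w * d))"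
      using arc_similarity(2)[OF e ab(2)] by (intro mult_left_mono) auto
    then have 1: "onorm (fderiv (\<phi> e) ?a) \<le> onorm (fderiv (\<phi> e) ?b) * exp (C * (p ^ length w * d))"
      using C(3)[OF e ab] by linarith
    have "onorm (fderiv (\<phi> e) ?a) * word_scale \<phi> w x
        \<le> (onorm (fderiv (\<phi> e) ?b) * exp (C * (p ^ length w * d)))
          * (word_scale \<phi> w y * exp (C * (\<Sum>i<length w. p ^ i) * d))"
      using 1 Cons.IH[OF w] arc_similarity(2)[OF e ab(2)] word_scale_pos[OF w xy(1)]
      unfolding d_def by (intro mult_mono) auto
    also have "\<dots> = onorm (fderiv (\<phi> e) ?b) * word_scale \<phi> w y
        * exp (C * (\<Sum>i<length (e # w). p ^ i) * d)"
      by (simp add: exp_add algebra_simps)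
    finally show ?case by (simp add: d_def)
  qed simp
  show ?thesis
  proof (rule that[of "C / (1 - p)" \<alpha>])
    show "C / (1 - p) > 0" "\<alpha> > 0" using C p by auto
    fix w v u x y assume w: "links G w v u" "x \<in> X v" "y \<in> X v"
    have "(\<Sum>i<length w. p ^ i) \<le> 1 / (1 - p)"
    proof -
      have "(\<Sum>i<length w. p ^ i) = (1 - p ^ length w) / (1 - p)"
        using p by (simp add: sum_gp_strict)
      also have "\<dots> \<le> 1 / (1 - p)" using p by (intro divide_right_mono) auto
      finally show ?thesis .
    qed
    then have "C * (\<Sum>i<length w. p ^ i) * norm (x - y) powr \<alpha>
        \<le> C * (1 / (1 - p)) * norm (x - y) powr \<alpha>"
      using C by (intro mult_right_mono mult_left_mono) auto
    then have "word_scale \<phi> w y * exp (C * (\<Sum>i<length w. p ^ i) * norm (x - y) powr \<alpha>)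
        \<le> word_scale \<phi> w y * exp (C / (1 - p) * norm (x - y) powr \<alpha>)"
      using word_scale_pos[OF w(1) w(3)] by (intro mult_left_mono) auto
    then show "word_scale \<phi> w x \<le> word_scale \<phi> w y * exp (C / (1 - p) * norm (x - y) powr \<alpha>)"
      using step[OF w] by linarith
  qed
qed

lemma uniform_word_scale_distortion:
  obtains K where "K \<ge> 0"
    "\<And>w v u x y. links G w v u \<Longrightarrow> x \<in> X v \<Longrightarrow> y \<in> X v \<Longrightarrow> word_scale \<phi> w x \<le> word_scale \<phi> w y * exp K"
proof -
  obtain C \<alpha> where C: "C > 0" "\<alpha> > 0"
    "\<And>w v u x y. links G w v u \<Longrightarrow> x \<in> X v \<Longrightarrow> y \<in> X v \<Longrightarrow>
       word_scale \<phi> w x \<le> word_scale \<phi> w y * exp (C * norm (x - y) powr \<alpha>)"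
    using word_scale_distortion by blast
  define D where "D = Max (insert 0 ((\<lambda>v. diameter (X v)) ` verts G))"
  have D: "diameter (X v) \<le> D" if "v \<in> verts G" for v
    unfolding D_def using finite_verts that by (intro Max_ge) auto
  have D0: "D \<ge> 0" unfolding D_def using finite_verts by (intro Max_ge) auto
  show ?thesis
  proof (rule that[of "C * D powr \<alpha>"])
    show "0 \<le> C * D powr \<alpha>" using C by simp
    fix w v u x y assume w: "links G w v u" and xy: "x \<in> X v" "y \<in> X v"
    have v: "v \<in> verts G" using links_verts[OF w] by simp
    have "norm (x - y) \<le> diameter (X v)"
      using diameter_bounded_bound[OF compact_imp_bounded[OF compact_X[OF v]] xy] by (simp add: dist_norm)
    then have "norm (x - y) powr \<alpha> \<le> D powr \<alpha>" using D[OF v] C by (intro powr_mono2) auto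
    then have "word_scale \<phi> w y * exp (C * norm (x - y) powr \<alpha>) \<le> word_scale \<phi> w y * exp (C * D powr \<alpha>)"
      using C word_scale_pos[OF w xy(2)] by (intro mult_left_mono) auto
    then show "word_scale \<phi> w x \<le> word_scale \<phi> w y * exp (C * D powr \<alpha>)"
      using C(3)[OF w xy] by linarith
  qed
qed

lemma bounded_subset_X: "v \<in> verts G \<Longrightarrow> D \<subseteq> X v \<Longrightarrow> bounded D"
  by (rule bounded_subset[OF compact_imp_bounded[OF compact_X]])

lemma bounded_word_image: "links G w v u \<Longrightarrow> D \<subseteq> X v \<Longrightarrow> bounded (word_map \<phi> w ` D)"
  by (rule bounded_subset_X[OF links_verts(2)]) (auto intro: word_map_into)

lemma connected_word_image:
  assumes "links G w v u" "connected D" "D \<subseteq> X v"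
  shows "connected (word_map \<phi> w ` D)"
proof -
  have "continuous_on D (word_map \<phi> w)"
    unfolding continuous_on_iff
  proof (intro ballI allI impI)
    fix x and e :: real assume x: "x \<in> D" and e: "0 < e"
    have "dist (word_map \<phi> w y) (word_map \<phi> w x) < e" if y: "y \<in> D" "dist y x < e" for y
    proof -
      have "lam ^ length w * norm (y - x) \<le> 1 * norm (y - x)"
        using lam_bounds by (intro mult_right_mono power_le_one) auto
      moreover have "norm (word_map \<phi> w y - word_map \<phi> w x) \<le> lam ^ length w * norm (y - x)"
        by (rule word_map_lipschitz[OF assms(1) subsetD[OF assms(3) y(1)] subsetD[OF assms(3) x]])
      ultimately show ?thesis using y(2) unfolding dist_norm by linarith
    qed
    then show "\<exists>d>0. \<forall>y\<in>D. dist y x < d \<longrightarrow> dist (word_map \<phi> w y) (word_map \<phi> w x) < e" using e by blast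
  qed
  then show ?thesis using assms(2) connected_continuous_image by blast
qed

lemma diameter_word_image:
  assumes w: "links G w v u" and D: "D \<subseteq> X v" "D \<noteq> {}"
  shows "diameter (word_map \<phi> w ` D) \<le> lam ^ length w * diameter D"
proof (rule diameter_le)
  show "word_map \<phi> w ` D \<noteq> {} \<or> 0 \<le> lam ^ length w * diameter D" using D by simp
  have bD: "bounded D" by (rule bounded_subset_X[OF links_verts(1)[OF w] D(1)])
  fix p q assume "p \<in> word_map \<phi> w ` D" "q \<in> word_map \<phi> w ` D"
  then obtain x y where xy: "x \<in> D" "y \<in> D" "p = word_map \<phi> w x" "q = word_map \<phi> w y" by blast
  have "norm (p - q) \<le> lam ^ length w * norm (x - y)"
    unfolding xy(3,4) by (rule word_map_lipschitz[OF w subsetD[OF D(1) xy(1)] subsetD[OF D(1) xy(2)]])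
  also have "\<dots> \<le> lam ^ length w * diameter D"
    using diameter_bounded_bound[OF bD xy(1,2)] lam_bounds by (intro mult_left_mono) (auto simp: dist_norm)
  finally show "norm (p - q) \<le> lam ^ length w * diameter D" .
qed

end

section \<open>Word maps are near-similarities on small sets\<close>

locale primitive_cgdms = cgdms G lam X \<phi>
  for G :: "('v, 'e) pre_digraph"
    and lam :: real
    and X :: "'v \<Rightarrow> (real ^ 'd) set"
    and \<phi> :: "'e \<Rightarrow> real ^ 'd \<Rightarrow> real ^ 'd" +
  assumes primitive: "finitely_primitive G"
    and diameter_X_pos: "v \<in> verts G \<Longrightarrow> diameter (X v) > 0"
begin

lemma arc_derivative_directions_subset:
  assumes e: "e \<in> arcs G" and x: "x \<in> X (head G e)"
  shows "fderiv (\<phi> e) x ` direction_space (X (head G e)) \<subseteq> direction_space (X (tail G e))"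
  using derivative_maps_directions[OF convex_X maps_into x arc_similarity(1)[OF e x]] e by simp

lemma dim_similarity_image:
  fixes F :: "real ^ 'd \<Rightarrow> real ^ 'd"
  assumes "linear F" "c > 0" "\<And>h. norm (F h) = c * norm h"
  shows "dim (F ` S) = dim S"
proof (rule dim_image_eq[OF assms(1)])
  have "F h = 0 \<Longrightarrow> h = 0" for h using assms(2) assms(3)[of h] by auto
  then show "inj_on F (span S)"
    using assms(1) by (metis inj_on_subset linear_injective_0 subset_UNIV)
qed

lemma arc_dim_mono:
  assumes e: "e \<in> arcs G"
  shows "dim (direction_space (X (head G e))) \<le> dim (direction_space (X (tail G e)))"
proof -
  obtain x where x: "x \<in> X (head G e)" using nonempty_X[of "head G e"] e by auto
  have "linear (fderiv (\<phi> e) x)"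
    using arc_similarity(1)[OF e x] by (metis bounded_linear.linear has_derivative_bounded_linear)
  then have "dim (fderiv (\<phi> e) x ` direction_space (X (head G e))) = dim (direction_space (X (head G e)))"
    by (rule dim_similarity_image[OF _ arc_similarity(2,3)[OF e x]])
  then show ?thesis using dim_subset[OF arc_derivative_directions_subset[OF e x]] by simp
qed

lemma word_dim_mono: "links G w v u \<Longrightarrow> dim (direction_space (X v)) \<le> dim (direction_space (X u))"
  using arc_dim_mono by (induction w arbitrary: u) (auto intro: order_trans)

text \<open>
  Along any arc the dimension cannot drop, as derivatives are injective; primitivity closes the
  arc to a cycle.
\<close>

lemma arc_dim_eq:
  assumes e: "e \<in> arcs G"
  shows "dim (direction_space (X (head G e))) = dim (direction_space (X (tail G e)))"
proof -
  obtain n w where w: "e # w @ [e] \<in> words G (n + 2)" "w \<in> words G n" "n \<ge> 1"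
    using primitive e unfolding finitely_primitive_def by blast
  then have "links G (e # w @ [e]) (head G e) (tail G e)"
    using links_words[OF wf_digraph_axioms w(1)] by simp
  then obtain m where "links G [e] (head G e) m" "links G w m (head G e)"
    by (auto simp: links_append[OF wf_digraph_axioms])
  then have "links G w (tail G e) (head G e)" by simp
  then show ?thesis using word_dim_mono arc_dim_mono[OF e] by force
qed

lemma arc_derivative_directions:
  assumes e: "e \<in> arcs G" and x: "x \<in> X (head G e)"
  shows "fderiv (\<phi> e) x ` direction_space (X (head G e)) = direction_space (X (tail G e))"
proof (rule subspace_dim_equal)
  have lin: "linear (fderiv (\<phi> e) x)"
    using arc_similarity(1)[OF e x] by (metis bounded_linear.linear has_derivative_bounded_linear)
  show "subspace (fderiv (\<phi> e) x ` direction_space (X (head G e)))"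
    using lin by (intro linear_subspace_image) auto
  show "dim (direction_space (X (tail G e))) \<le> dim (fderiv (\<phi> e) x ` direction_space (X (head G e)))"
    using dim_similarity_image[OF lin arc_similarity(2,3)[OF e x]] arc_dim_eq[OF e] by simp
qed (use arc_derivative_directions_subset[OF e x] in auto)

text \<open>
  Surjectivity onto the direction space of the target is what \<open>expansion_lower_bound\<close> asks for.
\<close>

lemma word_derivative:
  assumes "links G w v u" "x \<in> X v"
  shows "\<exists>F. (word_map \<phi> w has_derivative F) (at x) \<and>
    (\<forall>h. norm (F h) = word_scale \<phi> w x * norm h) \<and> F ` direction_space (X v) = direction_space (X u)"
  using assms(1)
proof (induction w arbitrary: u)
  case Nil
  then show ?case by (intro exI[of _ id]) (simp add: id_def)
next
  case (Cons e w)
  then have e: "e \<in> arcs G" and w: "links G w v (head G e)" and u: "tail G e = u" by auto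
  obtain F where F: "(word_map \<phi> w has_derivative F) (at x)"
    "\<And>h. norm (F h) = word_scale \<phi> w x * norm h" "F ` direction_space (X v) = direction_space (X (head G e))"
    using Cons.IH[OF w] by blast
  define E where "E = fderiv (\<phi> e) (word_map \<phi> w x)"
  have x': "word_map \<phi> w x \<in> X (head G e)" using word_map_into[OF w assms(2)] .
  have "(\<phi> e \<circ> word_map \<phi> w has_derivative E \<circ> F) (at x)"
    unfolding E_def by (intro diff_chain_at F(1) arc_similarity(1)[OF e x'])
  moreover have "norm ((E \<circ> F) h) = word_scale \<phi> (e # w) x * norm h" for h
    using arc_similarity(3)[OF e x', of "F h"] F(2)[of h] by (simp add: E_def)
  moreover have "(E \<circ> F) ` direction_space (X v) = direction_space (X u)"
    using arc_derivative_directions[OF e x'] F(3) u by (simp add: E_def flip: image_image)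
  ultimately show ?case unfolding word_map_simps by blast
qed

lemma uniform_shape:
  obtains R D where "0 < R" "R \<le> D"
    "\<And>v. v \<in> verts G \<Longrightarrow> \<exists>z\<in>X v. \<forall>l\<in>direction_space (X v). norm l \<le> R \<longrightarrow> z + l \<in> X v"
    "\<And>v x y. v \<in> verts G \<Longrightarrow> x \<in> X v \<Longrightarrow> y \<in> X v \<Longrightarrow> norm (x - y) \<le> D"
proof (cases "verts G = {}")
  case True
  then show ?thesis using that[of 1 1] by simp
next
  case False
  have "\<exists>r>0. \<exists>z\<in>X v. \<forall>l\<in>direction_space (X v). norm l \<le> r \<longrightarrow> z + l \<in> X v" if "v \<in> verts G" for v
    using relative_ball_exists[OF convex_X nonempty_X] that by metis
  then obtain r where r: "\<And>v. v \<in> verts G \<Longrightarrow> r v > 0 \<and> (\<exists>z\<in>X v. \<forall>l\<in>direction_space (X v). norm l \<le> r v \<longrightarrow> z + l \<in> X v)"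
    by metis
  define R where "R = Min (r ` verts G)"
  define D where "D = Max (insert R ((\<lambda>v. diameter (X v)) ` verts G))"
  have fin: "finite (r ` verts G)" "finite (insert R ((\<lambda>v. diameter (X v)) ` verts G))"
    using finite_verts by auto
  show ?thesis
  proof (rule that)
    show "R > 0" using r fin False by (auto simp: R_def Min_gr_iff)
    show "R \<le> D" unfolding D_def using fin(2) by (rule Max_ge) simp
    show "\<exists>z\<in>X v. \<forall>l\<in>direction_space (X v). norm l \<le> R \<longrightarrow> z + l \<in> X v" if "v \<in> verts G" for v
    proof -
      have "R \<le> r v" unfolding R_def using fin(1) that by (intro Min_le) auto
      then show ?thesis using r[OF that] by force
    qed
    show "norm (x - y) \<le> D" if "v \<in> verts G" "x \<in> X v" "y \<in> X v" for v x y
    proof -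
      have "norm (x - y) \<le> diameter (X v)"
        using diameter_bounded_bound[OF compact_imp_bounded[OF compact_X]] that by (metis dist_norm)
      also have "\<dots> \<le> D" unfolding D_def using fin(2) that by (intro Max_ge) auto
      finally show ?thesis .
    qed
  qed
qed

lemma word_map_lipschitz_scale:
  assumes w: "links G w v u" and Y: "Y \<subseteq> X v" "convex Y" "x \<in> Y" "y \<in> Y"
    and M: "\<And>z. z \<in> Y \<Longrightarrow> word_scale \<phi> w z \<le> M"
  shows "norm (word_map \<phi> w x - word_map \<phi> w y) \<le> M * norm (x - y)"
proof -
  have ex: "\<exists>F. (word_map \<phi> w has_derivative F) (at z) \<and> onorm F \<le> M" if z: "z \<in> Y" for z
  proof -
    have zX: "z \<in> X v" using z Y(1) by (rule subsetD[rotated])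
    obtain F where F: "(word_map \<phi> w has_derivative F) (at z)" "\<And>h. norm (F h) = word_scale \<phi> w z * norm h"
        "F ` direction_space (X v) = direction_space (X u)"
      using word_derivative[OF w zX] by blast
    have "onorm F = word_scale \<phi> w z"
      by (rule onorm_similarity[OF less_imp_le[OF word_scale_pos[OF w zX]] F(2)])
    then have "onorm F \<le> M" using M[OF z] by simp
    then show ?thesis using F(1) by (intro exI[of _ F] conjI)
  qed
  define F where "F = (\<lambda>z. SOME F. (word_map \<phi> w has_derivative F) (at z) \<and> onorm F \<le> M)"
  have F: "(word_map \<phi> w has_derivative F z) (at z) \<and> onorm (F z) \<le> M" if "z \<in> Y" for z
    unfolding F_def by (rule someI_ex[OF ex[OF that]])
  show ?thesis
  proof (rule differentiable_bound[OF Y(2) _ _ Y(3,4)])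
    fix z assume "z \<in> Y"
    then show "(word_map \<phi> w has_derivative F z) (at z within Y)" "onorm (F z) \<le> M"
      using F has_derivative_at_withinI by blast+
  qed
qed

lemma word_map_expansion:
  assumes w: "links G w v u" and Y: "Y \<subseteq> X v" "z \<in> Y" "y \<in> Y" "norm (y - z) \<le> \<rho>" "\<rho> > 0"
    and ball: "\<And>l. l \<in> direction_space (X v) \<Longrightarrow> norm l \<le> \<rho> \<Longrightarrow> z + l \<in> Y"
    and m: "m > 0" "\<And>z. z \<in> Y \<Longrightarrow> m \<le> word_scale \<phi> w z"
  shows "m * norm (y - z) \<le> norm (word_map \<phi> w y - word_map \<phi> w z)"
proof -
  have "\<exists>F. (word_map \<phi> w has_derivative F) (at x) \<and>
     (\<forall>h. norm (F h) = word_scale \<phi> w x * norm h) \<and> F ` direction_space (X v) = direction_space (X u)" if "x \<in> Y" for x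
    by (rule word_derivative[OF w subsetD[OF Y(1) that]])
  then have "\<forall>x\<in>Y. \<exists>F. (word_map \<phi> w has_derivative F) (at x) \<and>
     (\<forall>h. norm (F h) = word_scale \<phi> w x * norm h) \<and> F ` direction_space (X v) = direction_space (X u)" by (rule ballI)
  then obtain F where F: "\<And>x. x \<in> Y \<Longrightarrow> (word_map \<phi> w has_derivative F x) (at x)"
    "\<And>x h. x \<in> Y \<Longrightarrow> norm (F x h) = word_scale \<phi> w x * norm h"
    "\<And>x. x \<in> Y \<Longrightarrow> F x ` direction_space (X v) = direction_space (X u)"
    unfolding bchoice_iff by blast
  have "m * min \<rho> (norm (y - z)) \<le> norm (word_map \<phi> w y - word_map \<phi> w z)"
  proof (rule expansion_lower_bound[where L = "direction_space (X v)" and F = F and Y = Y])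
    show "x - y \<in> direction_space (X v)" if "x \<in> Y" "y \<in> Y" for x y using that Y by (auto intro: diff_in_direction_space)
    show "inj_on (word_map \<phi> w) Y" using word_map_inj[OF w] Y by (auto intro: inj_on_subset)
    fix x y assume xy: "x \<in> Y" "y \<in> Y"
    have "word_map \<phi> w y - word_map \<phi> w x \<in> direction_space (X u)"
      using xy Y word_map_into[OF w] by (intro diff_in_direction_space) auto
    then obtain h where h: "h \<in> direction_space (X v)" "F x h = word_map \<phi> w y - word_map \<phi> w x"
      using F(3)[OF xy(1)] by (metis imageE)
    have "m * norm h \<le> norm (F x h)" using F(2)[OF xy(1)] m(2)[OF xy(1)] by (simp add: mult_right_mono)
    then show "\<exists>h\<in>direction_space (X v). F x h = word_map \<phi> w y - word_map \<phi> w x \<and>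
        m * norm h \<le> norm (word_map \<phi> w y - word_map \<phi> w x)"
      using h by metis
  qed (use F ball m Y in auto)
  then show ?thesis using Y by (simp add: min_absorb2)
qed

text \<open>
  The number \<open>\<delta>\<close> serves all words at once because the distortion constants and the shape
  constants of the finitely many sets \<open>X v\<close> do.
\<close>

lemma word_map_near_similarity:
  assumes \<eta>: "0 < \<eta>" "\<eta> < 1"
  shows "\<exists>\<delta>>0. \<forall>w v u. links G w v u \<longrightarrow> (\<forall>x\<in>X v. \<forall>y\<in>X v. norm (x - y) \<le> \<delta> \<longrightarrow>
       (1 - \<eta>) * word_scale \<phi> w x * norm (x - y) \<le> norm (word_map \<phi> w x - word_map \<phi> w y) \<and>
       norm (word_map \<phi> w x - word_map \<phi> w y) \<le> (1 + \<eta>) * word_scale \<phi> w x * norm (x - y) \<and>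
       word_scale \<phi> w x \<le> (1 + \<eta>) * word_scale \<phi> w y)"
proof -
  obtain R D where RD: "0 < R" "R \<le> D"
    "\<And>v. v \<in> verts G \<Longrightarrow> \<exists>z\<in>X v. \<forall>l\<in>direction_space (X v). norm l \<le> R \<longrightarrow> z + l \<in> X v"
    "\<And>v x y. v \<in> verts G \<Longrightarrow> x \<in> X v \<Longrightarrow> y \<in> X v \<Longrightarrow> norm (x - y) \<le> D"
    using uniform_shape by blast
  obtain C \<alpha> where C: "C > 0" "\<alpha> > 0"
    "\<And>w v u x y. links G w v u \<Longrightarrow> x \<in> X v \<Longrightarrow> y \<in> X v \<Longrightarrow>
       word_scale \<phi> w x \<le> word_scale \<phi> w y * exp (C * norm (x - y) powr \<alpha>)"
    using word_scale_distortion by blast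
  have "0 < \<eta> / 2" "\<eta> / 2 < 1" using \<eta> by auto
  from almost_straight_parameters[OF RD(1,2) this]
  obtain \<sigma> N q where \<sigma>: "0 < \<sigma>" "\<sigma> \<le> 1" and N: "(1::nat) \<le> N" "2 * D \<le> real N * \<sigma> * R" and q: "1 < q"
    and par: "\<And>m M. 0 < m \<Longrightarrow> m \<le> M \<Longrightarrow> M \<le> q * m \<Longrightarrow>
       (1 - \<eta> / 2) * m \<le> (1 - \<sigma>) * m - 2 * real N * sqrt (M\<^sup>2 - m\<^sup>2) - 2 * M * \<sigma>"
    by blast
  \<comment> \<open>the admissible oscillation of the scale: its square must stay below \<open>q\<close>, and the
    two other bounds absorb it into the losses allowed by \<open>\<eta>\<close>\<close>
  define E where "E = Min {sqrt q, (1 - \<eta> / 2) / (1 - \<eta>), 1 + \<eta>}"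
  have E_le: "E \<le> sqrt q" "E \<le> (1 - \<eta> / 2) / (1 - \<eta>)" "E \<le> 1 + \<eta>"
    unfolding E_def by (rule Min_le; simp)+
  have "1 < (1 - \<eta> / 2) / (1 - \<eta>)" using \<eta> by (simp add: field_simps)
  then have E1: "E > 1" using q \<eta> by (auto simp: E_def)
  have "E\<^sup>2 \<le> (sqrt q)\<^sup>2" using E_le E1 by (intro power_mono) auto
  then have Eq: "E\<^sup>2 \<le> q" using q by simp
  have E\<eta>: "(1 - \<eta>) \<le> (1 - \<eta> / 2) / E" using E_le(2) E1 \<eta> by (simp add: field_simps)
  define \<delta> where "\<delta> = (ln E / C) powr (1 / \<alpha>) / 3"
  have \<delta>: "\<delta> > 0" using E1 C by (simp add: \<delta>_def)
  have E_bound: "exp (C * d powr \<alpha>) \<le> E" if "0 \<le> d" "d \<le> 3 * \<delta>" for d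
  proof -
    have "d powr \<alpha> \<le> (3 * \<delta>) powr \<alpha>" using that C by (intro powr_mono2) auto
    also have "\<dots> = ln E / C" using E1 C by (simp add: \<delta>_def powr_powr)
    finally have "C * d powr \<alpha> \<le> ln E" using C by (simp add: field_simps)
    then show ?thesis using E1 by (metis exp_le_cancel_iff exp_ln less_trans zero_less_one)
  qed
  have near: "word_scale \<phi> w a \<le> word_scale \<phi> w b * E"
    if "links G w v u" "a \<in> X v" "b \<in> X v" "norm (a - b) \<le> 3 * \<delta>" for w v u a b
  proof -
    have "word_scale \<phi> w b * exp (C * norm (a - b) powr \<alpha>) \<le> word_scale \<phi> w b * E"
      using E_bound that word_scale_pos by (intro mult_left_mono) (auto intro: less_imp_le)
    then show ?thesis using C(3)[OF that(1-3)] by linarith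
  qed
  show ?thesis
  proof (intro exI[of _ \<delta>] conjI allI impI ballI)
    show "\<delta> > 0" by (rule \<delta>)
    fix w v u x y
    assume w: "links G w v u" and xy: "x \<in> X v" "y \<in> X v" "norm (x - y) \<le> \<delta>"
    have v: "v \<in> verts G" using links_verts[OF w] by simp
    define g where "g = word_scale \<phi> w x"
    have g: "g > 0" using word_scale_pos[OF w xy(1)] by (simp add: g_def)
    show "word_scale \<phi> w x \<le> (1 + \<eta>) * word_scale \<phi> w y"
    proof -
      have "word_scale \<phi> w y * E \<le> word_scale \<phi> w y * (1 + \<eta>)"
        using E_le word_scale_pos[OF w xy(2)] by (intro mult_left_mono) auto
      then show ?thesis using near[OF w xy(1,2)] xy(3) \<delta> by (simp add: mult.commute)
    qed
    define Y where "Y = X v \<inter> cball x (3 * norm (x - y))"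
    have Y: "Y \<subseteq> X v" "convex Y" "x \<in> Y" "y \<in> Y"
      using xy convex_X[OF v] by (auto simp: Y_def dist_norm intro: convex_Int)
    have gY: "g / E \<le> word_scale \<phi> w z" "word_scale \<phi> w z \<le> g * E" if "z \<in> Y" for z
    proof -
      have "norm (x - z) \<le> 3 * \<delta>" using that xy(3) by (auto simp: Y_def dist_norm)
      then show "g / E \<le> word_scale \<phi> w z" "word_scale \<phi> w z \<le> g * E"
        using near[OF w, of x z] near[OF w, of z x] that xy E1
        by (auto simp: Y_def g_def field_simps norm_minus_commute)
    qed
    have upper: "norm (word_map \<phi> w a - word_map \<phi> w b) \<le> (g * E) * norm (a - b)" if "a \<in> Y" "b \<in> Y" for a b
      using word_map_lipschitz_scale[OF w Y(1,2) that gY(2)] by simp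
    have "(g * E) * norm (x - y) \<le> (1 + \<eta>) * g * norm (x - y)"
      using E_le g by (intro mult_right_mono) auto
    then show "norm (word_map \<phi> w x - word_map \<phi> w y) \<le> (1 + \<eta>) * word_scale \<phi> w x * norm (x - y)"
      using upper[OF Y(3,4)] by (simp add: g_def)
    obtain z0 where z0: "z0 \<in> X v" "\<And>l. l \<in> direction_space (X v) \<Longrightarrow> norm l \<le> R \<Longrightarrow> z0 + l \<in> X v"
      using RD(3)[OF v] by blast
    have m: "0 < g / E" using g E1 by simp
    have mM: "g / E \<le> g * E" using gY[OF Y(3)] by linarith
    have "g * E\<^sup>2 \<le> g * q" using Eq g by (intro mult_left_mono) auto
    then have Mq: "g * E \<le> q * (g / E)" using E1 by (simp add: field_simps power2_eq_square)
    have "norm (x - y) * ((1 - \<eta> / 2) * (g / E)) \<le> norm (word_map \<phi> w x - word_map \<phi> w y)"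
    proof (cases "x = y")
      case False
      have "norm (x - y) * ((1 - \<sigma>) * (g / E) - 2 * real N * sqrt ((g * E)\<^sup>2 - (g / E)\<^sup>2) - 2 * (g * E) * \<sigma>)
          \<le> norm (word_map \<phi> w x - word_map \<phi> w y)"
      proof (rule almost_straight_image[where ?z0.0 = z0 and R = R and D = D and L = "direction_space (X v)" and X = "X v"])
        show "g / E * norm (y - z) \<le> norm (word_map \<phi> w y - word_map \<phi> w z)"
          if "z \<in> Y" "0 < \<rho>" "\<And>l. l \<in> direction_space (X v) \<Longrightarrow> norm l \<le> \<rho> \<Longrightarrow> z + l \<in> Y" "y \<in> Y" "norm (y - z) \<le> \<rho>"
          for z \<rho> y
          by (rule word_map_expansion[OF w Y(1) that(1,4,5,2,3) m gY(1)])
        show "norm (x - z0) \<le> D" if "x \<in> X v" for x by (rule RD(4)[OF v that z0(1)])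
        show "norm (x - y) \<le> D" by (rule RD(4)[OF v xy(1,2)])
      qed (fact convex_X[OF v] z0 RD(1,2) subspace_direction_space xy(1,2) Y_def upper \<sigma> N m mM False)+
      moreover have "norm (x - y) * ((1 - \<eta> / 2) * (g / E)) \<le> norm (x - y) *
          ((1 - \<sigma>) * (g / E) - 2 * real N * sqrt ((g * E)\<^sup>2 - (g / E)\<^sup>2) - 2 * (g * E) * \<sigma>)"
        by (rule mult_left_mono[OF par[OF m mM Mq] norm_ge_zero])
      ultimately show ?thesis by linarith
    qed simp
    moreover have "(1 - \<eta>) * g * norm (x - y) \<le> (1 - \<eta> / 2) / E * g * norm (x - y)"
      using E\<eta> g by (intro mult_right_mono) auto
    ultimately show "(1 - \<eta>) * word_scale \<phi> w x * norm (x - y) \<le> norm (word_map \<phi> w x - word_map \<phi> w y)"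
      by (simp add: g_def mult_ac)
  qed
qed

end

section \<open>Derivative norms and diameters of images\<close>

context primitive_cgdms
begin

lemma onorm_fderiv_word_map:
  assumes w: "links G w v u" and x: "x \<in> X v"
  shows "onorm (fderiv (word_map \<phi> w) x) = word_scale \<phi> w x"
proof -
  obtain F where F: "(word_map \<phi> w has_derivative F) (at x)" "\<And>h. norm (F h) = word_scale \<phi> w x * norm h"
    using word_derivative[OF w x] by blast
  have "onorm F = word_scale \<phi> w x"
    by (rule onorm_similarity[OF less_imp_le[OF word_scale_pos[OF w x]] F(2)])
  then show ?thesis using frechet_derivative_at[OF F(1)] by simp
qed

lemma deriv_norm_eq:
  assumes "links G w v u" "w \<noteq> []"
  shows "deriv_norm G X \<phi> w = (SUP x\<in>X v. word_scale \<phi> w x)"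
  unfolding deriv_norm_def links_last[OF assms]
  using onorm_fderiv_word_map[OF assms(1)] by (intro SUP_cong) auto

lemma deriv_norm_comparable:
  "\<exists>K\<ge>0. \<forall>w v u. links G w v u \<longrightarrow> w \<noteq> [] \<longrightarrow> (\<forall>x\<in>X v.
     word_scale \<phi> w x \<le> deriv_norm G X \<phi> w \<and> deriv_norm G X \<phi> w \<le> exp K * word_scale \<phi> w x)"
proof -
  obtain K where K: "K \<ge> 0"
    "\<And>w v u x y. links G w v u \<Longrightarrow> x \<in> X v \<Longrightarrow> y \<in> X v \<Longrightarrow> word_scale \<phi> w x \<le> word_scale \<phi> w y * exp K"
    using uniform_word_scale_distortion by blast
  show ?thesis
  proof (intro exI[of _ K] conjI allI impI ballI)
    show "K \<ge> 0" by (rule K(1))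
    fix w v u x assume w: "links G w v u" "w \<noteq> []" and x: "x \<in> X v"
    have bd: "bdd_above (word_scale \<phi> w ` X v)"
      using K(2)[OF w(1) _ x] by (intro bdd_aboveI2)
    show "word_scale \<phi> w x \<le> deriv_norm G X \<phi> w"
      unfolding deriv_norm_eq[OF w] using bd x by (intro cSUP_upper)
    show "deriv_norm G X \<phi> w \<le> exp K * word_scale \<phi> w x"
      unfolding deriv_norm_eq[OF w] using K(2)[OF w(1) _ x] x by (intro cSUP_least) (auto simp: mult.commute)
  qed
qed

lemma diameter_near_scale:
  assumes \<epsilon>: "\<epsilon> > 0"
  obtains \<delta> where "\<delta> > 0"
    "\<And>w v u D x. links G w v u \<Longrightarrow> D \<subseteq> X v \<Longrightarrow> x \<in> D \<Longrightarrow> 0 < diameter D \<Longrightarrow> diameter D \<le> \<delta> \<Longrightarrow>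
       0 < diameter (word_map \<phi> w ` D) \<and>
       \<bar>ln (diameter (word_map \<phi> w ` D)) - ln (word_scale \<phi> w x * diameter D)\<bar> \<le> \<epsilon>"
proof -
  \<comment> \<open>chosen so that \<open>1 - 3 * \<eta>\<close> and \<open>1 + 3 * \<eta>\<close> lie between \<open>exp (- \<epsilon>)\<close> and \<open>exp \<epsilon>\<close>\<close>
  define \<eta> where "\<eta> = (1 - exp (- \<epsilon>)) / 3"
  have \<eta>: "0 < \<eta>" "\<eta> < 1/3" using \<epsilon> by (auto simp: \<eta>_def)
  have e1: "exp (- \<epsilon>) = 1 - 3 * \<eta>" by (simp add: \<eta>_def field_simps)
  have "0 \<le> (exp (\<epsilon> / 2) - exp (- (\<epsilon> / 2)))\<^sup>2" by simp
  also have "\<dots> = exp \<epsilon> + exp (- \<epsilon>) - 2"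
    by (simp add: power2_diff flip: exp_double exp_add)
  finally have e2: "1 + 3 * \<eta> \<le> exp \<epsilon>" using e1 by simp
  have "\<eta> < 1" using \<eta> by simp
  from word_map_near_similarity[OF \<eta>(1) this]
  obtain \<delta> where \<delta>: "\<delta> > 0"
    and low: "\<And>w v u x y. links G w v u \<Longrightarrow> x \<in> X v \<Longrightarrow> y \<in> X v \<Longrightarrow> norm (x - y) \<le> \<delta> \<Longrightarrow>
       (1 - \<eta>) * word_scale \<phi> w x * norm (x - y) \<le> norm (word_map \<phi> w x - word_map \<phi> w y)"
    and up: "\<And>w v u x y. links G w v u \<Longrightarrow> x \<in> X v \<Longrightarrow> y \<in> X v \<Longrightarrow> norm (x - y) \<le> \<delta> \<Longrightarrow>
       norm (word_map \<phi> w x - word_map \<phi> w y) \<le> (1 + \<eta>) * word_scale \<phi> w x * norm (x - y)"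
    and dis: "\<And>w v u x y. links G w v u \<Longrightarrow> x \<in> X v \<Longrightarrow> y \<in> X v \<Longrightarrow> norm (x - y) \<le> \<delta> \<Longrightarrow>
       word_scale \<phi> w x \<le> (1 + \<eta>) * word_scale \<phi> w y"
    by blast
  show ?thesis
  proof (rule that[OF \<delta>])
    fix w v u D x
    assume w: "links G w v u" and D: "D \<subseteq> X v" "x \<in> D" "0 < diameter D" "diameter D \<le> \<delta>"
    have bD: "bounded D" by (rule bounded_subset_X[OF links_verts(1)[OF w] D(1)])
    have near: "norm (a - b) \<le> diameter D" if "a \<in> D" "b \<in> D" for a b
      using diameter_bounded_bound[OF bD that] by (simp add: dist_norm)
    define g where "g = word_scale \<phi> w x"
    have xv: "x \<in> X v" using D by auto
    have g: "g > 0" using word_scale_pos[OF w xv] by (simp add: g_def)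
    have scale: "(1 - 2 * \<eta>) * g \<le> (1 - \<eta>) * word_scale \<phi> w a" "(1 + \<eta>) * word_scale \<phi> w a \<le> (1 + 3 * \<eta>) * g"
      if "a \<in> D" for a
    proof -
      have a: "a \<in> X v" "norm (x - a) \<le> \<delta>" "norm (a - x) \<le> \<delta>"
        using that D near[of x a] near[of a x] by (auto simp: norm_minus_commute)
      have pa: "word_scale \<phi> w a > 0" using word_scale_pos[OF w a(1)] .
      have gle: "g \<le> (1 + \<eta>) * word_scale \<phi> w a" using dis[OF w xv a(1,2)] by (simp add: g_def)
      have "(1 - 2 * \<eta>) * g \<le> (1 - 2 * \<eta>) * ((1 + \<eta>) * word_scale \<phi> w a)"
        using gle \<eta> by (intro mult_left_mono) auto
      also have "\<dots> = ((1 - 2 * \<eta>) * (1 + \<eta>)) * word_scale \<phi> w a" by simp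
      also have "\<dots> \<le> (1 - \<eta>) * word_scale \<phi> w a"
        using pa \<eta> by (intro mult_right_mono) (auto simp: algebra_simps)
      finally show "(1 - 2 * \<eta>) * g \<le> (1 - \<eta>) * word_scale \<phi> w a" .
      have "(1 + \<eta>) * word_scale \<phi> w a \<le> (1 + \<eta>) * ((1 + \<eta>) * g)"
        using dis[OF w a(1) xv a(3)] \<eta> by (intro mult_left_mono) (auto simp: g_def)
      also have "\<dots> = ((1 + \<eta>) * (1 + \<eta>)) * g" by simp
      also have "\<dots> \<le> (1 + 3 * \<eta>) * g"
      proof (intro mult_right_mono)
        have "\<eta> * \<eta> \<le> \<eta> * 1" using \<eta> by (intro mult_left_mono) auto
        then show "(1 + \<eta>) * (1 + \<eta>) \<le> 1 + 3 * \<eta>" by (simp add: algebra_simps)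
      qed (use g in auto)
      finally show "(1 + \<eta>) * word_scale \<phi> w a \<le> (1 + 3 * \<eta>) * g" .
    qed
    have bI: "bounded (word_map \<phi> w ` D)" using bounded_word_image[OF w D(1)] .
    have upper: "diameter (word_map \<phi> w ` D) \<le> exp \<epsilon> * (g * diameter D)"
    proof (rule diameter_le)
      fix p q assume "p \<in> word_map \<phi> w ` D" "q \<in> word_map \<phi> w ` D"
      then obtain a b where ab: "a \<in> D" "b \<in> D" "p = word_map \<phi> w a" "q = word_map \<phi> w b" by blast
      have "norm (p - q) \<le> (1 + \<eta>) * word_scale \<phi> w a * norm (a - b)"
        unfolding ab(3,4) using near[OF ab(1,2)] ab D by (intro up[OF w]) auto
      also have "\<dots> \<le> ((1 + 3 * \<eta>) * g) * diameter D"
        by (rule mult_mono[OF scale(2)[OF ab(1)] near[OF ab(1,2)]]) (use \<eta> g in auto)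
      also have "\<dots> = (1 + 3 * \<eta>) * (g * diameter D)" by simp
      also have "\<dots> \<le> exp \<epsilon> * (g * diameter D)" using e2 g D by (intro mult_right_mono) auto
      finally show "norm (p - q) \<le> exp \<epsilon> * (g * diameter D)" .
    qed (use D in auto)
    have "diameter D \<le> diameter (word_map \<phi> w ` D) / (exp (- \<epsilon>) * g)"
    proof (rule diameter_le)
      fix a b assume ab: "a \<in> D" "b \<in> D"
      have "exp (- \<epsilon>) * g \<le> (1 - 2 * \<eta>) * g" using e1 \<eta> g by (intro mult_right_mono) auto
      then have "exp (- \<epsilon>) * g * norm (a - b) \<le> (1 - \<eta>) * word_scale \<phi> w a * norm (a - b)"
        using scale(1)[OF ab(1)] by (intro mult_right_mono) auto
      also have "\<dots> \<le> norm (word_map \<phi> w a - word_map \<phi> w b)"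
        using near[OF ab] ab D by (intro low[OF w]) auto
      also have "\<dots> \<le> diameter (word_map \<phi> w ` D)"
        using diameter_bounded_bound[OF bI] ab by (auto simp: dist_norm)
      finally show "norm (a - b) \<le> diameter (word_map \<phi> w ` D) / (exp (- \<epsilon>) * g)"
        using g by (simp add: field_simps)
    qed (use D in auto)
    then have lower: "exp (- \<epsilon>) * (g * diameter D) \<le> diameter (word_map \<phi> w ` D)"
      using g by (simp add: field_simps)
    have pos: "0 < exp (- \<epsilon>) * (g * diameter D)" using g D by simp
    then have dpos: "0 < diameter (word_map \<phi> w ` D)" using lower by linarith
    have "ln (diameter (word_map \<phi> w ` D)) \<le> ln (exp \<epsilon> * (g * diameter D))"
      using upper dpos by (simp del: ln_mult)
    moreover have "ln (exp (- \<epsilon>) * (g * diameter D)) \<le> ln (diameter (word_map \<phi> w ` D))"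
      using lower pos by (simp del: ln_mult)
    moreover have "ln (exp s * (g * diameter D)) = s + ln (g * diameter D)" for s
      using g D by (subst ln_mult) auto
    ultimately show "0 < diameter (word_map \<phi> w ` D) \<and>
       \<bar>ln (diameter (word_map \<phi> w ` D)) - ln (word_scale \<phi> w x * diameter D)\<bar> \<le> \<epsilon>"
      using dpos unfolding g_def by (simp add: abs_le_iff)
  qed
qed

text \<open>
  For sets of small diameter this is contained in the near-similarity estimate. A connected set of
  larger diameter contains two points at distance exactly \<open>\<delta>\<close>, and these already keep the image
  from being too small.
\<close>

lemma diameter_comparable_scale:
  obtains K where "K \<ge> 0"
    "\<And>w v u D x. links G w v u \<Longrightarrow> D \<subseteq> X v \<Longrightarrow> x \<in> D \<Longrightarrow> connected D \<Longrightarrow> 0 < diameter D \<Longrightarrow>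
       0 < diameter (word_map \<phi> w ` D) \<and>
       \<bar>ln (diameter (word_map \<phi> w ` D)) - ln (word_scale \<phi> w x * diameter D)\<bar> \<le> K"
proof -
  obtain K0 where K0: "K0 \<ge> 0"
    "\<And>w v u x y. links G w v u \<Longrightarrow> x \<in> X v \<Longrightarrow> y \<in> X v \<Longrightarrow> word_scale \<phi> w x \<le> word_scale \<phi> w y * exp K0"
    using uniform_word_scale_distortion by blast
  obtain R D0 where D0: "0 < R" "R \<le> D0"
    "\<And>v x y. v \<in> verts G \<Longrightarrow> x \<in> X v \<Longrightarrow> y \<in> X v \<Longrightarrow> norm (x - y) \<le> D0"
    using uniform_shape by metis
  have D0p: "D0 > 0" using D0 by simp
  have "(0::real) < 1/2" "(1/2::real) < 1" by auto
  from word_map_near_similarity[OF this]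
  obtain \<delta> where \<delta>: "\<delta> > 0"
    and low: "\<And>w v u x y. links G w v u \<Longrightarrow> x \<in> X v \<Longrightarrow> y \<in> X v \<Longrightarrow> norm (x - y) \<le> \<delta> \<Longrightarrow>
       (1 - 1/2) * word_scale \<phi> w x * norm (x - y) \<le> norm (word_map \<phi> w x - word_map \<phi> w y)"
    by blast
  define \<theta> where "\<theta> = min 1 (\<delta> / D0) * exp (- K0) / 2"
  have \<theta>: "0 < \<theta>" "\<theta> \<le> 1"
  proof -
    show "0 < \<theta>" using \<delta> D0p by (simp add: \<theta>_def)
    have "min 1 (\<delta> / D0) * exp (- K0) \<le> 1 * 1" using K0 \<delta> D0p by (intro mult_mono) auto
    then show "\<theta> \<le> 1" by (simp add: \<theta>_def)
  qed
  show ?thesis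
  proof (rule that[of "K0 - ln \<theta>"])
    have ln\<theta>: "ln \<theta> \<le> 0" using \<theta> by simp
    then show "0 \<le> K0 - ln \<theta>" using K0(1) by linarith
    fix w v u D x
    assume w: "links G w v u" and D: "D \<subseteq> X v" "x \<in> D" "connected D" "0 < diameter D"
    have v: "v \<in> verts G" using links_verts[OF w] by simp
    have bD: "bounded D" by (rule bounded_subset_X[OF v D(1)])
    define g where "g = word_scale \<phi> w x"
    have xv: "x \<in> X v" using D by auto
    have g: "g > 0" using word_scale_pos[OF w xv] by (simp add: g_def)
    have bI: "bounded (word_map \<phi> w ` D)" using bounded_word_image[OF w D(1)] .
    have dD0: "diameter D \<le> D0"
      using D D0(3)[OF v] by (intro diameter_le) (auto simp: subset_iff)
    have upper: "diameter (word_map \<phi> w ` D) \<le> exp K0 * (g * diameter D)"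
    proof (rule diameter_le)
      fix p q assume "p \<in> word_map \<phi> w ` D" "q \<in> word_map \<phi> w ` D"
      then obtain a b where ab: "a \<in> D" "b \<in> D" "p = word_map \<phi> w a" "q = word_map \<phi> w b" by blast
      have "norm (p - q) \<le> (g * exp K0) * norm (a - b)"
        unfolding ab(3,4) g_def
        using ab D convex_X[OF v] K0(2)[OF w _ xv] by (intro word_map_lipschitz_scale[OF w subset_refl]) auto
      also have "\<dots> \<le> (g * exp K0) * diameter D"
        using diameter_bounded_bound[OF bD ab(1,2)] g by (intro mult_left_mono) (auto simp: dist_norm)
      finally show "norm (p - q) \<le> exp K0 * (g * diameter D)" by (simp add: mult_ac)
    qed (use D in auto)
    have pair: "exp (- K0) / 2 * (g * norm (a - b)) \<le> diameter (word_map \<phi> w ` D)"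
      if ab: "a \<in> D" "b \<in> D" "norm (a - b) \<le> \<delta>" for a b
    proof -
      have av: "a \<in> X v" "b \<in> X v" using ab D by auto
      have "exp (- K0) * g \<le> word_scale \<phi> w a"
        using K0(2)[OF w xv av(1)] by (simp add: g_def exp_minus field_simps)
      then have "exp (- K0) * g / 2 * norm (a - b) \<le> (1 - 1/2) * word_scale \<phi> w a * norm (a - b)"
        by (intro mult_right_mono) auto
      also have "\<dots> \<le> norm (word_map \<phi> w a - word_map \<phi> w b)" by (rule low[OF w av ab(3)])
      also have "\<dots> \<le> diameter (word_map \<phi> w ` D)"
        using diameter_bounded_bound[OF bI] ab by (auto simp: dist_norm)
      finally show ?thesis by simp
    qed
    have lower: "\<theta> * (g * diameter D) \<le> diameter (word_map \<phi> w ` D)"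
    proof (cases "\<forall>a\<in>D. \<forall>b\<in>D. norm (a - b) \<le> \<delta>")
      case True
      have "diameter D \<le> diameter (word_map \<phi> w ` D) / (exp (- K0) / 2 * g)"
        using pair True D g by (intro diameter_le) (auto simp: field_simps)
      then have "exp (- K0) / 2 * (g * diameter D) \<le> diameter (word_map \<phi> w ` D)"
        using g by (simp add: field_simps)
      moreover have "\<theta> * (g * diameter D) \<le> exp (- K0) / 2 * (g * diameter D)"
        using g D unfolding \<theta>_def by (intro mult_right_mono) auto
      ultimately show ?thesis by linarith
    next
      case False
      then obtain a b where ab: "a \<in> D" "b \<in> D" "\<delta> < dist a b" by (auto simp: dist_norm not_le)
      have "connected (dist a ` D)" using D(3) by (intro connected_continuous_image continuous_intros)
      moreover have "0 \<in> dist a ` D" "dist a b \<in> dist a ` D" using ab by force+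
      ultimately have "\<delta> \<in> dist a ` D"
        using ab \<delta> by (meson connected_contains_Icc atLeastAtMost_iff less_imp_le subsetD)
      then obtain c where c: "c \<in> D" "norm (a - c) = \<delta>" by (auto simp: dist_norm)
      have "min 1 (\<delta> / D0) * diameter D \<le> \<delta> / D0 * D0" using dD0 \<delta> D0p D by (intro mult_mono) auto
      then have "min 1 (\<delta> / D0) * diameter D \<le> \<delta>" using D0p by simp
      then have "exp (- K0) / 2 * g * (min 1 (\<delta> / D0) * diameter D) \<le> exp (- K0) / 2 * g * \<delta>"
        using g by (intro mult_left_mono) auto
      also have "\<dots> \<le> diameter (word_map \<phi> w ` D)" using pair[OF ab(1) c(1)] c(2) by simp
      finally show ?thesis by (simp add: \<theta>_def mult_ac)
    qed
    have pos: "0 < \<theta> * (g * diameter D)" using g D \<theta> by simp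
    then have dpos: "0 < diameter (word_map \<phi> w ` D)" using lower by linarith
    have "ln (diameter (word_map \<phi> w ` D)) \<le> ln (exp K0 * (g * diameter D))"
      using upper dpos by (simp del: ln_mult)
    moreover have "ln (\<theta> * (g * diameter D)) \<le> ln (diameter (word_map \<phi> w ` D))"
      using lower pos by (simp del: ln_mult)
    moreover have "ln (exp K0 * (g * diameter D)) = K0 + ln (g * diameter D)"
      "ln (\<theta> * (g * diameter D)) = ln \<theta> + ln (g * diameter D)"
      using g D \<theta> by (subst ln_mult; simp)+
    ultimately have "\<bar>ln (diameter (word_map \<phi> w ` D)) - ln (g * diameter D)\<bar> \<le> K0 - ln \<theta>"
      using K0(1) ln\<theta> unfolding abs_le_iff by linarith
    then show "0 < diameter (word_map \<phi> w ` D) \<and>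
       \<bar>ln (diameter (word_map \<phi> w ` D)) - ln (word_scale \<phi> w x * diameter D)\<bar> \<le> K0 - ln \<theta>"
      using dpos unfolding g_def by blast
  qed
qed

end

section \<open>The scaling function\<close>

text \<open>
  For admissible words of length at least 2 this is the scaling ratio. For a single letter the
  denominator is the diameter of the set \<open>X (tail G e)\<close> that contains the image of \<open>\<phi> e\<close>, and not
  that of its domain; with this choice the product over all prefixes of a word telescopes.
\<close>

definition level_ratio ::
  "('v, 'e) pre_digraph \<Rightarrow> ('v \<Rightarrow> 'a::metric_space set) \<Rightarrow> ('e \<Rightarrow> 'a \<Rightarrow> 'a) \<Rightarrow> 'e list \<Rightarrow> real" where
  "level_ratio G X \<phi> w = diameter (word_map \<phi> w ` X (head G (last w)))
     / diameter (word_map \<phi> (butlast w) ` X (tail G (last w)))"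

context primitive_cgdms
begin

lemma connected_X: "v \<in> verts G \<Longrightarrow> connected (X v)"
  using convex_X convex_connected by blast

lemma diameter_scale_pos:
  assumes "links G w v u" "D \<subseteq> X v" "x \<in> D" "connected D" "0 < diameter D"
  shows "0 < diameter (word_map \<phi> w ` D)"
proof (rule diameter_comparable_scale)
  fix K :: real
  assume "\<And>w v u D x. links G w v u \<Longrightarrow> D \<subseteq> X v \<Longrightarrow> x \<in> D \<Longrightarrow> connected D \<Longrightarrow> 0 < diameter D \<Longrightarrow>
       0 < diameter (word_map \<phi> w ` D) \<and>
       \<bar>ln (diameter (word_map \<phi> w ` D)) - ln (word_scale \<phi> w x * diameter D)\<bar> \<le> K"
  from this[OF assms] show ?thesis by blast
qed

lemma diameter_word_image_pos:
  assumes w: "links G w v u"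
  shows "0 < diameter (word_map \<phi> w ` X v)"
proof -
  have v: "v \<in> verts G" using links_verts[OF w] by simp
  obtain x where "x \<in> X v" using nonempty_X[OF v] by blast
  then show ?thesis
    using diameter_scale_pos[OF w subset_refl _ connected_X[OF v] diameter_X_pos[OF v]] by blast
qed

text \<open>
  Both diameters in the quotient for \<open>w @ p\<close> are diameters of images under the same map
  \<open>word_map \<phi> w\<close>, of two nested sets, so the scale of this map at a common point cancels.
\<close>

lemma level_ratio_prepend:
  assumes p: "links G p v m" "p \<noteq> []" and w: "links G w m u"
    and B: "\<And>D x. D \<subseteq> X m \<Longrightarrow> x \<in> D \<Longrightarrow> connected D \<Longrightarrow> 0 < diameter D \<Longrightarrow>
       diameter D \<le> lam ^ (length p - 1) * diameter (X (tail G (last p))) \<Longrightarrow>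
       0 < diameter (word_map \<phi> w ` D) \<and>
       \<bar>ln (diameter (word_map \<phi> w ` D)) - ln (word_scale \<phi> w x * diameter D)\<bar> \<le> B"
  shows "\<bar>ln (level_ratio G X \<phi> (w @ p)) - ln (level_ratio G X \<phi> p)\<bar> \<le> 2 * B"
proof -
  obtain q e where pe: "p = q @ [e]" using p(2) by (metis rev_exhaust)
  have e: "e \<in> arcs G" "head G e = v" and q: "links G q (tail G e) m"
    using p(1) unfolding pe by (auto simp: links_append[OF wf_digraph_axioms])
  define D where "D = word_map \<phi> q ` X (tail G e)"
  define D' where "D' = word_map \<phi> p ` X v"
  have v: "v \<in> verts G" "tail G e \<in> verts G" using e links_verts[OF p(1)] by auto
  have D'D: "D' \<subseteq> D"
    using maps_into[OF e(1)] e(2) unfolding D_def D'_def pe word_map_append by force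
  have DX: "D \<subseteq> X m" unfolding D_def using word_map_into[OF q] by blast
  have conn: "connected D" "connected D'"
    unfolding D_def D'_def using connected_word_image[OF q connected_X[OF v(2)]]
      connected_word_image[OF p(1) connected_X[OF v(1)]] by auto
  have pos: "0 < diameter D" "0 < diameter D'"
    unfolding D_def D'_def using diameter_word_image_pos[OF q] diameter_word_image_pos[OF p(1)] by auto
  obtain x where x: "x \<in> D'" unfolding D'_def using nonempty_X[OF v(1)] by blast
  have small: "diameter D \<le> lam ^ (length p - 1) * diameter (X (tail G (last p)))"
    unfolding D_def pe using diameter_word_image[OF q subset_refl] nonempty_X[OF v(2)] by simp
  have "diameter D' \<le> diameter D"
    by (rule diameter_subset[OF D'D bounded_subset_X[OF links_verts(2)[OF p(1)] DX]])
  then have small': "diameter D' \<le> lam ^ (length p - 1) * diameter (X (tail G (last p)))"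
    using small by linarith
  have ratios: "level_ratio G X \<phi> p = diameter D' / diameter D"
    "level_ratio G X \<phi> (w @ p) = diameter (word_map \<phi> w ` D') / diameter (word_map \<phi> w ` D)"
    unfolding level_ratio_def D_def D'_def pe using e
    by (simp_all add: word_map_append image_comp butlast_append o_assoc)
  have bD: "0 < diameter (word_map \<phi> w ` D)"
    "\<bar>ln (diameter (word_map \<phi> w ` D)) - ln (word_scale \<phi> w x * diameter D)\<bar> \<le> B"
    using B[OF DX subsetD[OF D'D x] conn(1) pos(1) small] by auto
  have bD': "0 < diameter (word_map \<phi> w ` D')"
    "\<bar>ln (diameter (word_map \<phi> w ` D')) - ln (word_scale \<phi> w x * diameter D')\<bar> \<le> B"
    using B[OF order_trans[OF D'D DX] x conn(2) pos(2) small'] by auto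
  have "x \<in> X m" using x D'D DX by blast
  then have s: "0 < word_scale \<phi> w x" using word_scale_pos[OF w] by blast
  have l: "ln (word_scale \<phi> w x * diameter D) = ln (word_scale \<phi> w x) + ln (diameter D)"
    "ln (word_scale \<phi> w x * diameter D') = ln (word_scale \<phi> w x) + ln (diameter D')"
    using s pos by (subst ln_mult; simp)+
  have r: "ln (level_ratio G X \<phi> p) = ln (diameter D') - ln (diameter D)"
    "ln (level_ratio G X \<phi> (w @ p)) = ln (diameter (word_map \<phi> w ` D')) - ln (diameter (word_map \<phi> w ` D))"
    unfolding ratios using pos bD(1) bD'(1) by (subst ln_div; simp)+
  show ?thesis using bD(2) bD'(2) unfolding l r by linarith
qed

lemma level_ratio_prepend_bounded:
  "\<exists>K\<ge>0. \<forall>w p v m u. links G p v m \<longrightarrow> links G w m u \<longrightarrow> p \<noteq> [] \<longrightarrow>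
     \<bar>ln (level_ratio G X \<phi> (w @ p)) - ln (level_ratio G X \<phi> p)\<bar> \<le> K"
proof -
  obtain K where K: "K \<ge> 0"
    "\<And>w v u D x. links G w v u \<Longrightarrow> D \<subseteq> X v \<Longrightarrow> x \<in> D \<Longrightarrow> connected D \<Longrightarrow> 0 < diameter D \<Longrightarrow>
       0 < diameter (word_map \<phi> w ` D) \<and>
       \<bar>ln (diameter (word_map \<phi> w ` D)) - ln (word_scale \<phi> w x * diameter D)\<bar> \<le> K"
    using diameter_comparable_scale by blast
  show ?thesis
  proof (intro exI[of _ "2 * K"] conjI allI impI)
    show "\<bar>ln (level_ratio G X \<phi> (w @ p)) - ln (level_ratio G X \<phi> p)\<bar> \<le> 2 * K"
      if "links G p v m" "links G w m u" "p \<noteq> []" for w p v m u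
      by (rule level_ratio_prepend[OF that(1,3,2)]) (rule K(2)[OF that(2)])
  qed (use K(1) in auto)
qed

lemma level_ratio_prepend_small:
  assumes \<epsilon>: "\<epsilon> > 0"
  shows "\<exists>M. \<forall>w p v m u. links G p v m \<longrightarrow> links G w m u \<longrightarrow> p \<noteq> [] \<longrightarrow> M \<le> length p \<longrightarrow>
       \<bar>ln (level_ratio G X \<phi> (w @ p)) - ln (level_ratio G X \<phi> p)\<bar> \<le> \<epsilon>"
proof -
  define D0 where "D0 = Max (insert 1 ((\<lambda>v. diameter (X v)) ` verts G))"
  have D0: "diameter (X v) \<le> D0" if "v \<in> verts G" for v
    unfolding D0_def using finite_verts that by (intro Max_ge) auto
  have "1 \<le> D0" unfolding D0_def using finite_verts by (intro Max_ge) auto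
  then have D0p: "D0 > 0" by simp
  have "\<epsilon> / 2 > 0" using \<epsilon> by simp
  from diameter_near_scale[OF this]
  obtain \<delta> where \<delta>: "\<delta> > 0"
    "\<And>w v u D x. links G w v u \<Longrightarrow> D \<subseteq> X v \<Longrightarrow> x \<in> D \<Longrightarrow> 0 < diameter D \<Longrightarrow> diameter D \<le> \<delta> \<Longrightarrow>
       0 < diameter (word_map \<phi> w ` D) \<and>
       \<bar>ln (diameter (word_map \<phi> w ` D)) - ln (word_scale \<phi> w x * diameter D)\<bar> \<le> \<epsilon> / 2"
    by blast
  have "0 < \<delta> / D0" using \<delta>(1) D0p by simp
  from real_arch_pow_inv[OF this lam_bounds(2)] obtain N where N: "lam ^ N < \<delta> / D0" by blast
  show ?thesis
  proof (intro exI[of _ "Suc N"] allI impI)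
    fix w p v m u
    assume p: "links G p v m" and w: "links G w m u" and ne: "p \<noteq> []" and len: "Suc N \<le> length p"
    have t: "tail G (last p) \<in> verts G"
      using p ne by (induction p arbitrary: m) (auto split: if_splits)
    have "lam ^ (length p - 1) * diameter (X (tail G (last p))) \<le> lam ^ N * D0"
      using len lam_bounds D0[OF t] diameter_X_pos[OF t]
      by (intro mult_mono power_decreasing) auto
    also have "\<dots> \<le> \<delta>" using N D0p by (simp add: field_simps)
    finally have "lam ^ (length p - 1) * diameter (X (tail G (last p))) \<le> \<delta>" .
    then have "\<bar>ln (level_ratio G X \<phi> (w @ p)) - ln (level_ratio G X \<phi> p)\<bar> \<le> 2 * (\<epsilon> / 2)"
      by (intro level_ratio_prepend[OF p ne w] \<delta>(2)[OF w]) linarith+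
    then show "\<bar>ln (level_ratio G X \<phi> (w @ p)) - ln (level_ratio G X \<phi> p)\<bar> \<le> \<epsilon>" by simp
  qed
qed

lemma links_trunc:
  assumes "\<omega> \<in> dual_space G"
  shows "links G (trunc \<omega> (Suc n)) (head G (\<omega> 0)) (tail G (\<omega> n))"
proof -
  have a: "\<omega> j \<in> arcs G" "head G (\<omega> (Suc j)) = tail G (\<omega> j)" for j
    using assms by (auto simp: dual_space_def admissible_def)
  show ?thesis
    by (induction n) (use a in \<open>auto simp: trunc_Suc, simp add: trunc_def\<close>)
qed

lemma scaling_ratio_trunc:
  assumes "\<omega> \<in> dual_space G" "n \<ge> 2"
  shows "scaling_ratio G X \<phi> (trunc \<omega> n) = level_ratio G X \<phi> (trunc \<omega> n)"
proof -
  obtain k where k: "n = Suc (Suc k)" using assms(2) by (metis add_2_eq_Suc le_Suc_ex)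
  have "last (trunc \<omega> n) = \<omega> 0" "last (butlast (trunc \<omega> n)) = \<omega> 1"
    unfolding k trunc_def by (simp_all add: map_upt_Suc butlast_append del: upt_Suc)
  moreover have "head G (\<omega> 1) = tail G (\<omega> 0)"
    using assms by (auto simp: dual_space_def admissible_def)
  ultimately show ?thesis using k by (simp add: scaling_ratio_def level_ratio_def word_image_def)
qed

lemma trunc_split:
  assumes \<omega>: "\<omega> \<in> dual_space G" and mn: "1 \<le> m" "m \<le> n"
  shows "\<exists>w v m' u. trunc \<omega> n = w @ trunc \<omega> m \<and> links G (trunc \<omega> m) v m' \<and> links G w m' u \<and> trunc \<omega> m \<noteq> []"
proof -
  obtain k where k: "n = k + m" using mn by (metis le_iff_add add.commute)
  obtain m0 where m0: "m = Suc m0" using mn by (cases m) auto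
  have lk: "links G (trunc (\<lambda>i. \<omega> (i + m)) k @ trunc \<omega> m) (head G (\<omega> 0)) (tail G (\<omega> (k + m0)))"
    using links_trunc[OF \<omega>, of "k + m0"] unfolding trunc_append[symmetric] m0 by simp
  then obtain m' where "links G (trunc \<omega> m) (head G (\<omega> 0)) m'"
    "links G (trunc (\<lambda>i. \<omega> (i + m)) k) m' (tail G (\<omega> (k + m0)))"
    by (auto simp: links_append[OF wf_digraph_axioms])
  moreover have "trunc \<omega> m \<noteq> []" using mn by (metis length_trunc list.size(3) not_one_le_zero)
  ultimately show ?thesis unfolding k trunc_append by blast
qed

lemma level_ratio_trunc_bounded:
  "\<exists>K\<ge>0. \<forall>\<omega>\<in>dual_space G. \<forall>m n. 1 \<le> m \<longrightarrow> m \<le> n \<longrightarrow>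
     \<bar>ln (level_ratio G X \<phi> (trunc \<omega> n)) - ln (level_ratio G X \<phi> (trunc \<omega> m))\<bar> \<le> K"
proof -
  obtain K where K: "K \<ge> 0"
    "\<And>w p v m u. links G p v m \<Longrightarrow> links G w m u \<Longrightarrow> p \<noteq> [] \<Longrightarrow>
       \<bar>ln (level_ratio G X \<phi> (w @ p)) - ln (level_ratio G X \<phi> p)\<bar> \<le> K"
    using level_ratio_prepend_bounded by blast
  show ?thesis
  proof (intro exI[of _ K] conjI ballI allI impI)
    fix \<omega> and m n :: nat assume "\<omega> \<in> dual_space G" "1 \<le> m" "m \<le> n"
    from trunc_split[OF this]
    show "\<bar>ln (level_ratio G X \<phi> (trunc \<omega> n)) - ln (level_ratio G X \<phi> (trunc \<omega> m))\<bar> \<le> K"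
      using K(2) by force
  qed (use K(1) in auto)
qed

lemma level_ratio_trunc_small:
  assumes "\<epsilon> > 0"
  shows "\<exists>M. \<forall>\<omega>\<in>dual_space G. \<forall>m n. M \<le> m \<longrightarrow> 1 \<le> m \<longrightarrow> m \<le> n \<longrightarrow>
     \<bar>ln (level_ratio G X \<phi> (trunc \<omega> n)) - ln (level_ratio G X \<phi> (trunc \<omega> m))\<bar> \<le> \<epsilon>"
proof -
  obtain M where M: "\<And>w p v m u. links G p v m \<Longrightarrow> links G w m u \<Longrightarrow> p \<noteq> [] \<Longrightarrow> M \<le> length p \<Longrightarrow>
       \<bar>ln (level_ratio G X \<phi> (w @ p)) - ln (level_ratio G X \<phi> p)\<bar> \<le> \<epsilon>"
    using level_ratio_prepend_small[OF assms] by blast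
  show ?thesis
  proof (intro exI[of _ M] ballI allI impI)
    fix \<omega> and m n :: nat assume "\<omega> \<in> dual_space G" and Mm: "M \<le> m" and "1 \<le> m" "m \<le> n"
    from trunc_split[OF this(1,3,4)]
    show "\<bar>ln (level_ratio G X \<phi> (trunc \<omega> n)) - ln (level_ratio G X \<phi> (trunc \<omega> m))\<bar> \<le> \<epsilon>"
      using M[of "trunc \<omega> m"] Mm by force
  qed
qed

text \<open>
  Left extensions change the logarithms of the quotients by amounts that tend to 0 uniformly,
  so these form a Cauchy sequence.
\<close>

lemma scaling_function_limit:
  assumes \<omega>: "\<omega> \<in> dual_space G"
  shows "0 < scaling_function G X \<phi> \<omega>"
    and "(\<lambda>n. ln (level_ratio G X \<phi> (trunc \<omega> n))) \<longlonglongrightarrow> ln (scaling_function G X \<phi> \<omega>)"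
proof -
  define a where "a = (\<lambda>\<omega> n. ln (level_ratio G X \<phi> (trunc \<omega> n)))"
  have "Cauchy (a \<omega>)"
  proof (rule metric_CauchyI)
    fix \<epsilon> :: real assume "\<epsilon> > 0"
    then have "\<epsilon> / 2 > 0" by simp
    from level_ratio_trunc_small[OF this] obtain M where M: "\<And>m n. M \<le> m \<Longrightarrow> 1 \<le> m \<Longrightarrow> m \<le> n \<Longrightarrow> \<bar>a \<omega> n - a \<omega> m\<bar> \<le> \<epsilon> / 2"
      using \<omega> unfolding a_def by blast
    show "\<exists>M. \<forall>m\<ge>M. \<forall>n\<ge>M. dist (a \<omega> m) (a \<omega> n) < \<epsilon>"
    proof (intro exI[of _ "Suc M"] allI impI)
      fix m n assume "Suc M \<le> m" "Suc M \<le> n"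
      then have "\<bar>a \<omega> (max m n) - a \<omega> (min m n)\<bar> \<le> \<epsilon> / 2" by (intro M) auto
      then show "dist (a \<omega> m) (a \<omega> n) < \<epsilon>"
        using \<open>\<epsilon> > 0\<close> by (cases "m \<le> n") (auto simp: dist_real_def abs_real_def split: if_splits)
    qed
  qed
  then obtain l where l: "a \<omega> \<longlonglongrightarrow> l" by (auto simp: Cauchy_convergent_iff convergent_def)
  have eq: "exp (a \<omega> n) = scaling_ratio G X \<phi> (trunc \<omega> n)" if n: "n \<ge> 2" for n
  proof -
    define k where "k = n - 2"
    have k: "n = Suc (Suc k)" using n by (simp add: k_def)
    have "trunc \<omega> n \<noteq> []" by (simp add: k trunc_Suc)
    then obtain q e where qe: "trunc \<omega> n = q @ [e]" by (cases "trunc \<omega> n" rule: rev_cases) auto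
    have lk: "links G (trunc \<omega> n) (head G (\<omega> 0)) (tail G (\<omega> (Suc k)))" unfolding k by (rule links_trunc[OF \<omega>])
    then have q: "links G q (tail G e) (tail G (\<omega> (Suc k)))" and e: "head G e = head G (\<omega> 0)"
      unfolding qe by (auto simp: links_append[OF wf_digraph_axioms])
    have "0 < level_ratio G X \<phi> (trunc \<omega> n)"
      using diameter_word_image_pos[OF q] diameter_word_image_pos[OF lk] e
      unfolding level_ratio_def qe by simp
    then show ?thesis using scaling_ratio_trunc[OF \<omega> n] by (simp add: a_def)
  qed
  have "(\<lambda>n. exp (a \<omega> n)) \<longlonglongrightarrow> exp l" by (rule tendsto_exp[OF l])
  then have "(\<lambda>n. scaling_ratio G X \<phi> (trunc \<omega> n)) \<longlonglongrightarrow> exp l"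
    by (rule Lim_transform_eventually) (use eq in \<open>auto simp: eventually_sequentially\<close>)
  then have "scaling_function G X \<phi> \<omega> = exp l" unfolding scaling_function_def by (rule limI)
  then show "0 < scaling_function G X \<phi> \<omega>"
    and "(\<lambda>n. ln (level_ratio G X \<phi> (trunc \<omega> n))) \<longlonglongrightarrow> ln (scaling_function G X \<phi> \<omega>)"
    using l by (simp_all add: a_def)
qed

lemma scaling_function_error:
  assumes \<omega>: "\<omega> \<in> dual_space G"
    and B: "\<And>n. m \<le> n \<Longrightarrow> \<bar>ln (level_ratio G X \<phi> (trunc \<omega> n)) - ln (level_ratio G X \<phi> (trunc \<omega> m))\<bar> \<le> B"
  shows "\<bar>ln (scaling_function G X \<phi> \<omega>) - ln (level_ratio G X \<phi> (trunc \<omega> m))\<bar> \<le> B"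
proof (rule LIMSEQ_le_const2)
  show "(\<lambda>n. \<bar>ln (level_ratio G X \<phi> (trunc \<omega> n)) - ln (level_ratio G X \<phi> (trunc \<omega> m))\<bar>)
      \<longlonglongrightarrow> \<bar>ln (scaling_function G X \<phi> \<omega>) - ln (level_ratio G X \<phi> (trunc \<omega> m))\<bar>"
    by (intro tendsto_intros scaling_function_limit(2)[OF \<omega>])
  show "\<exists>N. \<forall>n\<ge>N. \<bar>ln (level_ratio G X \<phi> (trunc \<omega> n)) - ln (level_ratio G X \<phi> (trunc \<omega> m))\<bar> \<le> B"
    using B by blast
qed

lemma sum_ln_level_ratio:
  assumes "links G w v u"
  shows "(\<Sum>j<length w. ln (level_ratio G X \<phi> (take (Suc j) w)))
    = ln (diameter (word_map \<phi> w ` X v)) - ln (diameter (X u))"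
  using assms
proof (induction w arbitrary: v rule: rev_induct)
  case (snoc e w)
  have w: "links G w (tail G e) u" and e: "head G e = v"
    using snoc.prems by (auto simp: links_append[OF wf_digraph_axioms])
  have "ln (level_ratio G X \<phi> (w @ [e]))
      = ln (diameter (word_map \<phi> (w @ [e]) ` X v)) - ln (diameter (word_map \<phi> w ` X (tail G e)))"
    using diameter_word_image_pos[OF w] diameter_word_image_pos[OF snoc.prems] e
    by (simp add: level_ratio_def ln_div)
  then show ?case using snoc.IH[OF w] by simp
qed simp

text \<open>
  The prefixes of \<open>w\<close> of length less than \<open>M\<close> contribute a bounded error each, the longer ones
  at most \<open>\<epsilon>\<close>; what remains is the telescoping product of the level ratios.
\<close>

lemma prod_scaling_function_comparable:
  fixes c :: "'e list \<Rightarrow> nat \<Rightarrow> nat \<Rightarrow> 'e"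
  assumes c: "\<And>n w k. \<lbrakk>w \<in> words G n; k < n\<rbrakk> \<Longrightarrow>
           c w k \<in> dual_space G \<and> trunc (c w k) (n - k) = take (n - k) w"
    and \<epsilon>: "\<epsilon> > 0"
  shows "\<exists>A. \<forall>n\<ge>1. \<forall>w\<in>words G n.
     \<bar>(\<Sum>k<n. ln (scaling_function G X \<phi> (c w k))) - ln (deriv_norm G X \<phi> w)\<bar> \<le> A + real n * \<epsilon>"
proof -
  obtain K where K: "K \<ge> 0"
    and bd': "\<And>\<omega> m n. \<omega> \<in> dual_space G \<Longrightarrow> 1 \<le> m \<Longrightarrow> m \<le> n \<Longrightarrow>
       \<bar>ln (level_ratio G X \<phi> (trunc \<omega> n)) - ln (level_ratio G X \<phi> (trunc \<omega> m))\<bar> \<le> K"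
    using level_ratio_trunc_bounded by blast
  have bd: "\<bar>ln (scaling_function G X \<phi> \<omega>) - ln (level_ratio G X \<phi> (trunc \<omega> m))\<bar> \<le> K"
    if "\<omega> \<in> dual_space G" "1 \<le> m" for \<omega> m
    by (rule scaling_function_error[OF that(1) bd'[OF that]])
  obtain M where M': "\<And>\<omega> m n. \<omega> \<in> dual_space G \<Longrightarrow> M \<le> m \<Longrightarrow> 1 \<le> m \<Longrightarrow> m \<le> n \<Longrightarrow>
       \<bar>ln (level_ratio G X \<phi> (trunc \<omega> n)) - ln (level_ratio G X \<phi> (trunc \<omega> m))\<bar> \<le> \<epsilon>"
    using level_ratio_trunc_small[OF \<epsilon>] by blast
  have M: "\<bar>ln (scaling_function G X \<phi> \<omega>) - ln (level_ratio G X \<phi> (trunc \<omega> m))\<bar> \<le> \<epsilon>"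
    if "\<omega> \<in> dual_space G" "M \<le> m" "1 \<le> m" for \<omega> m
    by (rule scaling_function_error[OF that(1) M'[OF that]])
  obtain K1 where K1: "K1 \<ge> 0"
    "\<And>w v u D x. links G w v u \<Longrightarrow> D \<subseteq> X v \<Longrightarrow> x \<in> D \<Longrightarrow> connected D \<Longrightarrow> 0 < diameter D \<Longrightarrow>
       0 < diameter (word_map \<phi> w ` D) \<and>
       \<bar>ln (diameter (word_map \<phi> w ` D)) - ln (word_scale \<phi> w x * diameter D)\<bar> \<le> K1"
    using diameter_comparable_scale by blast
  obtain K2 where K2: "K2 \<ge> 0"
    "\<And>w v u x. links G w v u \<Longrightarrow> w \<noteq> [] \<Longrightarrow> x \<in> X v \<Longrightarrow> word_scale \<phi> w x \<le> deriv_norm G X \<phi> w"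
    "\<And>w v u x. links G w v u \<Longrightarrow> w \<noteq> [] \<Longrightarrow> x \<in> X v \<Longrightarrow> deriv_norm G X \<phi> w \<le> exp K2 * word_scale \<phi> w x"
    using deriv_norm_comparable by blast
  define B where "B = Max (insert 0 ((\<lambda>v. \<bar>ln (diameter (X v))\<bar>) ` verts G))"
  have B: "\<bar>ln (diameter (X v))\<bar> \<le> B" if "v \<in> verts G" for v
    unfolding B_def using finite_verts that by (intro Max_ge) auto
  show ?thesis
  proof (intro exI[of _ "K * real M + 2 * B + K1 + K2"] allI impI ballI)
    fix n w assume n: "1 \<le> n" and w: "w \<in> words G n"
    have len: "length w = n" "w \<noteq> []" using w n by (auto simp: words_def)
    define v u where "v = head G (last w)" and "u = tail G (hd w)"
    have lk: "links G w v u" unfolding v_def u_def by (rule links_words[OF wf_digraph_axioms w len(2)])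
    have vu: "v \<in> verts G" "u \<in> verts G" using links_verts[OF lk] by auto
    obtain x where x: "x \<in> X v" using nonempty_X[OF vu(1)] by blast
    define S1 where "S1 = (\<Sum>k<n. ln (scaling_function G X \<phi> (c w k)))"
    define S2 where "S2 = (\<Sum>k<n. ln (level_ratio G X \<phi> (take (n - k) w)))"
    have "\<bar>S1 - S2\<bar> \<le> (\<Sum>k<n. \<epsilon> + (if n - k < M then K else 0))"
      unfolding S1_def S2_def sum_subtractf[symmetric]
    proof (rule order_trans[OF sum_abs sum_mono])
      fix k assume "k \<in> {..<n}"
      then have k: "k < n" by simp
      have ck: "c w k \<in> dual_space G" "trunc (c w k) (n - k) = take (n - k) w" using c[OF w k] by auto
      show "\<bar>ln (scaling_function G X \<phi> (c w k)) - ln (level_ratio G X \<phi> (take (n - k) w))\<bar>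
          \<le> \<epsilon> + (if n - k < M then K else 0)"
        using bd[OF ck(1), of "n - k"] M[OF ck(1), of "n - k"] k \<epsilon> unfolding ck(2)
        by (cases "n - k < M") (simp_all add: Suc_leI add_increasing)
    qed
    also have "\<dots> = real n * \<epsilon> + K * real (card {k. k < n \<and> n - k < M})"
      by (simp add: sum.distrib sum.If_cases lessThan_def Int_def)
    also have "\<dots> \<le> real n * \<epsilon> + K * real M"
    proof -
      have "card {k. k < n \<and> n - k < M} \<le> card {n - M..<n}" by (intro card_mono) auto
      then have "card {k. k < n \<and> n - k < M} \<le> M" by simp
      then show ?thesis using K by (intro add_left_mono mult_left_mono) auto
    qed
    finally have 1: "\<bar>S1 - S2\<bar> \<le> real n * \<epsilon> + K * real M" .
    \<comment> \<open>dropping the last \<open>k\<close> letters for \<open>k < n\<close> runs through the nonempty prefixes, longest first\<close>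
    have "S2 = (\<Sum>k<n. ln (level_ratio G X \<phi> (take (Suc (n - Suc k)) w)))"
      unfolding S2_def by (intro sum.cong) (auto simp: Suc_diff_Suc)
    also have "\<dots> = (\<Sum>j<n. ln (level_ratio G X \<phi> (take (Suc j) w)))"
      by (rule sum.nat_diff_reindex[where g = "\<lambda>j. ln (level_ratio G X \<phi> (take (Suc j) w))"])
    also have "\<dots> = ln (diameter (word_map \<phi> w ` X v)) - ln (diameter (X u))"
      using sum_ln_level_ratio[OF lk] len by simp
    finally have 2: "S2 = ln (diameter (word_map \<phi> w ` X v)) - ln (diameter (X u))" .
    have s: "0 < word_scale \<phi> w x" by (rule word_scale_pos[OF lk x])
    have 3: "\<bar>ln (diameter (word_map \<phi> w ` X v)) - (ln (word_scale \<phi> w x) + ln (diameter (X v)))\<bar> \<le> K1"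
      using K1(2)[OF lk subset_refl x connected_X[OF vu(1)] diameter_X_pos[OF vu(1)]]
        diameter_X_pos[OF vu(1)] s by (simp add: ln_mult)
    have low: "word_scale \<phi> w x \<le> deriv_norm G X \<phi> w" by (rule K2(2)[OF lk len(2) x])
    then have "ln (word_scale \<phi> w x) \<le> ln (deriv_norm G X \<phi> w)" using s by simp
    moreover have "ln (deriv_norm G X \<phi> w) \<le> ln (exp K2 * word_scale \<phi> w x)"
      using K2(3)[OF lk len(2) x] low s by (simp del: ln_mult)
    moreover have "ln (exp K2 * word_scale \<phi> w x) = K2 + ln (word_scale \<phi> w x)"
      using s by (subst ln_mult) auto
    ultimately have 4: "\<bar>ln (word_scale \<phi> w x) - ln (deriv_norm G X \<phi> w)\<bar> \<le> K2" by linarith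
    have "\<bar>S1 - ln (deriv_norm G X \<phi> w)\<bar> \<le> K * real M + 2 * B + K1 + K2 + real n * \<epsilon>"
      using 1 2 3 4 B[OF vu(1)] B[OF vu(2)] by linarith
    then show "\<bar>(\<Sum>k<n. ln (scaling_function G X \<phi> (c w k))) - ln (deriv_norm G X \<phi> w)\<bar>
        \<le> K * real M + 2 * B + K1 + K2 + real n * \<epsilon>"
      by (simp add: S1_def)
  qed
qed

end

section \<open>Sums in the extended reals and exponential growth rates\<close>

lemma infsum_ennreal_leI:
  fixes f :: "'a \<Rightarrow> ennreal"
  assumes "\<And>F. finite F \<Longrightarrow> F \<subseteq> A \<Longrightarrow> sum f F \<le> C"
  shows "infsum f A \<le> C"
  by (subst nonneg_infsum_complete) (auto intro!: SUP_least assms)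

lemma sum_le_infsum_ennreal:
  fixes f :: "'a \<Rightarrow> ennreal"
  assumes "finite F" "F \<subseteq> A"
  shows "sum f F \<le> infsum f A"
  using assms by (subst nonneg_infsum_complete) (auto intro!: SUP_upper)

lemma infsum_ennreal_le_cmult:
  fixes f g :: "'a \<Rightarrow> ennreal"
  assumes "\<And>x. x \<in> A \<Longrightarrow> f x \<le> C * g x"
  shows "infsum f A \<le> C * infsum g A"
proof (rule infsum_ennreal_leI)
  fix F assume F: "finite F" "F \<subseteq> A"
  have "sum f F \<le> (\<Sum>x\<in>F. C * g x)" using assms F by (intro sum_mono) auto
  also have "\<dots> = C * sum g F" by (simp add: sum_distrib_left)
  also have "\<dots> \<le> C * infsum g A" using sum_le_infsum_ennreal[OF F] by (intro mult_left_mono) auto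
  finally show "sum f F \<le> C * infsum g A" .
qed

lemma ext_log_pos: "0 < x \<Longrightarrow> ext_log (ennreal x) = ereal (ln x)"
  by (simp add: ext_log_def)

lemma growth_rate_le:
  assumes "x \<le> ennreal (exp b) * y" and n: "n \<ge> 1"
  shows "ereal (1 / real n) * ext_log x \<le> ereal (1 / real n) * ext_log y + ereal (b / real n)"
proof (cases "y = \<infinity> \<or> x = 0")
  case True
  have "ereal (1 / real n) * ext_log x = -\<infinity>" if "x = 0"
    using n that by (simp add: ext_log_def)
  moreover have "ereal (1 / real n) * ext_log y = \<infinity>" if "y = \<infinity>"
    using n that by (simp add: ext_log_def)
  ultimately show ?thesis using True by auto
next
  case False
  then obtain y' where y': "y = ennreal y'" "y' \<ge> 0" by (cases y) (auto simp: top_ennreal_def)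
  then have le: "x \<le> ennreal (exp b * y')" using assms by (simp add: ennreal_mult)
  then have "x \<noteq> \<infinity>" by (auto simp: top_unique)
  then obtain x' where x': "x = ennreal x'" "x' \<ge> 0" by (cases x) auto
  have x'p: "x' > 0" using False x' by (cases "x' = 0") auto
  have xy: "x' \<le> exp b * y'" using le x' y' by (simp add: ennreal_le_iff)
  then have y'p: "y' > 0" using x'p y' by (cases "y' = 0") auto
  have "ln x' \<le> ln (exp b * y')" using xy x'p by (simp del: ln_mult)
  also have "\<dots> = b + ln y'" using y'p by (subst ln_mult) auto
  finally have "ln x' / real n \<le> (b + ln y') / real n" by (rule divide_right_mono) simp
  then show ?thesis
    by (simp add: x'(1) y'(1) ext_log_pos[OF x'p] ext_log_pos[OF y'p] add_divide_distrib)
qed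

text \<open>
  The growth rates may be infinite, so they cannot be subtracted; the order characterisation of
  limits in the extended reals avoids this.
\<close>

lemma growth_rate_transfer:
  fixes S T :: "nat \<Rightarrow> ennreal"
  assumes le: "\<And>\<epsilon>. \<epsilon> > 0 \<Longrightarrow> \<exists>A. \<forall>n\<ge>1. T n \<le> ennreal (exp (A + real n * \<epsilon>)) * S n \<and>
                                          S n \<le> ennreal (exp (A + real n * \<epsilon>)) * T n"
    and lim: "(\<lambda>n. ereal (1 / real n) * ext_log (S n)) \<longlonglongrightarrow> P"
  shows "(\<lambda>n. ereal (1 / real n) * ext_log (T n)) \<longlonglongrightarrow> P"
proof -
  define s t where "s = (\<lambda>n. ereal (1 / real n) * ext_log (S n))"
    and "t = (\<lambda>n. ereal (1 / real n) * ext_log (T n))"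
  have near: "\<forall>\<^sub>F n in sequentially. t n \<le> s n + ereal d \<and> s n \<le> t n + ereal d" if d: "d > 0" for d
  proof -
    obtain A where A: "\<And>n. n \<ge> 1 \<Longrightarrow> T n \<le> ennreal (exp (A + real n * (d / 2))) * S n"
      "\<And>n. n \<ge> 1 \<Longrightarrow> S n \<le> ennreal (exp (A + real n * (d / 2))) * T n"
      using le[of "d / 2"] d by auto
    have "(\<lambda>n. A / real n) \<longlonglongrightarrow> 0" by (rule lim_const_over_n)
    then have "\<forall>\<^sub>F n in sequentially. A / real n < d / 2" using d by (intro order_tendstoD) auto
    then show ?thesis
      using eventually_ge_at_top[of 1]
    proof eventually_elim
      case (elim n)
      have "(A + real n * (d / 2)) / real n = A / real n + d / 2" using elim by (simp add: add_divide_distrib)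
      then have "(A + real n * (d / 2)) / real n \<le> d" using elim(1) by linarith
      then have *: "z + ereal ((A + real n * (d / 2)) / real n) \<le> z + ereal d" for z
        by (intro add_left_mono) simp
      have "t n \<le> s n + ereal ((A + real n * (d / 2)) / real n)"
        "s n \<le> t n + ereal ((A + real n * (d / 2)) / real n)"
        unfolding s_def t_def by (rule growth_rate_le[OF A(1) elim(2)], rule elim(2))
          (rule growth_rate_le[OF A(2) elim(2)], rule elim(2))
      then show ?case using * by (meson order_trans)
    qed
  qed
  have lim': "s \<longlonglongrightarrow> P" using lim by (simp add: s_def)
  have "t \<longlonglongrightarrow> P"
  proof (rule order_tendstoI)
    fix c assume "P < c"
    then obtain r' where r': "P < ereal r'" "ereal r' < c" using ereal_dense2 by blast
    then obtain r where r: "P < ereal r" "r < r'" using ereal_dense2[of P "ereal r'"] by auto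
    have "\<forall>\<^sub>F n in sequentially. s n < ereal r" using lim' r by (intro order_tendstoD) auto
    moreover have "\<forall>\<^sub>F n in sequentially. t n \<le> s n + ereal (r' - r) \<and> s n \<le> t n + ereal (r' - r)"
      using r by (intro near) simp
    ultimately show "\<forall>\<^sub>F n in sequentially. t n < c"
    proof eventually_elim
      case (elim n)
      have "t n \<le> ereal r + ereal (r' - r)" using elim by (meson add_right_mono less_imp_le order_trans)
      then show ?case using r'(2) by simp
    qed
  next
    fix c assume "c < P"
    then obtain r' where r': "c < ereal r'" "ereal r' < P" using ereal_dense2 by blast
    then obtain r where r: "ereal r < P" "r' < r" using ereal_dense2[of "ereal r'" P] by auto
    have "\<forall>\<^sub>F n in sequentially. ereal r < s n" using lim' r by (intro order_tendstoD) auto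
    moreover have "\<forall>\<^sub>F n in sequentially. t n \<le> s n + ereal (r - r') \<and> s n \<le> t n + ereal (r - r')"
      using r by (intro near) simp
    ultimately show "\<forall>\<^sub>F n in sequentially. c < t n"
    proof eventually_elim
      case (elim n)
      have "ereal r < t n + ereal (r - r')" using elim by (meson less_le_trans)
      then have "ereal r' < t n" by (cases "t n") auto
      then show ?case using r'(1) by (meson less_trans)
    qed
  qed
  then show ?thesis by (simp add: t_def)
qed

lemma fekete_subadditive_limit:
  fixes a :: "nat \<Rightarrow> real"
  assumes "\<And>m n. 1 \<le> m \<Longrightarrow> 1 \<le> n \<Longrightarrow> a (m + n) \<le> a m + a n"
  shows "(\<lambda>n. ereal (a n / real n)) \<longlonglongrightarrow> (INF n\<in>{1..}. ereal (a n / real n))"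
proof (rule order_tendstoI)
  fix c assume c: "c < (INF n\<in>{1..}. ereal (a n / real n))"
  show "\<forall>\<^sub>F n in sequentially. c < ereal (a n / real n)"
    using eventually_ge_at_top[of 1]
  proof eventually_elim
    case (elim n)
    have "(INF n\<in>{1..}. ereal (a n / real n)) \<le> ereal (a n / real n)" using elim by (intro INF_lower) auto
    then show ?case using c by (rule less_le_trans[rotated])
  qed
next
  fix c assume "(INF n\<in>{1..}. ereal (a n / real n)) < c"
  then obtain m where m: "m \<ge> 1" "ereal (a m / real m) < c" by (auto simp: INF_less_iff)
  define \<mu> where "\<mu> = a m / real m"
  obtain r where r: "\<mu> < r" "ereal r < c" using ereal_dense2[OF m(2)] by (auto simp: \<mu>_def)
  \<comment> \<open>the value at 0 is replaced by 0 because the remainder modulo \<open>m\<close> may vanish\<close>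
  define b where "b = (\<lambda>n. if n = 0 then 0 else a n)"
  have sub: "b (i + j) \<le> b i + b j" for i j using assms[of i j] by (auto simp: b_def)
  have mult: "b (q * m + s) \<le> real q * b m + b s" for q s
  proof (induction q)
    case (Suc q)
    have "b (Suc q * m + s) \<le> b m + b (q * m + s)" using sub[of m "q * m + s"] by (simp add: add.assoc)
    then show ?case using Suc by (simp add: algebra_simps)
  qed simp
  define B where "B = Max (b ` {..<m})"
  have B: "b s \<le> B" if "s < m" for s unfolding B_def using that by (intro Max_ge) auto
  define C where "C = real m * \<bar>\<mu>\<bar> + B"
  have est: "a n \<le> real n * \<mu> + C" if n: "n \<ge> 1" for n
  proof -
    have nq: "n = (n div m) * m + n mod m" by simp
    have "a n = b n" using n by (simp add: b_def)
    also have "\<dots> \<le> real (n div m) * b m + b (n mod m)" using mult[of "n div m" "n mod m"] by simp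
    also have "b m = real m * \<mu>" using m by (simp add: b_def \<mu>_def)
    also have "real (n div m) * (real m * \<mu>) = (real n - real (n mod m)) * \<mu>"
    proof -
      have "real n = real (n div m) * real m + real (n mod m)" by (metis nq of_nat_add of_nat_mult)
      then show ?thesis by (simp add: algebra_simps)
    qed
    finally have "a n \<le> real n * \<mu> - real (n mod m) * \<mu> + b (n mod m)" by (simp add: algebra_simps)
    moreover have "b (n mod m) \<le> B" using m by (intro B) auto
    moreover have "- (real (n mod m) * \<mu>) \<le> real m * \<bar>\<mu>\<bar>"
    proof -
      have "- (real (n mod m) * \<mu>) \<le> real (n mod m) * \<bar>\<mu>\<bar>"
        by (metis abs_ge_minus_self abs_mult abs_of_nat)
      also have "\<dots> \<le> real m * \<bar>\<mu>\<bar>" using m by (intro mult_right_mono) (auto intro: less_imp_le)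
      finally show ?thesis .
    qed
    ultimately show ?thesis by (simp add: C_def)
  qed
  have "(\<lambda>n. C / real n) \<longlonglongrightarrow> 0" by (rule lim_const_over_n)
  then have "\<forall>\<^sub>F n in sequentially. C / real n < r - \<mu>" using r by (intro order_tendstoD) auto
  then show "\<forall>\<^sub>F n in sequentially. ereal (a n / real n) < c"
    using eventually_ge_at_top[of 1]
  proof eventually_elim
    case (elim n)
    have "a n / real n \<le> (real n * \<mu> + C) / real n" using est[OF elim(2)] by (intro divide_right_mono) auto
    also have "\<dots> = \<mu> + C / real n" using elim by (simp add: add_divide_distrib)
    also have "\<dots> < r" using elim by simp
    finally have "ereal (a n / real n) < ereal r" by simp
    then show ?case using r(2) by (rule less_trans)
  qed
qed

section \<open>Partition sums and the pressure\<close>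

context primitive_cgdms
begin

lemma deriv_norm_pos:
  assumes "links G w v u" "w \<noteq> []"
  shows "0 < deriv_norm G X \<phi> w"
proof -
  obtain x where x: "x \<in> X v" using nonempty_X[OF links_verts(1)[OF assms(1)]] by blast
  have "word_scale \<phi> w x \<le> deriv_norm G X \<phi> w" using deriv_norm_comparable assms x by blast
  then show ?thesis using word_scale_pos[OF assms(1) x] by linarith
qed

lemma deriv_norm_submult:
  assumes b: "links G b v m" "b \<noteq> []" and a: "links G a m u" "a \<noteq> []"
  shows "deriv_norm G X \<phi> (a @ b) \<le> deriv_norm G X \<phi> a * deriv_norm G X \<phi> b"
proof -
  have ab: "links G (a @ b) v u" using a b by (auto simp: links_append[OF wf_digraph_axioms])
  have "X v \<noteq> {}" using nonempty_X[OF links_verts(1)[OF b(1)]] .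
  moreover have "word_scale \<phi> (a @ b) x \<le> deriv_norm G X \<phi> a * deriv_norm G X \<phi> b" if x: "x \<in> X v" for x
  proof -
    have x': "word_map \<phi> b x \<in> X m" by (rule word_map_into[OF b(1) x])
    have "word_scale \<phi> a (word_map \<phi> b x) \<le> deriv_norm G X \<phi> a" "word_scale \<phi> b x \<le> deriv_norm G X \<phi> b"
      using deriv_norm_comparable a b x x' by blast+
    then show ?thesis
      unfolding word_scale_append using word_scale_pos[OF b(1) x] word_scale_pos[OF a(1) x']
      by (intro mult_mono) auto
  qed
  ultimately show ?thesis
    using deriv_norm_eq[OF ab] b(2) by (simp add: cSUP_least)
qed

lemma deriv_norm_supermult:
  "\<exists>\<kappa>>0. \<forall>a b v m u. links G b v m \<longrightarrow> b \<noteq> [] \<longrightarrow> links G a m u \<longrightarrow> a \<noteq> [] \<longrightarrow>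
     \<kappa> * (deriv_norm G X \<phi> a * deriv_norm G X \<phi> b) \<le> deriv_norm G X \<phi> (a @ b)"
proof -
  obtain K where K: "K \<ge> 0"
    "\<And>w v u x. links G w v u \<Longrightarrow> w \<noteq> [] \<Longrightarrow> x \<in> X v \<Longrightarrow> word_scale \<phi> w x \<le> deriv_norm G X \<phi> w"
    "\<And>w v u x. links G w v u \<Longrightarrow> w \<noteq> [] \<Longrightarrow> x \<in> X v \<Longrightarrow> deriv_norm G X \<phi> w \<le> exp K * word_scale \<phi> w x"
    using deriv_norm_comparable by blast
  show ?thesis
  proof (intro exI[of _ "exp (- K) * exp (- K)"] conjI allI impI)
    fix a b v m u
    assume b: "links G b v m" "b \<noteq> []" and a: "links G a m u" "a \<noteq> []"
    have ab: "links G (a @ b) v u" using a b by (auto simp: links_append[OF wf_digraph_axioms])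
    obtain x where x: "x \<in> X v" using nonempty_X[OF links_verts(1)[OF b(1)]] by blast
    have x': "word_map \<phi> b x \<in> X m" by (rule word_map_into[OF b(1) x])
    have "exp (- K) * deriv_norm G X \<phi> a \<le> word_scale \<phi> a (word_map \<phi> b x)"
      using K(3)[OF a x'] by (simp add: exp_minus field_simps)
    moreover have "exp (- K) * deriv_norm G X \<phi> b \<le> word_scale \<phi> b x"
      using K(3)[OF b x] by (simp add: exp_minus field_simps)
    ultimately have "(exp (- K) * deriv_norm G X \<phi> a) * (exp (- K) * deriv_norm G X \<phi> b)
        \<le> word_scale \<phi> (a @ b) x"
      unfolding word_scale_append using deriv_norm_pos[OF b] word_scale_pos[OF a(1) x']
      by (intro mult_mono) auto
    also have "\<dots> \<le> deriv_norm G X \<phi> (a @ b)" using K(2)[OF ab _ x] b by simp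
    finally show "exp (- K) * exp (- K) * (deriv_norm G X \<phi> a * deriv_norm G X \<phi> b) \<le> deriv_norm G X \<phi> (a @ b)"
      by (simp add: mult_ac)
  qed simp
qed

definition partition_sum :: "real \<Rightarrow> nat \<Rightarrow> ennreal" where
  "partition_sum t n = (\<Sum>\<^sub>\<infinity>w\<in>words G n. ennreal (deriv_norm G X \<phi> w powr t))"

lemma words_split:
  assumes "w \<in> words G (n + m)" "1 \<le> n" "1 \<le> m"
  shows "\<exists>v k u. links G (drop n w) v k \<and> links G (take n w) k u"
    and "drop n w \<in> words G m" "take n w \<in> words G n" "take n w \<noteq> []" "drop n w \<noteq> []"
proof -
  have len: "length w = n + m" using assms by (auto simp: words_def)
  then have ne: "w \<noteq> []" using assms by auto
  then have "links G (take n w @ drop n w) (head G (last w)) (tail G (hd w))"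
    using links_words[OF wf_digraph_axioms assms(1)] by simp
  then obtain k where k: "links G (drop n w) (head G (last w)) k" "links G (take n w) k (tail G (hd w))"
    unfolding links_append[OF wf_digraph_axioms] by blast
  then show "\<exists>v k u. links G (drop n w) v k \<and> links G (take n w) k u" by blast
  show "drop n w \<in> words G m" "take n w \<in> words G n" "take n w \<noteq> []" "drop n w \<noteq> []"
    using links_imp_words[OF k(1)] links_imp_words[OF k(2)] len assms ne by auto
qed

lemma partition_sum_submult:
  assumes t: "t \<ge> 0" and n: "1 \<le> n" and m: "1 \<le> m"
  shows "partition_sum t (n + m) \<le> partition_sum t n * partition_sum t m"
  unfolding partition_sum_def[of _ "n + m"]
proof (rule infsum_ennreal_leI)
  fix F assume F: "finite F" "F \<subseteq> words G (n + m)"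
  let ?f = "\<lambda>w. ennreal (deriv_norm G X \<phi> w powr t)"
  have "sum ?f F \<le> (\<Sum>w\<in>F. ?f (take n w) * ?f (drop n w))"
  proof (rule sum_mono)
    fix w assume "w \<in> F"
    then have w: "w \<in> words G (n + m)" using F(2) by (rule subsetD[rotated])
    obtain v k u where s: "links G (drop n w) v k" "links G (take n w) k u"
      using words_split(1)[OF w n m] by blast
    note s = s words_split(4,5)[OF w n m]
    have "deriv_norm G X \<phi> (take n w @ drop n w) \<le> deriv_norm G X \<phi> (take n w) * deriv_norm G X \<phi> (drop n w)"
      by (rule deriv_norm_submult[OF s(1,4,2,3)])
    moreover have "links G (take n w @ drop n w) v u"
      unfolding links_append[OF wf_digraph_axioms] using s(1,2) by blast
    then have "0 < deriv_norm G X \<phi> (take n w @ drop n w)" by (rule deriv_norm_pos) (use s in simp)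
    ultimately have "deriv_norm G X \<phi> (take n w @ drop n w) powr t
        \<le> (deriv_norm G X \<phi> (take n w) * deriv_norm G X \<phi> (drop n w)) powr t"
      using t by (intro powr_mono2) auto
    then have "deriv_norm G X \<phi> w powr t \<le> deriv_norm G X \<phi> (take n w) powr t * deriv_norm G X \<phi> (drop n w) powr t"
      using deriv_norm_pos[OF s(1,4)] deriv_norm_pos[OF s(2,3)] by (simp add: powr_mult)
    then show "?f w \<le> ?f (take n w) * ?f (drop n w)"
      by (simp add: ennreal_leI flip: ennreal_mult)
  qed
  also have "\<dots> = (\<Sum>p\<in>(\<lambda>w. (take n w, drop n w)) ` F. ?f (fst p) * ?f (snd p))"
  proof (subst sum.reindex)
    show "inj_on (\<lambda>w. (take n w, drop n w)) F" by (rule inj_onI) (metis append_take_drop_id prod.inject)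
  qed simp
  also have "\<dots> \<le> (\<Sum>p\<in>take n ` F \<times> drop n ` F. ?f (fst p) * ?f (snd p))"
    using F by (intro sum_mono2) auto
  also have "\<dots> = sum ?f (take n ` F) * sum ?f (drop n ` F)"
    unfolding sum_product sum.cartesian_product by (intro sum.cong) auto
  also have "\<dots> \<le> partition_sum t n * partition_sum t m"
    unfolding partition_sum_def
  proof (intro mult_mono sum_le_infsum_ennreal)
    show "take n ` F \<subseteq> words G n" "drop n ` F \<subseteq> words G m"
      using words_split(2,3)[OF subsetD[OF F(2)] n m] by auto
  qed (use F in auto)
  finally show "sum ?f F \<le> partition_sum t n * partition_sum t m" .
qed

text \<open>
  The first letters of the finitely many connecting words.
\<close>

lemma finite_successors:
  "\<exists>B. finite B \<and> B \<subseteq> arcs G \<and> (\<forall>e\<in>arcs G. \<exists>b\<in>B. head G e = tail G b)"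
proof -
  obtain n \<Lambda> where \<Lambda>: "n \<ge> 1" "finite \<Lambda>" "\<Lambda> \<subseteq> words G n"
    "\<And>e1 e2. e1 \<in> arcs G \<Longrightarrow> e2 \<in> arcs G \<Longrightarrow> \<exists>w\<in>\<Lambda>. e1 # w @ [e2] \<in> words G (n + 2)"
    using primitive unfolding finitely_primitive_def by blast
  have ne: "w \<noteq> [] \<and> hd w \<in> arcs G" if "w \<in> \<Lambda>" for w
  proof -
    have "length w = n" "set w \<subseteq> arcs G" using that \<Lambda>(3) by (auto simp: words_def)
    then show ?thesis using \<Lambda>(1) by (cases w) auto
  qed
  show ?thesis
  proof (intro exI[of _ "hd ` \<Lambda>"] conjI ballI)
    fix e assume e: "e \<in> arcs G"
    then obtain w where w: "w \<in> \<Lambda>" "e # w @ [e] \<in> words G (n + 2)" using \<Lambda>(4) by blast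
    then have "head G e = tail G (hd w)"
      using ne[OF w(1)] by (cases w) (auto simp: words_def admissible_def)
    then show "\<exists>b\<in>hd ` \<Lambda>. head G e = tail G b" using w(1) by blast
  qed (use \<Lambda> ne in auto)
qed

text \<open>
  Each letter \<open>e\<close> is extended to a word of length \<open>n\<close> by a continuation taken from a finite set. The
  derivative norms of these continuations have a positive minimum, so by bounded distortion the
  extension costs at most a constant factor, which leaves an infinite sum infinite.
\<close>

lemma partition_sum_infinite:
  assumes t: "t \<ge> 0" and inf: "partition_sum t 1 = \<infinity>" and n: "n \<ge> 1"
  shows "partition_sum t n = \<infinity>"
proof (cases "n = 1")
  case False
  then obtain k where k: "n = Suc k" "1 \<le> k" using n by (cases n) auto
  let ?f = "\<lambda>w. ennreal (deriv_norm G X \<phi> w powr t)"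
  obtain B where B: "finite B" "B \<subseteq> arcs G" "\<And>e. e \<in> arcs G \<Longrightarrow> \<exists>b\<in>B. head G e = tail G b"
    using finite_successors by blast
  define U where "U = {u. set u \<subseteq> B \<and> length u = k}"
  have fin: "finite U" unfolding U_def using B(1) by (rule finite_lists_length_eq)
  have "\<exists>u v. set u \<subseteq> B \<and> length u = j \<and> links G u v (head G e)" if "e \<in> arcs G" for e j
    using that
  proof (induction j arbitrary: e)
    case 0
    then show ?case by (intro exI[of _ "[]"] exI[of _ "head G e"]) simp
  next
    case (Suc j)
    obtain b where b: "b \<in> B" "head G e = tail G b" using B(3)[OF Suc.prems] by blast
    then obtain u v where "set u \<subseteq> B" "length u = j" "links G u v (head G b)" using Suc.IH[of b] B(2) by blast
    then show ?case using b B(2) by (intro exI[of _ "b # u"] exI[of _ v]) auto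
  qed
  then have "\<forall>e\<in>arcs G. \<exists>u. u \<in> U \<and> (\<exists>v. links G u v (head G e))" unfolding U_def by blast
  then obtain ext where ext: "\<And>e. e \<in> arcs G \<Longrightarrow> ext e \<in> U" "\<And>e. e \<in> arcs G \<Longrightarrow> \<exists>v. links G (ext e) v (head G e)"
    unfolding bchoice_iff by blast
  have ext_ne: "ext e \<noteq> []" if "e \<in> arcs G" for e using ext(1)[OF that] k(2) by (auto simp: U_def)
  obtain \<kappa> where \<kappa>: "\<kappa> > 0" "\<And>a b v m u. links G b v m \<Longrightarrow> b \<noteq> [] \<Longrightarrow> links G a m u \<Longrightarrow> a \<noteq> [] \<Longrightarrow>
     \<kappa> * (deriv_norm G X \<phi> a * deriv_norm G X \<phi> b) \<le> deriv_norm G X \<phi> (a @ b)"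
    using deriv_norm_supermult by blast
  have fin_ext: "finite (ext ` arcs G)" using ext(1) fin by (meson finite_subset image_subsetI)
  define \<mu> where "\<mu> = Min (insert 1 (deriv_norm G X \<phi> ` ext ` arcs G))"
  have \<mu>_le: "\<mu> \<le> deriv_norm G X \<phi> (ext e)" if "e \<in> arcs G" for e
    unfolding \<mu>_def using fin_ext that by (intro Min_le) auto
  have "0 < deriv_norm G X \<phi> (ext e)" if "e \<in> arcs G" for e
    using deriv_norm_pos ext(2)[OF that] ext_ne[OF that] by blast
  then have \<mu>: "\<mu> > 0"
    unfolding \<mu>_def using fin_ext by (subst Min_gr_iff) auto
  define c where "c = (\<kappa> * \<mu>) powr (- t)"
  have single: "?f [e] \<le> ennreal c * ?f (e # ext e)" if e: "e \<in> arcs G" for e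
  proof -
    obtain v where v: "links G (ext e) v (head G e)" using ext(2)[OF e] by blast
    have le: "links G [e] (head G e) (tail G e)" using e by simp
    have d: "0 < deriv_norm G X \<phi> [e]" using deriv_norm_pos[OF le] by simp
    have "\<kappa> * \<mu> * deriv_norm G X \<phi> [e] \<le> \<kappa> * (deriv_norm G X \<phi> [e] * deriv_norm G X \<phi> (ext e))"
      using \<mu>_le[OF e] \<kappa>(1) d by simp
    also have "\<dots> \<le> deriv_norm G X \<phi> (e # ext e)" using \<kappa>(2)[OF v ext_ne[OF e] le] by simp
    finally have "(\<kappa> * \<mu> * deriv_norm G X \<phi> [e]) powr t \<le> deriv_norm G X \<phi> (e # ext e) powr t"
      using t \<kappa>(1) \<mu> d by (intro powr_mono2) auto
    then have "(\<kappa> * \<mu>) powr t * deriv_norm G X \<phi> [e] powr t \<le> deriv_norm G X \<phi> (e # ext e) powr t"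
      using \<kappa>(1) \<mu> d by (simp add: powr_mult)
    then have "c * ((\<kappa> * \<mu>) powr t * deriv_norm G X \<phi> [e] powr t) \<le> c * deriv_norm G X \<phi> (e # ext e) powr t"
      unfolding c_def by (intro mult_left_mono) auto
    moreover have "c * (\<kappa> * \<mu>) powr t = 1" unfolding c_def using \<kappa>(1) \<mu> by (simp flip: powr_add)
    ultimately have "deriv_norm G X \<phi> [e] powr t \<le> c * deriv_norm G X \<phi> (e # ext e) powr t"
      by (simp flip: mult.assoc)
    then show ?thesis by (simp add: c_def ennreal_leI flip: ennreal_mult)
  qed
  have "partition_sum t 1 \<le> ennreal c * partition_sum t n"
    unfolding partition_sum_def[of _ 1]
  proof (rule infsum_ennreal_leI)
    fix F assume F: "finite F" "F \<subseteq> words G 1"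
    define g where "g = (\<lambda>w. hd w # ext (hd w))"
    have w1: "w = [hd w] \<and> hd w \<in> arcs G" if "w \<in> F" for w
      using that F(2) by (cases w) (auto simp: words_def)
    have "sum ?f F \<le> (\<Sum>w\<in>F. ennreal c * ?f (g w))"
      using single w1 unfolding g_def by (intro sum_mono) metis
    also have "\<dots> = ennreal c * (\<Sum>w\<in>F. ?f (g w))" by (rule sum_distrib_left[symmetric])
    also have "(\<Sum>w\<in>F. ?f (g w)) = sum ?f (g ` F)"
    proof (rule sum.reindex[symmetric, unfolded o_def])
      show "inj_on g F" unfolding g_def by (rule inj_onI) (metis list.inject w1)
    qed
    also have "ennreal c * \<dots> \<le> ennreal c * partition_sum t n"
      unfolding partition_sum_def
    proof (intro mult_left_mono sum_le_infsum_ennreal)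
      have "g w \<in> words G n" if w: "w \<in> F" for w
      proof -
        have e: "hd w \<in> arcs G" using w1[OF w] by blast
        obtain v where "links G (ext (hd w)) v (head G (hd w))" using ext(2)[OF e] by blast
        then have "links G (g w) v (tail G (hd w))" using e by (simp add: g_def)
        then have "g w \<in> words G (length (g w))" by (rule links_imp_words)
        moreover have "length (g w) = n" using ext(1)[OF e] k by (simp add: g_def U_def)
        ultimately show ?thesis by simp
      qed
      then show "g ` F \<subseteq> words G n" by blast
    qed (use F in auto)
    finally show "sum ?f F \<le> ennreal c * partition_sum t n" .
  qed
  then have "ennreal c * partition_sum t n = \<infinity>" using inf by (simp add: top_unique)
  then show ?thesis by (simp add: ennreal_mult_eq_top_iff)
qed (use inf in simp)

lemma partition_sum_nonzero:
  assumes ne: "arcs G \<noteq> {}" and n: "n \<ge> 1"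
  shows "partition_sum t n \<noteq> 0"
proof -
  obtain e where e: "e \<in> arcs G" using ne by blast
  have "\<exists>w v. length w = j \<and> links G w v (head G e)" if "e \<in> arcs G" for j e
    using that
  proof (induction j arbitrary: e)
    case 0
    then show ?case by (intro exI[of _ "[]"] exI[of _ "head G e"]) simp
  next
    case (Suc j)
    obtain b where b: "b \<in> arcs G" "head G e = tail G b" using finite_successors Suc.prems by blast
    then obtain u v where "length u = j" "links G u v (head G b)" using Suc.IH[of b] by blast
    then show ?case using b by (intro exI[of _ "b # u"] exI[of _ v]) auto
  qed
  then obtain w v where w: "length w = n" "links G w v (head G e)" using e by blast
  have "0 < deriv_norm G X \<phi> w" using w n by (intro deriv_norm_pos) auto
  moreover have "w \<in> words G n" using links_imp_words[OF w(2)] w(1) by simp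
  then have "sum (\<lambda>w. ennreal (deriv_norm G X \<phi> w powr t)) {w} \<le> partition_sum t n"
    unfolding partition_sum_def by (intro sum_le_infsum_ennreal) auto
  ultimately show ?thesis by auto
qed

lemma pressure_limit:
  assumes t: "t \<ge> 0"
  shows "(\<lambda>n. ereal (1 / real n) * ext_log (partition_sum t n)) \<longlonglongrightarrow> pressure G X \<phi> t"
proof -
  have "\<exists>P. (\<lambda>n. ereal (1 / real n) * ext_log (partition_sum t n)) \<longlonglongrightarrow> P"
  proof -
    consider "arcs G = {}" | "partition_sum t 1 = \<infinity>" | "arcs G \<noteq> {}" "partition_sum t 1 \<noteq> \<infinity>" by blast
    then show ?thesis
    proof cases
      case 1
      have "ereal (1 / real n) * ext_log (partition_sum t n) = -\<infinity>" if n: "n \<ge> 1" for n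
      proof -
        have "words G n = {}" using 1 n by (auto simp: words_def)
        then show ?thesis using n by (simp add: partition_sum_def ext_log_def)
      qed
      then have "(\<lambda>n. ereal (1 / real n) * ext_log (partition_sum t n)) \<longlonglongrightarrow> -\<infinity>"
        by (intro tendsto_eventually eventually_mono[OF eventually_ge_at_top[of 1]])
      then show ?thesis by blast
    next
      case 2
      have "ereal (1 / real n) * ext_log (partition_sum t n) = \<infinity>" if n: "n \<ge> 1" for n
        using partition_sum_infinite[OF t 2 n] n by (simp add: ext_log_def)
      then have "(\<lambda>n. ereal (1 / real n) * ext_log (partition_sum t n)) \<longlonglongrightarrow> \<infinity>"
        by (intro tendsto_eventually eventually_mono[OF eventually_ge_at_top[of 1]])
      then show ?thesis by blast
    next
      case 3
      have fin: "partition_sum t (Suc n) \<noteq> \<infinity>" for n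
      proof (induction n)
        case (Suc n)
        have "partition_sum t (Suc (Suc n)) \<le> partition_sum t (Suc n) * partition_sum t 1" using partition_sum_submult[OF t, of "Suc n" 1] by simp
        moreover have "partition_sum t (Suc n) * partition_sum t 1 \<noteq> \<infinity>" using Suc 3 by (simp add: ennreal_mult_eq_top_iff)
        ultimately show ?case by (auto simp: top_unique)
      qed (use 3 in simp)
      have ex: "\<exists>x>0. partition_sum t n = ennreal x" if n: "n \<ge> 1" for n
      proof -
        obtain k where "n = Suc k" using n by (cases n) auto
        then have "partition_sum t n \<noteq> \<infinity>" using fin by blast
        moreover have "partition_sum t n \<noteq> 0" by (rule partition_sum_nonzero[OF 3(1) n])
        ultimately show ?thesis by (cases "partition_sum t n") (auto simp: less_le)
      qed
      then obtain \<sigma> where \<sigma>: "\<And>n. n \<ge> 1 \<Longrightarrow> \<sigma> n > 0" "\<And>n. n \<ge> 1 \<Longrightarrow> partition_sum t n = ennreal (\<sigma> n)" by metis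
      define a where "a = (\<lambda>n. ln (\<sigma> n))"
      have "a (m + n) \<le> a m + a n" if mn: "1 \<le> m" "1 \<le> n" for m n
      proof -
        have "ennreal (\<sigma> (m + n)) \<le> ennreal (\<sigma> m * \<sigma> n)"
          using partition_sum_submult[OF t mn] \<sigma> mn by (simp add: ennreal_mult less_imp_le)
        then have "\<sigma> (m + n) \<le> \<sigma> m * \<sigma> n" using \<sigma>(1)[OF mn(1)] \<sigma>(1)[OF mn(2)] by (subst (asm) ennreal_le_iff) auto
        then have "ln (\<sigma> (m + n)) \<le> ln (\<sigma> m * \<sigma> n)" using \<sigma>(1)[of "m + n"] mn by (simp del: ln_mult)
        also have "\<dots> = ln (\<sigma> m) + ln (\<sigma> n)" using \<sigma>(1)[OF mn(1)] \<sigma>(1)[OF mn(2)] by (simp add: ln_mult)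
        finally show ?thesis by (simp add: a_def)
      qed
      then have "(\<lambda>n. ereal (a n / real n)) \<longlonglongrightarrow> (INF n\<in>{1..}. ereal (a n / real n))" by (rule fekete_subadditive_limit)
      moreover have "\<forall>\<^sub>F n in sequentially. ereal (a n / real n) = ereal (1 / real n) * ext_log (partition_sum t n)"
        using eventually_ge_at_top[of 1] by eventually_elim (simp add: \<sigma> ext_log_pos a_def)
      ultimately have "(\<lambda>n. ereal (1 / real n) * ext_log (partition_sum t n)) \<longlonglongrightarrow> (INF n\<in>{1..}. ereal (a n / real n))"
        by (rule Lim_transform_eventually)
      then show ?thesis by blast
    qed
  qed
  then obtain P where P: "(\<lambda>n. ereal (1 / real n) * ext_log (partition_sum t n)) \<longlonglongrightarrow> P" by blast
  moreover have "pressure G X \<phi> t = P" unfolding pressure_def using P by (intro limI) (simp add: partition_sum_def)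
  ultimately show ?thesis by simp
qed

text \<open>
  The termwise estimate for \<open>t = 1\<close> is raised to the power \<open>t\<close>; the precision \<open>\<epsilon> / (t + 1)\<close> allows
  for the exponent.
\<close>

lemma scaling_sums_comparable:
  fixes c :: "'e list \<Rightarrow> nat \<Rightarrow> nat \<Rightarrow> 'e"
  assumes c: "\<And>n w k. \<lbrakk>w \<in> words G n; k < n\<rbrakk> \<Longrightarrow>
           c w k \<in> dual_space G \<and> trunc (c w k) (n - k) = take (n - k) w"
    and t: "t \<ge> 0" and \<epsilon>: "\<epsilon> > 0"
  defines "T \<equiv> \<lambda>n. \<Sum>\<^sub>\<infinity>w\<in>words G n. ennreal (\<Prod>k<n. scaling_function G X \<phi> (c w k) powr t)"
  shows "\<exists>A. \<forall>n\<ge>1. T n \<le> ennreal (exp (A + real n * \<epsilon>)) * partition_sum t n \<and>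
                    partition_sum t n \<le> ennreal (exp (A + real n * \<epsilon>)) * T n"
proof -
  have "\<epsilon> / (t + 1) > 0" using \<epsilon> t by simp
  from prod_scaling_function_comparable[OF c this]
  obtain A where A: "\<And>n w. n \<ge> 1 \<Longrightarrow> w \<in> words G n \<Longrightarrow>
     \<bar>(\<Sum>k<n. ln (scaling_function G X \<phi> (c w k))) - ln (deriv_norm G X \<phi> w)\<bar> \<le> A + real n * (\<epsilon> / (t + 1))"
    by blast
  show ?thesis
  proof (intro exI[of _ "t * A"] allI impI)
    fix n :: nat assume n: "n \<ge> 1"
    define E where "E = exp (t * A + real n * \<epsilon>)"
    have each: "(\<Prod>k<n. scaling_function G X \<phi> (c w k) powr t) \<le> E * deriv_norm G X \<phi> w powr t
        \<and> deriv_norm G X \<phi> w powr t \<le> E * (\<Prod>k<n. scaling_function G X \<phi> (c w k) powr t)"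
      if w: "w \<in> words G n" for w
    proof -
      define s where "s = (\<Sum>k<n. ln (scaling_function G X \<phi> (c w k)))"
      define d where "d = ln (deriv_norm G X \<phi> w)"
      have "w \<noteq> []" using w n by (auto simp: words_def)
      then have "0 < deriv_norm G X \<phi> w" using deriv_norm_pos links_words[OF wf_digraph_axioms w] by blast
      then have dn: "deriv_norm G X \<phi> w powr t = exp (t * d)" by (simp add: d_def powr_def)
      have "(\<Prod>k<n. scaling_function G X \<phi> (c w k) powr t) = (\<Prod>k<n. exp (t * ln (scaling_function G X \<phi> (c w k))))"
      proof (rule prod.cong)
        fix k assume "k \<in> {..<n}"
        then have "c w k \<in> dual_space G" using c[OF w] by blast
        then have "0 < scaling_function G X \<phi> (c w k)" by (rule scaling_function_limit(1))
        then show "scaling_function G X \<phi> (c w k) powr t = exp (t * ln (scaling_function G X \<phi> (c w k)))"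
          by (simp add: powr_def)
      qed simp
      also have "\<dots> = exp (t * s)" by (simp add: s_def exp_sum sum_distrib_left)
      finally have pr: "(\<Prod>k<n. scaling_function G X \<phi> (c w k) powr t) = exp (t * s)" .
      have "t * \<bar>s - d\<bar> \<le> t * (A + real n * (\<epsilon> / (t + 1)))"
        using A[OF n w] t unfolding s_def d_def by (intro mult_left_mono) auto
      also have "\<dots> = t * A + real n * (t * (\<epsilon> / (t + 1)))" by (simp add: algebra_simps)
      also have "t * (\<epsilon> / (t + 1)) \<le> \<epsilon>" using t \<epsilon> by (simp add: field_simps)
      finally have b: "t * \<bar>s - d\<bar> \<le> t * A + real n * \<epsilon>" by (simp add: mult_left_mono)
      have "t * (s - d) \<le> t * \<bar>s - d\<bar>" "t * (d - s) \<le> t * \<bar>s - d\<bar>" using t by (auto intro!: mult_left_mono)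
      then have "t * s \<le> t * A + real n * \<epsilon> + t * d" "t * d \<le> t * A + real n * \<epsilon> + t * s"
        using b by (auto simp: right_diff_distrib)
      then show ?thesis unfolding pr dn E_def by (simp flip: exp_add)
    qed
    show "T n \<le> ennreal (exp (t * A + real n * \<epsilon>)) * partition_sum t n \<and>
        partition_sum t n \<le> ennreal (exp (t * A + real n * \<epsilon>)) * T n"
      unfolding T_def partition_sum_def E_def[symmetric]
    proof (intro conjI infsum_ennreal_le_cmult)
      have "E \<ge> 0" by (simp add: E_def)
      moreover have "(\<Prod>k<n. scaling_function G X \<phi> (c w k) powr t) \<ge> 0" for w by (intro prod_nonneg) auto
      ultimately show "ennreal (\<Prod>k<n. scaling_function G X \<phi> (c w k) powr t) \<le> ennreal E * ennreal (deriv_norm G X \<phi> w powr t)"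
        "ennreal (deriv_norm G X \<phi> w powr t) \<le> ennreal E * ennreal (\<Prod>k<n. scaling_function G X \<phi> (c w k) powr t)"
        if "w \<in> words G n" for w
        using each[OF that] by (simp_all add: ennreal_leI flip: ennreal_mult)
    qed
  qed
qed

end

section \<open>The pressure in terms of the scaling function\<close>

theorem theoremB:
  fixes G :: "('v, 'e) pre_digraph"
    and lam :: real
    and X :: "'v \<Rightarrow> (real ^ 'd) set"
    and \<phi> :: "'e \<Rightarrow> real ^ 'd \<Rightarrow> real ^ 'd"
    and c :: "'e list \<Rightarrow> nat \<Rightarrow> nat \<Rightarrow> 'e"
    and t :: real
  assumes "cgdms G lam X \<phi>"
    and "finitely_primitive G"
    and "\<And>v. v \<in> verts G \<Longrightarrow> diameter (X v) > 0"
    and "\<And>n w k. \<lbrakk>w \<in> words G n; k < n\<rbrakk> \<Longrightarrow>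
           c w k \<in> dual_space G \<and> trunc (c w k) (n - k) = take (n - k) w"
    and "t \<ge> 0"
  shows "(\<lambda>n. ereal (1 / real n) *
            ext_log (\<Sum>\<^sub>\<infinity>w\<in>words G n.
              ennreal (\<Prod>k<n. scaling_function G X \<phi> (c w k) powr t)))
         \<longlonglongrightarrow> pressure G X \<phi> t"
proof -
  interpret cgdms G lam X \<phi> by (rule assms(1))
  interpret primitive_cgdms G lam X \<phi> by unfold_locales (rule assms(2), rule assms(3))
  show ?thesis
    by (rule growth_rate_transfer[OF scaling_sums_comparable[OF assms(4,5)] pressure_limit[OF assms(5)]])
qed

end
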